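(* Let $s\in C^2(\mathbb{R}^{B},\mathbb{R})$ satisfy (S1)-(S3), let $k\ge2$, assume that $( *_0)$ and $( *_1)$ hold, and let $\rho_1,\dots,\rho_4\in(0,\bar\rho)$ be chosen as in the context. If $l\in\mathbb{N}$ is sufficiently large, then for each $\mathbf{m}=(\mathbf{m}_1,\dots,\mathbf{m}_{4k})\in\mathbb{Z}^{4k}$ with $\mathbf{m}_i<\mathbf{m}_{i+1}$ for $1\le i<4k$ and $\mathbf{m}_j+2l<\mathbf{m}_{j+1}$ for even $j<4k$, there is a $U\in Y_{\mathbf{m},l}$ such that $J_1(U)=b_{\mathbf{m},l}=\inf_{Y_{\mathbf{m},l}}J_1$. Moreover, $U$ is a solution of (EL) provided that $\mathbf{m}_2-\mathbf{m}_1,\ \mathbf{m}_4-\mathbf{m}_3,\dots,\mathbf{m}_{4k}-\mathbf{m}_{4k-1}$ are large enough.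
   Context: Model. Fix integers $n\ge 2$, $r\ge 1$. For $\mathbf{i}=(\mathbf{i}_1,\dots,\mathbf{i}_n)\in\mathbb{Z}^n$ let $\|\mathbf{i}\|=\sum_k|\mathbf{i}_k|$, and let $B=\{\mathbf{k}\in\mathbb{Z}^n:\|\mathbf{k}\|\le r\}$. A configuration is a function $u:\mathbb{Z}^n\to\mathbb{R}$; inequalities between configurations are pointwise ($u<v$ means $u(\mathbf{j})<v(\mathbf{j})$ for all $\mathbf{j}$). A function $s\in C^2(\mathbb{R}^{B},\mathbb{R})$ satisfies: (S1) $s(u+1_B)=s(u)$ for all $u\in\mathbb{R}^B$, where $1_B$ is the constant function $1$; (S2) $s$ is bounded from below, and $s(u)\to\infty$ as $|u(\mathbf{k})-u(\mathbf{j})|\to\infty$ for $\mathbf{k},\mathbf{j}\in B$ with $\|\mathbf{k}-\mathbf{j}\|=1$; (S3) the second partial derivatives satisfy $\partial_{\mathbf{k},\mathbf{j}}s\le 0$ for all $\mathbf{k}\ne\mathbf{j}$ in $B$, and $\partial_{\mathbf{0},\mathbf{j}}s<0$ whenever $\|\mathbf{j}\|=1$. For a configuration $u$ and $\mathbf{j}\in\mathbb{Z}^n$ put $S_{\mathbf{j}}(u)=s\big((u(\mathbf{j}+\mathbf{k}))_{\mathbf{k}\in B}\big)$. The Euler-Lagrange equation is (EL): $\sum_{\mathbf{j}:\|\mathbf{j}-\mathbf{i}\|\le r}\partial_{\mathbf{i}}S_{\mathbf{j}}(u)=0$ for all $\mathbf{i}\in\mathbb{Z}^n$, where $\partial_{\mathbf{i}}$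 is the derivative with respect to $u(\mathbf{i})$. A solution is a configuration satisfying (EL). Periodic minimizers. A configuration is $1$-periodic in $\mathbf{i}_j$ if $u(\mathbf{i}+\mathbf{e}_j)=u(\mathbf{i})$ for all $\mathbf{i}$, $\mathbf{e}_j$ being the $j$th unit vector. Let $c_0=\inf S_{\mathbf{0}}(u)$ over configurations $u$ that are $1$-periodic in all directions, and let $\mathcal{M}_0$ be the set of such $u$ with $S_{\mathbf{0}}(u)=c_0$. In an ordered set $A$ of configurations, $v<w$ in $A$ are adjacent if no $u\in A$ satisfies $v<u<w$. Gap condition $( *_0)$: there are adjacent $v_0,w_0\in\mathcal{M}_0$ with $v_0<w_0$. Basic heteroclinics. For $v<w$ in $\mathcal{M}_0$ let $\hat\Gamma_1(v,w)$ be the set of configurations $u$ that are $1$-periodic in $\mathbf{i}_2,\dots,\mathbf{i}_n$ with $v\le u\le w$. With $\mathbf{T}_i=i\mathbf{e}_1$ and $\|u\|_{\mathbf{T}_i}=|u(\mathbf{T}_i)|$, let $\Gamma_1(v_0,w_0)$ (resp. $\Gamma_1(w_0,v_0)$) be the set of $u\in\hat\Gamma_1(v_0,w_0)$ with $\|u-v_0\|_{\mathbf{T}_i}\to0$ as $i\to-\infty$ and $\|u-w_0\|_{\mathbf{T}_i}\to0$ as $i\to\infty$ (resp. with $v_0$ and $w_0$ interchanged in these limits). Put $J_{1,p}(u)=S_{\mathbf{T}_p}(u)-c_0$, $J_{1;p,q}(u)=\sum_{j=p}^qJ_{1,j}(u)$, $J_1(u)=\liminf_{p\to-\infty,\,q\to\infty}J_{1;p,q}(u)$.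 Let $c_1(v_0,w_0)=\inf_{\Gamma_1(v_0,w_0)}J_1$ and $\mathcal{M}_1(v_0,w_0)=\{u\in\Gamma_1(v_0,w_0):J_1(u)=c_1(v_0,w_0)\}$; $c_1(w_0,v_0)$ and $\mathcal{M}_1(w_0,v_0)$ are defined in the same way from $\Gamma_1(w_0,v_0)$. Gap condition $( *_1)$: there are adjacent $v_1<w_1$ in $\mathcal{M}_1(v_0,w_0)$ and adjacent $\tilde v_1<\tilde w_1$ in $\mathcal{M}_1(w_0,v_0)$. Constrained problem. Let $\rho_-(u)=\|u-v_0\|_{\mathbf{T}_0}$, $\rho_+(u)=\|u-w_0\|_{\mathbf{T}_0}$, $\bar\rho=\|w_0-v_0\|_{\mathbf{T}_0}$, and $(\tau^1_{-i}u)(\mathbf{j})=u(\mathbf{j}+i\mathbf{e}_1)$. Under $( *_1)$ one can and does fix $\rho_1,\dots,\rho_4\in(0,\bar\rho)$ with $\rho_1\notin\rho_-(\mathcal{M}_1(v_0,w_0))$, $\rho_2\notin\rho_+(\mathcal{M}_1(v_0,w_0))$, $\rho_3\notin\rho_+(\mathcal{M}_1(w_0,v_0))$, $\rho_4\notin\rho_-(\mathcal{M}_1(w_0,v_0))$. For $l\in\mathbb{N}$ and $\mathbf{m}\in\mathbb{Z}^{4k}$ as in the claim, $Y_{\mathbf{m},l}$ is the set of $u\in\hat\Gamma_1(v_0,w_0)$ with $\|u-v_0\|_{\mathbf{T}_i}\to0$ as $|i|\to\infty$ and, for every $j=0,1,\dots,k-1$, (a) $\rho_-(\tau^1_{-i}u)\le\rho_1$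 for $\mathbf{m}_{1+4j}-l\le i\le\mathbf{m}_{1+4j}-1$; (b) $\rho_+(\tau^1_{-i}u)\le\rho_2$ for $\mathbf{m}_{2+4j}\le i\le\mathbf{m}_{2+4j}+l-1$; (c) $\rho_+(\tau^1_{-i}u)\le\rho_3$ for $\mathbf{m}_{3+4j}-l\le i\le\mathbf{m}_{3+4j}-1$; (d) $\rho_-(\tau^1_{-i}u)\le\rho_4$ for $\mathbf{m}_{4+4j}\le i\le\mathbf{m}_{4+4j}+l-1$. "Large enough" for the differences $\mathbf{m}_{2i}-\mathbf{m}_{2i-1}$ means: for the given $l$ there is $N$ such that the conclusion holds whenever all these differences are at least $N$. *)

theory Defs
  imports "HOL-Analysis.Analysis"
begin

type_synonym 'n config = "int ^ 'n \<Rightarrow> real"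

definition l1norm :: "int ^ 'n \<Rightarrow> int" where
  "l1norm i = (\<Sum>k\<in>UNIV. \<bar>i $ k\<bar>)"

definition Bset :: "nat \<Rightarrow> (int ^ 'n) set" where
  "Bset r = {k. l1norm k \<le> int r}"

text \<open>The order on configurations used throughout is strict at every site; it is stronger than
  the library's strict order on functions.\<close>

definition cless :: "'n::finite config \<Rightarrow> 'n config \<Rightarrow> bool"  (infix "\<prec>" 50) where
  "u \<prec> v \<longleftrightarrow> (\<forall>j. u j < v j)"

definition adjacent :: "'n::finite config set \<Rightarrow> 'n config \<Rightarrow> 'n config \<Rightarrow> bool" where
  "adjacent A v w \<longleftrightarrow> v \<in> A \<and> w \<in> A \<and> v \<prec> w \<and> \<not> (\<exists>u\<in>A. v \<prec> u \<and> u \<prec> w)"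


text \<open>For an index set I, the space of real functions on I is represented by the extensional
  functions, i.e. by the carrier of the product topology \<open>powertop_real I\<close>. Only the
  values of a function f on this carrier matter.\<close>

definition pderiv_at :: "'i \<Rightarrow> (('i \<Rightarrow> real) \<Rightarrow> real) \<Rightarrow> ('i \<Rightarrow> real) \<Rightarrow> real" where
  "pderiv_at k f u = deriv (\<lambda>t. f (u(k := t))) (u k)"

definition C1_on :: "'i set \<Rightarrow> (('i \<Rightarrow> real) \<Rightarrow> real) \<Rightarrow> bool" where
  "C1_on I f \<longleftrightarrow> continuous_map (powertop_real I) euclideanreal f \<and>
     (\<forall>k\<in>I. (\<forall>u\<in>extensional I. (\<lambda>t. f (u(k := t))) field_differentiable at (u k)) \<and>
            continuous_map (powertop_real I) euclideanreal (pderiv_at k f))"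

definition C2_on :: "'i set \<Rightarrow> (('i \<Rightarrow> real) \<Rightarrow> real) \<Rightarrow> bool" where
  "C2_on I f \<longleftrightarrow> C1_on I f \<and> (\<forall>k\<in>I. C1_on I (pderiv_at k f))"


definition S1 :: "nat \<Rightarrow> ('n::finite config \<Rightarrow> real) \<Rightarrow> bool" where
  "S1 r s \<longleftrightarrow> (\<forall>u\<in>extensional (Bset r). s (\<lambda>k\<in>Bset r. u k + 1) = s u)"

definition S2 :: "nat \<Rightarrow> ('n::finite config \<Rightarrow> real) \<Rightarrow> bool" where
  "S2 r s \<longleftrightarrow> bdd_below (s ` extensional (Bset r)) \<and>
     (\<forall>k\<in>Bset r. \<forall>j\<in>Bset r. l1norm (k - j) = 1 \<longrightarrow>
        (\<forall>M. \<exists>R. \<forall>u\<in>extensional (Bset r). \<bar>u k - u j\<bar> \<ge> R \<longrightarrow> s u \<ge> M))"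

definition S3 :: "nat \<Rightarrow> ('n::finite config \<Rightarrow> real) \<Rightarrow> bool" where
  "S3 r s \<longleftrightarrow> (\<forall>u\<in>extensional (Bset r).
     (\<forall>k\<in>Bset r. \<forall>j\<in>Bset r. k \<noteq> j \<longrightarrow> pderiv_at k (pderiv_at j s) u \<le> 0) \<and>
     (\<forall>j. l1norm j = 1 \<longrightarrow> pderiv_at 0 (pderiv_at j s) u < 0))"

definition Sloc :: "nat \<Rightarrow> ('n::finite config \<Rightarrow> real) \<Rightarrow> int ^ 'n \<Rightarrow> 'n config \<Rightarrow> real" where
  "Sloc r s j u = s (\<lambda>k\<in>Bset r. u (j + k))"

definition solution :: "nat \<Rightarrow> ('n::finite config \<Rightarrow> real) \<Rightarrow> 'n config \<Rightarrow> bool" where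
  "solution r s u \<longleftrightarrow>
     (\<forall>i. (\<Sum>j | l1norm (j - i) \<le> int r. pderiv_at i (Sloc r s j) u) = 0)"


definition periodic1 :: "'n \<Rightarrow> 'n::finite config \<Rightarrow> bool" where
  "periodic1 h u \<longleftrightarrow> (\<forall>i. u (i + axis h 1) = u i)"

definition c0 :: "nat \<Rightarrow> ('n::finite config \<Rightarrow> real) \<Rightarrow> real" where
  "c0 r s = Inf {Sloc r s 0 u | u. \<forall>h. periodic1 h u}"

definition M0 :: "nat \<Rightarrow> ('n::finite config \<Rightarrow> real) \<Rightarrow> 'n config set" where
  "M0 r s = {u. (\<forall>h. periodic1 h u) \<and> Sloc r s 0 u = c0 r s}"


text \<open>The coordinates are indexed by the finite type \<open>'n\<close>, which carries no order. The argument
  \<open>d\<close> below is the index of the first coordinate, so that \<open>axis d i\<close> is the site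
  $i\,\mathbf{e}_1 = \mathbf{T}_i$.\<close>

definition Tnorm :: "'n \<Rightarrow> int \<Rightarrow> 'n::finite config \<Rightarrow> real" where
  "Tnorm d i u = \<bar>u (axis d i)\<bar>"

definition Gamma1_hat :: "'n \<Rightarrow> 'n::finite config \<Rightarrow> 'n config \<Rightarrow> 'n config set" where
  "Gamma1_hat d v w = {u. (\<forall>h. h \<noteq> d \<longrightarrow> periodic1 h u) \<and> v \<le> u \<and> u \<le> w}"

text \<open>\<open>Gamma1 d v0 w0 a b\<close> consists of the configurations between \<open>v0\<close> and \<open>w0\<close> that are
  asymptotic to \<open>a\<close> at minus infinity and to \<open>b\<close> at plus infinity. The order
  interval is the same for both choices of \<open>(a, b)\<close>, namely \<open>(v0, w0)\<close> and \<open>(w0, v0)\<close>.\<close>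

definition Gamma1 ::
  "'n \<Rightarrow> 'n::finite config \<Rightarrow> 'n config \<Rightarrow> 'n config \<Rightarrow> 'n config \<Rightarrow> 'n config set" where
  "Gamma1 d v0 w0 a b = {u \<in> Gamma1_hat d v0 w0.
     ((\<lambda>i. Tnorm d i (\<lambda>j. u j - a j)) \<longlongrightarrow> 0) at_bot \<and>
     ((\<lambda>i. Tnorm d i (\<lambda>j. u j - b j)) \<longlongrightarrow> 0) at_top}"

definition J1_sum :: "nat \<Rightarrow> ('n::finite config \<Rightarrow> real) \<Rightarrow> 'n \<Rightarrow> int \<Rightarrow> int \<Rightarrow> 'n config \<Rightarrow> real" where
  "J1_sum r s d p q u = (\<Sum>j=p..q. (Sloc r s (axis d j) u - c0 r s))"

definition J1 :: "nat \<Rightarrow> ('n::finite config \<Rightarrow> real) \<Rightarrow> 'n \<Rightarrow> 'n config \<Rightarrow> ereal" where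
  "J1 r s d u = Liminf (at_bot \<times>\<^sub>F at_top) (\<lambda>(p, q). ereal (J1_sum r s d p q u))"

definition c1 :: "nat \<Rightarrow> ('n::finite config \<Rightarrow> real) \<Rightarrow> 'n \<Rightarrow>
    'n::finite config \<Rightarrow> 'n config \<Rightarrow> 'n config \<Rightarrow> 'n config \<Rightarrow> ereal" where
  "c1 r s d v0 w0 a b = (INF u\<in>Gamma1 d v0 w0 a b. J1 r s d u)"

definition M1 :: "nat \<Rightarrow> ('n::finite config \<Rightarrow> real) \<Rightarrow> 'n \<Rightarrow>
    'n::finite config \<Rightarrow> 'n config \<Rightarrow> 'n config \<Rightarrow> 'n config \<Rightarrow> 'n config set" where
  "M1 r s d v0 w0 a b = {u \<in> Gamma1 d v0 w0 a b. J1 r s d u = c1 r s d v0 w0 a b}"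


text \<open>\<open>rho d v0\<close> and \<open>rho d w0\<close> are $\rho_-$ and $\rho_+$; \<open>tau1 d i\<close> is $\tau^1_{-i}$.\<close>

definition rho :: "'n \<Rightarrow> 'n::finite config \<Rightarrow> 'n config \<Rightarrow> real" where
  "rho d v u = Tnorm d 0 (\<lambda>j. u j - v j)"

definition tau1 :: "'n \<Rightarrow> int \<Rightarrow> 'n::finite config \<Rightarrow> 'n config" where
  "tau1 d i u = (\<lambda>j. u (j + axis d i))"

text \<open>A tuple of integers with indices 1 to 4k is a function \<open>m\<close> on the naturals whose other
  values are irrelevant.\<close>

definition Yset :: "'n \<Rightarrow> 'n::finite config \<Rightarrow> 'n config \<Rightarrow> real \<Rightarrow> real \<Rightarrow> real \<Rightarrow> real \<Rightarrow>
    nat \<Rightarrow> (nat \<Rightarrow> int) \<Rightarrow> nat \<Rightarrow> 'n::finite config set" where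
  "Yset d v0 w0 \<rho>1 \<rho>2 \<rho>3 \<rho>4 k m l = {u \<in> Gamma1 d v0 w0 v0 v0. \<forall>j<k.
     (\<forall>i\<in>{m (1 + 4 * j) - int l .. m (1 + 4 * j) - 1}. rho d v0 (tau1 d i u) \<le> \<rho>1) \<and>
     (\<forall>i\<in>{m (2 + 4 * j) .. m (2 + 4 * j) + int l - 1}. rho d w0 (tau1 d i u) \<le> \<rho>2) \<and>
     (\<forall>i\<in>{m (3 + 4 * j) - int l .. m (3 + 4 * j) - 1}. rho d w0 (tau1 d i u) \<le> \<rho>3) \<and>
     (\<forall>i\<in>{m (4 + 4 * j) .. m (4 + 4 * j) + int l - 1}. rho d v0 (tau1 d i u) \<le> \<rho>4)}"

definition b_inf :: "nat \<Rightarrow> ('n::finite config \<Rightarrow> real) \<Rightarrow> 'n \<Rightarrow> 'n config \<Rightarrow> 'n config \<Rightarrow>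
    real \<Rightarrow> real \<Rightarrow> real \<Rightarrow> real \<Rightarrow> nat \<Rightarrow> (nat \<Rightarrow> int) \<Rightarrow> nat \<Rightarrow> ereal" where
  "b_inf r s d v0 w0 \<rho>1 \<rho>2 \<rho>3 \<rho>4 k m l = (INF u\<in>Yset d v0 w0 \<rho>1 \<rho>2 \<rho>3 \<rho>4 k m l. J1 r s d u)"

end

theory Submission
  imports Defs
begin

text \<open>
  A configuration that is 1-periodic in all directions but one is a sequence \<open>x\<close> with values in
  \<open>[a, b]\<close>, and the problem becomes one for a chain with a finite-range submodular interaction.
  A periodic chain has nonnegative energy, because the maximum of all translates of a nearly minimal
  periodic chain is constant and still nearly minimal. Hence the infimum \<open>\<phi>\<close> of the energies of all
  paths that lead to a given state is finite, and adding its coboundary to the energy density \<open>H\<close>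
  gives a density \<open>G \<ge> 0\<close> whose sum is $J_1$ up to a term that depends only on the two limits.
  A chain with \<open>G = 0\<close> is minimal, so it solves the Euler-Lagrange equation, and two such chains
  cannot touch by the strong comparison principle. This makes every loop from \<open>a\<close> to \<open>b\<close> and back cost
  a definite amount of energy; therefore chains of finite energy converge to \<open>a\<close> or \<open>b\<close> at both ends,
  and minimizing sequences in $Y_{m,l}$ cannot lose a loop at infinity. A minimizer that reaches the
  bound of one of its constraints contains a transition through a value which no minimal transition
  takes, and such a transition costs a definite amount more than a minimal one. If the transitions
  have enough room, gluing minimal transitions together is cheaper, so no constraint is active and
  the minimizer solves the Euler-Lagrange equation.
\<close>

subsection \<open>Chains with submodular interaction\<close>

text \<open>\<open>\<phi>\<close> is only shown to be bounded and continuous, so \<open>G\<close> is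
  neither differentiated nor used as a submodular density. Both operations are carried out on
  \<open>H\<close>: summed over a long interval, the terms in \<open>\<phi>\<close> telescope to two
  boundary values, which are bounded, converge where the chain converges, and do not see a change at
  a fixed site.

  Convergence at the ends is the delicate point. Finite energy makes \<open>G\<close> small far out,
  but this alone does not make the limsup S of a chain a ground state. A limit of translates attains
  S as its maximum, and the running maximum of the chain over 2r + 1 sites again has finite energy.
  In the limit \<open>G\<close> therefore vanishes on a block where the running maximum equals S
  throughout, and this forces S to be \<open>a\<close> or \<open>b\<close>.

  The two size conditions have different sources. The length \<open>l\<close> must force a chain of
  bounded energy to come close to a ground state inside every window; the bound is the energy of a
  competitor made of sharp steps, which fits every admissible \<open>m\<close>, so \<open>l\<close>
  can be chosen before \<open>m\<close>. The required size of the differences is the width of a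
  nearly minimal transition.\<close>

definition band :: "real \<Rightarrow> real \<Rightarrow> (int \<Rightarrow> real) set" where
  "band a b = {x. \<forall>i. a \<le> x i \<and> x i \<le> b}"

definition shift :: "int \<Rightarrow> (int \<Rightarrow> real) \<Rightarrow> int \<Rightarrow> real" where
  "shift i x = (\<lambda>j. x (i + j))"

lemma shift_apply [simp]: "shift i x j = x (i + j)"
  by (simp add: shift_def)

lemma shift_shift [simp]: "shift i (shift j x) = shift (i + j) x"
  by (auto simp: shift_def algebra_simps)

lemma shift_0 [simp]: "shift 0 x = x"
  by (auto simp: shift_def)

lemma shift_const [simp]: "shift i (\<lambda>_. c) = (\<lambda>_. c)"
  by (auto simp: shift_def)

lemma shift_sup: "shift i (sup x y) = sup (shift i x) (shift i y)"
  and shift_inf: "shift i (inf x y) = inf (shift i x) (shift i y)"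
  by (auto simp: shift_def)

lemma band_shift [simp]: "x \<in> band a b \<Longrightarrow> shift i x \<in> band a b"
  by (auto simp: band_def)

lemma band_sup [simp]: "x \<in> band a b \<Longrightarrow> y \<in> band a b \<Longrightarrow> sup x y \<in> band a b"
  by (auto simp: band_def sup_real_def le_max_iff_disj)

lemma band_inf [simp]: "x \<in> band a b \<Longrightarrow> y \<in> band a b \<Longrightarrow> inf x y \<in> band a b"
  by (auto simp: band_def inf_real_def min_le_iff_disj)

lemma band_const [simp]: "(\<lambda>_. c) \<in> band a b \<longleftrightarrow> a \<le> c \<and> c \<le> b"
  by (auto simp: band_def)

lemma band_upd: "x \<in> band a b \<Longrightarrow> a \<le> t \<Longrightarrow> t \<le> b \<Longrightarrow> x(i := t) \<in> band a b"
  by (auto simp: band_def)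

text \<open>Tychonoff's theorem; since the index set is countable, the product is first countable,
  so compactness gives convergent subsequences.\<close>

lemma band_seq_compact:
  assumes "\<And>n::nat. x n \<in> band a b"
  shows "\<exists>y\<in>band a b. \<exists>\<sigma>::nat \<Rightarrow> nat. strict_mono \<sigma> \<and> (\<forall>i. (\<lambda>n. x (\<sigma> n) i) \<longlonglongrightarrow> y i)"
proof -
  have band_eq: "band a b = PiE UNIV (\<lambda>_. {a..b})"
    by (auto simp: band_def)
  have "compactin (product_topology (\<lambda>_::int. euclidean) UNIV) (PiE UNIV (\<lambda>_. {a..b::real}))"
    by (subst compactin_PiE) auto
  then have "compact (band a b)"
    by (simp add: euclidean_product_topology band_eq)
  then have "seq_compact (band a b)"
    by (rule compact_imp_seq_compact)
  then obtain y \<sigma> where y: "y \<in> band a b" "strict_mono (\<sigma> :: nat \<Rightarrow> nat)" "(x \<circ> \<sigma>) \<longlonglongrightarrow> y"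
    using assms unfolding seq_compact_def by metis
  have "(\<lambda>n. x (\<sigma> n) i) \<longlonglongrightarrow> y i" for i
  proof -
    have "continuous_on UNIV (\<lambda>x::int \<Rightarrow> real. x i)"
      by simp
    from continuous_on_tendsto_compose[OF this y(3)] show ?thesis
      by (simp add: o_def)
  qed
  with y show ?thesis by blast
qed

text \<open>\<open>D p\<close> is the derivative of \<open>h\<close> with respect to site \<open>p\<close>. The strict inequality is assumed for
  \<open>D (-1)\<close> and \<open>D 1\<close> as functions of site 0, since (S3) is strict only for $\partial_{0,j} s$ in this
  order.\<close>

locale chain =
  fixes r :: int and h :: "(int \<Rightarrow> real) \<Rightarrow> real" and D :: "int \<Rightarrow> (int \<Rightarrow> real) \<Rightarrow> real"
    and a b :: real
  assumes r1: "r \<ge> 1" and ab: "a < b"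
    and h_local: "\<And>x y. (\<And>i. \<bar>i\<bar> \<le> r \<Longrightarrow> x i = y i) \<Longrightarrow> h x = h y"
    and h_cont: "\<And>x y. (\<And>i. (\<lambda>n. x n i) \<longlonglongrightarrow> y i) \<Longrightarrow> (\<lambda>n. h (x n)) \<longlonglongrightarrow> h y"
    and h_deriv: "\<And>x p. \<bar>p\<bar> \<le> r \<Longrightarrow> ((\<lambda>t. h (x(p := t))) has_real_derivative D p x) (at (x p))"
    and D_anti: "\<And>x y p. \<bar>p\<bar> \<le> r \<Longrightarrow> x \<le> y \<Longrightarrow> x p = y p \<Longrightarrow> D p y \<le> D p x"
    and D_strict: "\<And>x y p. \<bar>p\<bar> = 1 \<Longrightarrow> x \<le> y \<Longrightarrow> x p = y p \<Longrightarrow> x 0 < y 0 \<Longrightarrow> D p y < D p x"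
    and h_const_nonneg: "\<And>c. a \<le> c \<Longrightarrow> c \<le> b \<Longrightarrow> h (\<lambda>_. c) \<ge> 0"
    and h_const_0: "\<And>c. a \<le> c \<Longrightarrow> c \<le> b \<Longrightarrow> h (\<lambda>_. c) = 0 \<longleftrightarrow> c = a \<or> c = b"
    and D_const: "\<And>c. c \<in> {a, b} \<Longrightarrow> (\<Sum>p=-r..r. D p (\<lambda>_. c)) = 0"
begin

abbreviation "X \<equiv> band a b"

definition H :: "int \<Rightarrow> (int \<Rightarrow> real) \<Rightarrow> real" where
  "H i x = h (shift i x)"

lemma h_deriv_upd:
  assumes "\<bar>p\<bar> \<le> r"
  shows "((\<lambda>s. h (x(p := s))) has_real_derivative D p (x(p := t))) (at t)"
  using h_deriv[OF assms, of "x(p := t)"] by simp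

lemma h_submodular: "h (sup x y) + h (inf x y) \<le> h x + h y"
proof -
  \<comment> \<open>Raise the sites one at a time, from \<open>x\<close> to the supremum and from the infimum to \<open>y\<close>; each step
    costs more in the second case, by antimonotonicity of \<open>D\<close>.\<close>
  define xs where "xs n = (\<lambda>i. if i < -r + int n then sup x y i else x i)" for n
  define ys where "ys n = (\<lambda>i. if i < -r + int n then y i else inf x y i)" for n
  have "h (xs n) - h (ys n) \<le> h x - h (inf x y)" if "int n \<le> 2 * r + 1" for n
    using that
  proof (induction n)
    case 0
    have "h (xs 0) = h x" "h (ys 0) = h (inf x y)"
      by (auto intro!: h_local simp: xs_def ys_def)
    then show ?case by linarith
  next
    case (Suc n)
    define p where "p = -r + int n"
    have p: "\<bar>p\<bar> \<le> r" using Suc.prems by (simp add: p_def)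
    have "h (xs (Suc n)) - h (ys (Suc n)) \<le> h (xs n) - h (ys n)"
    proof (cases "y p \<le> x p")
      case True
      have "xs (Suc n) = xs n" "ys (Suc n) = ys n"
        using True by (auto simp: fun_eq_iff xs_def ys_def p_def sup_real_def inf_real_def
            max_def min_def not_less order_le_less)
      then show ?thesis by simp
    next
      case False
      have eq: "xs (Suc n) = (xs n)(p := y p)" "ys (Suc n) = (ys n)(p := y p)"
          "xs n = (xs n)(p := x p)" "ys n = (ys n)(p := x p)"
        using False by (auto simp: fun_eq_iff xs_def ys_def p_def sup_real_def inf_real_def)
      have le: "ys n \<le> xs n"
        by (auto simp: le_fun_def xs_def ys_def)
      define g where "g t = h ((xs n)(p := t)) - h ((ys n)(p := t))" for t
      have "g (y p) \<le> g (x p)"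
      proof (rule DERIV_nonpos_imp_nonincreasing[of "x p" "y p" g])
        show "x p \<le> y p" using False by simp
        fix t
        have "(g has_real_derivative D p ((xs n)(p := t)) - D p ((ys n)(p := t))) (at t)"
          unfolding g_def by (rule DERIV_diff[OF h_deriv_upd[OF p] h_deriv_upd[OF p]])
        moreover have "D p ((xs n)(p := t)) \<le> D p ((ys n)(p := t))"
          using le p by (intro D_anti) (auto simp: le_fun_def)
        ultimately show "\<exists>l. (g has_real_derivative l) (at t) \<and> l \<le> 0"
          by (intro exI conjI) auto
      qed
      then show ?thesis using eq by (simp add: g_def)
    qed
    with Suc show ?case by simp
  qed
  from this[of "nat (2 * r + 1)"] have "h (xs (nat (2 * r + 1))) - h (ys (nat (2 * r + 1))) \<le> h x - h (inf x y)"
    using r1 by simp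
  moreover have "h (xs (nat (2 * r + 1))) = h (sup x y)" "h (ys (nat (2 * r + 1))) = h y"
    using r1 by (auto intro!: h_local simp: xs_def ys_def)
  ultimately show ?thesis by simp
qed

lemma H_submodular: "H i (sup x y) + H i (inf x y) \<le> H i x + H i y"
  by (simp add: H_def shift_sup shift_inf h_submodular)

lemma H_local: "(\<And>j. \<bar>j - i\<bar> \<le> r \<Longrightarrow> x j = y j) \<Longrightarrow> H i x = H i y"
  unfolding H_def by (rule h_local) simp

lemma H_shift: "H i (shift j x) = H (i + j) x"
  by (simp add: H_def)

lemma h_unif_cont:
  assumes "\<eta> > 0"
  shows "\<exists>\<epsilon>>0. \<forall>x\<in>X. \<forall>y\<in>X. (\<forall>i. \<bar>i\<bar> \<le> r \<longrightarrow> \<bar>x i - y i\<bar> \<le> \<epsilon>) \<longrightarrow> \<bar>h x - h y\<bar> \<le> \<eta>"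
proof (rule ccontr)
  assume neg: "\<not> ?thesis"
  define P where "P n x y \<longleftrightarrow> x \<in> X \<and> y \<in> X \<and> (\<forall>i. \<bar>i\<bar> \<le> r \<longrightarrow> \<bar>x i - y i\<bar> \<le> 1 / real (Suc n)) \<and> \<bar>h x - h y\<bar> > \<eta>"
    for n x y
  have "\<exists>x y. P n x y" for n
  proof -
    have "1 / real (Suc n) > 0" by simp
    with neg show ?thesis unfolding not_le[symmetric] P_def by blast
  qed
  then obtain x y where "\<And>n. P n (x n) (y n)"
    by metis
  then have xy: "\<And>n. x n \<in> X" "\<And>n. y n \<in> X"
      "\<And>n i. \<bar>i\<bar> \<le> r \<Longrightarrow> \<bar>x n i - y n i\<bar> \<le> 1 / real (Suc n)" "\<And>n. \<bar>h (x n) - h (y n)\<bar> > \<eta>"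
    by (simp_all add: P_def)
  obtain z \<sigma> where z: "strict_mono (\<sigma> :: nat \<Rightarrow> nat)" "\<And>i. (\<lambda>n. x (\<sigma> n) i) \<longlonglongrightarrow> z i"
    using band_seq_compact[where x = x, OF xy(1)] by blast
  \<comment> \<open>The bound on the distance of \<open>x n\<close> and \<open>y n\<close> holds
    only on the range of \<open>h\<close>. Outside it \<open>y n\<close> is replaced by
    \<open>x n\<close>, which does not change \<open>h\<close> and makes the whole chain converge to
    \<open>z\<close>.\<close>
  define y' where "y' n = (\<lambda>i. if \<bar>i\<bar> \<le> r then y n i else x n i)" for n
  have "(\<lambda>n. y' (\<sigma> n) i) \<longlonglongrightarrow> z i" for i
  proof -
    have "(\<lambda>n. y' (\<sigma> n) i - x (\<sigma> n) i) \<longlonglongrightarrow> 0"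
    proof (rule Lim_null_comparison)
      have "norm (y' (\<sigma> n) i - x (\<sigma> n) i) \<le> 1 / real (Suc n)" for n
      proof -
        have "norm (y' (\<sigma> n) i - x (\<sigma> n) i) \<le> 1 / real (Suc (\<sigma> n))"
          using xy(3)[of i "\<sigma> n"] by (auto simp: y'_def abs_minus_commute)
        also have "\<dots> \<le> 1 / real (Suc n)"
          using seq_suble[OF z(1), of n] by (intro divide_left_mono) auto
        finally show ?thesis .
      qed
      then show "\<forall>\<^sub>F n in sequentially. norm (y' (\<sigma> n) i - x (\<sigma> n) i) \<le> 1 / real (Suc n)"
        by simp
      show "(\<lambda>n. 1 / real (Suc n)) \<longlonglongrightarrow> 0"
        using LIMSEQ_inverse_real_of_nat by (simp add: inverse_eq_divide)
    qed
    from tendsto_add[OF this z(2)[of i]] show ?thesis by simp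
  qed
  then have "(\<lambda>n. h (y' (\<sigma> n))) \<longlonglongrightarrow> h z" by (rule h_cont)
  moreover have "h (y' n) = h (y n)" for n
    by (rule h_local) (simp add: y'_def)
  moreover have "(\<lambda>n. h (x (\<sigma> n))) \<longlonglongrightarrow> h z" using z(2) by (rule h_cont)
  ultimately have "(\<lambda>n. \<bar>h (x (\<sigma> n)) - h (y (\<sigma> n))\<bar>) \<longlonglongrightarrow> \<bar>h z - h z\<bar>"
    by (intro tendsto_intros) auto
  moreover have "\<forall>n\<ge>0. \<eta> \<le> \<bar>h (x (\<sigma> n)) - h (y (\<sigma> n))\<bar>"
    using xy(4) by (auto intro: less_imp_le)
  ultimately have "\<eta> \<le> \<bar>h z - h z\<bar>"
    by (intro LIMSEQ_le_const[where a = \<eta>]) blast+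
  with assms show False by simp
qed

lemma h_bounded: "\<exists>M>0. \<forall>x\<in>X. \<bar>h x\<bar> \<le> M"
proof (rule ccontr)
  assume neg: "\<not> ?thesis"
  define P where "P n x \<longleftrightarrow> x \<in> X \<and> \<bar>h x\<bar> > real (Suc n)" for n x
  have "\<exists>x. P n x" for n
  proof -
    have "real (Suc n) > 0" by simp
    with neg show ?thesis unfolding not_le[symmetric] P_def by blast
  qed
  then obtain x where "\<And>n. P n (x n)"
    by metis
  then have x: "\<And>n. x n \<in> X" "\<And>n. \<bar>h (x n)\<bar> > real (Suc n)"
    by (simp_all add: P_def)
  obtain z \<sigma> where z: "strict_mono (\<sigma> :: nat \<Rightarrow> nat)" "\<And>i. (\<lambda>n. x (\<sigma> n) i) \<longlonglongrightarrow> z i"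
    using band_seq_compact[where x = x, OF x(1)] by blast
  have "(\<lambda>n. h (x (\<sigma> n))) \<longlonglongrightarrow> h z" using z(2) by (rule h_cont)
  then have "Bseq (\<lambda>n. h (x (\<sigma> n)))"
    by (intro convergent_imp_Bseq) (auto simp: convergent_def)
  then obtain K where K: "\<And>n. \<bar>h (x (\<sigma> n))\<bar> \<le> K"
    by (auto simp: Bseq_def)
  obtain n where "real n > K" using reals_Archimedean2 by blast
  with K[of n] x(2)[of "\<sigma> n"] seq_suble[OF z(1), of n] show False by simp
qed

end

text \<open>Serves to compare the energies of two chains whose densities differ at boundedly many
  sites.\<close>

lemma sum_le_except:
  fixes f g :: "'i \<Rightarrow> real"
  assumes "finite S" "c \<ge> 0"
    and "\<And>j. j \<in> A \<Longrightarrow> f j \<le> g j + (if j \<in> S then c else 0)"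
  shows "sum f A \<le> sum g A + c * real (card S)"
proof (cases "finite A")
  case True
  have "sum f A \<le> (\<Sum>j\<in>A. g j + (if j \<in> S then c else 0))"
    using assms(3) by (rule sum_mono)
  also have "\<dots> = sum g A + (\<Sum>j\<in>A. if j \<in> S then c else 0)"
    by (rule sum.distrib)
  also have "(\<Sum>j\<in>A. if j \<in> S then c else 0) = c * real (card (A \<inter> S))"
    using True by (simp flip: sum.inter_restrict)
  also have "\<dots> \<le> c * real (card S)"
    using assms(1,2) by (intro mult_left_mono) (auto intro: card_mono)
  finally show ?thesis by simp
next
  case False
  with assms(2) show ?thesis by simp
qed

text \<open>\<open>rmax k x i\<close> is the maximum of \<open>x\<close> over the sites from
  \<open>i\<close> to \<open>i + k\<close>. It is built by iteration because each step is a supremum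
  with one translate, to which submodularity applies.\<close>

definition rmax :: "nat \<Rightarrow> (int \<Rightarrow> real) \<Rightarrow> int \<Rightarrow> real" where
  "rmax k = (\<lambda>x. sup x (shift 1 x)) ^^ k"

definition rmin :: "nat \<Rightarrow> (int \<Rightarrow> real) \<Rightarrow> int \<Rightarrow> real" where
  "rmin k = (\<lambda>x. inf x (shift 1 x)) ^^ k"

lemma rmax_simps [simp]: "rmax 0 x = x" "rmax (Suc k) x = sup (rmax k x) (shift 1 (rmax k x))"
  and rmin_simps [simp]: "rmin 0 x = x" "rmin (Suc k) x = inf (rmin k x) (shift 1 (rmin k x))"
  by (simp_all add: rmax_def rmin_def)

lemma rmax_band [simp]: "x \<in> band a b \<Longrightarrow> rmax k x \<in> band a b"
  and rmin_band [simp]: "x \<in> band a b \<Longrightarrow> rmin k x \<in> band a b"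
  by (induction k) auto

lemma rmax_ge: "i \<le> j \<Longrightarrow> j \<le> i + int k \<Longrightarrow> x j \<le> rmax k x i"
proof (induction k arbitrary: i)
  case (Suc k)
  show ?case
  proof (cases "j = i + int (Suc k)")
    case True
    then have "x j \<le> rmax k x (1 + i)" by (intro Suc.IH) auto
    then show ?thesis by (auto simp: sup_real_def)
  next
    case False
    with Suc.prems have "x j \<le> rmax k x i" by (intro Suc.IH) auto
    then show ?thesis by (auto simp: sup_real_def)
  qed
qed simp

lemma rmin_le: "i \<le> j \<Longrightarrow> j \<le> i + int k \<Longrightarrow> rmin k x i \<le> x j"
proof (induction k arbitrary: i)
  case (Suc k)
  show ?case
  proof (cases "j = i + int (Suc k)")
    case True
    then have "rmin k x (1 + i) \<le> x j" by (intro Suc.IH) auto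
    then show ?thesis by (auto simp: inf_real_def)
  next
    case False
    with Suc.prems have "rmin k x i \<le> x j" by (intro Suc.IH) auto
    then show ?thesis by (auto simp: inf_real_def)
  qed
qed simp

lemma rmax_le: "(\<And>j. i \<le> j \<Longrightarrow> j \<le> i + int k \<Longrightarrow> x j \<le> c) \<Longrightarrow> rmax k x i \<le> c"
proof (induction k arbitrary: i)
  case (Suc k)
  have "rmax k x i \<le> c" "rmax k x (1 + i) \<le> c"
    by (rule Suc.IH, rule Suc.prems; simp)+
  then show ?case by simp
qed simp

lemma rmin_ge: "(\<And>j. i \<le> j \<Longrightarrow> j \<le> i + int k \<Longrightarrow> c \<le> x j) \<Longrightarrow> c \<le> rmin k x i"
proof (induction k arbitrary: i)
  case (Suc k)
  have "c \<le> rmin k x i" "c \<le> rmin k x (1 + i)"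
    by (rule Suc.IH, rule Suc.prems; simp)+
  then show ?case by simp
qed simp

section \<open>Euler-Lagrange residual, strong comparison and periodic chains\<close>

context chain
begin

text \<open>The derivative of the formal total energy with respect to site \<open>i\<close>: the
  density \<open>H (i - p)\<close> sees this site at position \<open>p\<close>, and only finitely
  many densities see it.\<close>

definition E :: "int \<Rightarrow> (int \<Rightarrow> real) \<Rightarrow> real" where
  "E i x = (\<Sum>p=-r..r. D p (shift (i - p) x))"

lemma E_deriv:
  "((\<lambda>t. \<Sum>j=i-r..i+r. H j (x(i := t))) has_real_derivative E i x) (at (x i))"
proof -
  have "((\<lambda>t. H j (x(i := t))) has_real_derivative D (i - j) (shift j x)) (at (x i))"
    if "j \<in> {i-r..i+r}" for j
  proof -
    have "H j (x(i := t)) = h ((shift j x)(i - j := t))" for t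
      unfolding H_def by (rule arg_cong[where f = h]) (auto simp: fun_eq_iff)
    moreover have "((\<lambda>t. h ((shift j x)(i - j := t))) has_real_derivative D (i - j) (shift j x)) (at (shift j x (i - j)))"
      using that by (intro h_deriv) auto
    ultimately show ?thesis by simp
  qed
  then have "((\<lambda>t. \<Sum>j=i-r..i+r. H j (x(i := t))) has_real_derivative (\<Sum>j=i-r..i+r. D (i - j) (shift j x))) (at (x i))"
    by (rule DERIV_sum)
  also have "(\<Sum>j=i-r..i+r. D (i - j) (shift j x)) = E i x"
    unfolding E_def by (rule sum.reindex_bij_witness[of _ "\<lambda>p. i - p" "\<lambda>j. i - j"]) auto
  finally show ?thesis .
qed

lemma E_strict_antimono:
  assumes "x \<le> y" "x i = y i" "x (i + 1) < y (i + 1) \<or> x (i - 1) < y (i - 1)"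
  shows "E i y < E i x"
proof -
  have "\<exists>p\<in>{-r..r}. D p (shift (i - p) y) < D p (shift (i - p) x)"
  proof (cases "x (i + 1) < y (i + 1)")
    case True
    \<comment> \<open>The term \<open>p = -1\<close> belongs to the density centred at
      \<open>i + 1\<close>: there the right neighbour is site 0 and \<open>i\<close> is site -1,
      which is the configuration of the strict inequality.\<close>
    with assms r1 show ?thesis
      by (intro bexI[of _ "-1"] D_strict) (auto simp: le_fun_def)
  next
    case False
    with assms r1 show ?thesis
      by (intro bexI[of _ 1] D_strict) (auto simp: le_fun_def)
  qed
  moreover have "\<forall>p\<in>{-r..r}. D p (shift (i - p) y) \<le> D p (shift (i - p) x)"
    using assms by (intro ballI D_anti) (auto simp: le_fun_def)
  ultimately show ?thesis
    unfolding E_def by (intro sum_strict_mono_ex1) auto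
qed

lemma E_const: "c \<in> {a, b} \<Longrightarrow> E i (\<lambda>_. c) = 0"
  using D_const[of c] by (simp add: E_def)

text \<open>At a contact site, a strict inequality at a neighbour would make \<open>E\<close>
  strictly smaller for the upper chain. Hence the neighbours are contact sites too, and contact
  spreads over the whole line.\<close>

lemma touching_eq:
  assumes "x \<le> y" "\<And>i. x i = y i \<Longrightarrow> E i x \<le> E i y" "x i0 = y i0"
  shows "x = y"
proof -
  have step: "x (i + 1) = y (i + 1) \<and> x (i - 1) = y (i - 1)" if "x i = y i" for i
    using E_strict_antimono[OF assms(1) that] assms(2)[OF that] assms(1)
    unfolding le_fun_def by (metis linorder_not_le order_le_less)
  have "x i = y i" for i
    by (induction i rule: int_induct[of _ i0]) (use assms(3) step in auto)
  then show ?thesis by auto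
qed

text \<open>The hypotheses are the variational inequalities of an obstacle problem with obstacles
  \<open>a\<close> and \<open>b\<close>. Both obstacles solve the equation, so by strong comparison
  a chain that touches one of them coincides with it, and otherwise both inequalities hold at every
  site.\<close>

lemma one_sided_EL:
  assumes "x \<in> X" "\<And>i. x i < b \<Longrightarrow> E i x \<ge> 0" "\<And>i. a < x i \<Longrightarrow> E i x \<le> 0"
  shows "(\<forall>i. E i x = 0) \<and> (x = (\<lambda>_. a) \<or> x = (\<lambda>_. b) \<or> (\<forall>i. a < x i \<and> x i < b))"
proof -
  have bd: "a \<le> x i" "x i \<le> b" for i using assms(1) by (auto simp: band_def)
  show ?thesis
  proof (cases "\<forall>i. a < x i \<and> x i < b")
    case True
    with assms(2,3) show ?thesis by (metis order_antisym)
  next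
    case False
    then obtain i0 where "\<not> (a < x i0 \<and> x i0 < b)" by blast
    with bd[of i0] have "x i0 = a \<or> x i0 = b" by linarith
    then have "x = (\<lambda>_. a) \<or> x = (\<lambda>_. b)"
    proof
      assume "x i0 = a"
      then have "(\<lambda>_. a) = x"
        using bd ab assms(2) E_const[of a]
        by (intro touching_eq[of _ _ i0]) (auto simp: le_fun_def)
      then show ?thesis by simp
    next
      assume "x i0 = b"
      then have "x = (\<lambda>_. b)"
        using bd ab assms(3) E_const[of b]
        by (intro touching_eq[of _ _ i0]) (auto simp: le_fun_def)
      then show ?thesis by simp
    qed
    then show ?thesis using E_const by auto
  qed
qed

lemma periodic_sum_nonneg:
  assumes x: "x \<in> X" and N: "N > 0" and per: "\<And>i. x (i + N) = x i"
  shows "0 \<le> (\<Sum>j\<in>{0..<N}. H j x)"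
proof -
  define P where "P = {x \<in> X. \<forall>i. x (i + N) = x i}"
  define f where "f x = (\<Sum>j\<in>{0..<N}. H j x)" for x
  obtain M where M: "M > 0" "\<And>x. x \<in> X \<Longrightarrow> \<bar>h x\<bar> \<le> M"
    using h_bounded by blast
  have f_lower: "f y \<ge> - (of_int N * M)" if "y \<in> X" for y
  proof -
    have "(\<Sum>j\<in>{0..<N}. - M) \<le> f y"
      unfolding f_def using that M(2)[OF band_shift[OF that]]
      by (intro sum_mono) (auto simp: H_def abs_le_iff minus_le_iff)
    then show ?thesis using N by simp
  qed
  then have bdd: "bdd_below (f ` P)"
    by (auto simp: P_def bdd_below_def)
  define m where "m = Inf (f ` P)"
  have m_le: "m \<le> f y" if "y \<in> P" for y
    unfolding m_def using bdd that by (intro cInf_lower) auto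
  have f_shift: "f (shift 1 y) = f y" if "y \<in> P" for y
  proof -
    have "H N y = H 0 y"
      unfolding H_def using that by (intro arg_cong[where f = h]) (auto simp: P_def fun_eq_iff add.commute)
    have "f (shift 1 y) = (\<Sum>j\<in>{0..<N}. H (j + 1) y)"
      by (simp add: f_def H_shift)
    also have "\<dots> = (\<Sum>j\<in>{1..<N+1}. H j y)"
      by (rule sum.reindex_bij_witness[of _ "\<lambda>j. j - 1" "\<lambda>j. j + 1"]) auto
    also have "{1..<N+1} = insert N {1..<N}" using N by auto
    also have "(\<Sum>j\<in>insert N {1..<N}. H j y) = (\<Sum>j\<in>insert 0 {1..<N}. H j y)"
      using \<open>H N y = H 0 y\<close> by simp
    also have "insert 0 {1..<N} = {0..<N}" using N by auto
    finally show ?thesis by (simp only: f_def)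
  qed
  have shift_P: "shift 1 y \<in> P" if "y \<in> P" for y
  proof -
    have "y (1 + (i + N)) = y (1 + i)" for i
    proof -
      have "y (1 + i + N) = y (1 + i)" using that unfolding P_def by blast
      then show ?thesis by (simp add: add.assoc)
    qed
    with that show ?thesis by (simp add: P_def)
  qed
  have sup_P: "sup y z \<in> P" and inf_P: "inf y z \<in> P" if "y \<in> P" "z \<in> P" for y z
    using that unfolding P_def by (auto intro: band_sup band_inf)
  have rmax_P: "rmax k y \<in> P" if "y \<in> P" for k y
  proof (induction k)
    case (Suc k)
    from sup_P[OF Suc shift_P[OF Suc]] show ?case by (simp only: rmax_simps)
  qed (use that in simp)
  \<comment> \<open>The infimum of two periodic chains is a competitor, so its energy is at least
    \<open>m\<close>; by submodularity one supremum with a translate at most doubles the excess over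
    \<open>m\<close>.\<close>
  have excess: "f (rmax k y) - m \<le> 2 ^ k * (f y - m)" if "y \<in> P" for k y
  proof (induction k)
    case (Suc k)
    let ?z = "rmax k y"
    have zP: "?z \<in> P" "shift 1 ?z \<in> P" using rmax_P[OF that] shift_P by blast+
    then have "inf ?z (shift 1 ?z) \<in> P" by (rule inf_P)
    then have "m \<le> f (inf ?z (shift 1 ?z))" by (rule m_le)
    moreover have "f (sup ?z (shift 1 ?z)) + f (inf ?z (shift 1 ?z)) \<le> f ?z + f (shift 1 ?z)"
      unfolding f_def sum.distrib[symmetric] by (intro sum_mono H_submodular)
    moreover have "f (shift 1 ?z) = f ?z" using zP(1) by (rule f_shift)
    ultimately have "f (rmax (Suc k) y) - m \<le> 2 * (f ?z - m)"
      unfolding rmax_simps by argo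
    also have "\<dots> \<le> 2 * (2 ^ k * (f y - m))"
      using Suc by (intro mult_left_mono) auto
    finally show ?case by (simp only: power_Suc mult.assoc)
  qed simp
  \<comment> \<open>A running maximum over a full period is the same at every site.\<close>
  have const: "f (rmax (nat N) y) \<ge> 0" if "y \<in> P" for y
  proof -
    have y1: "y (i + N) = y i" for i using that by (simp add: P_def)
    have yN: "y (i + k * N) = y i" for i k
    proof (induction k rule: int_induct[of _ 0])
      case (step1 k)
      have "i + (k + 1) * N = i + k * N + N" by (simp add: algebra_simps)
      with step1 show ?case by (simp only: y1)
    next
      case (step2 k)
      have "i + k * N = i + (k - 1) * N + N" by (simp add: algebra_simps)
      with step2 show ?case by (simp only: y1)
    qed simp
    have ge: "y j \<le> rmax (nat N) y i" for i j
    proof -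
      have "y (i + (j - i) mod N + (j - i) div N * N) = y (i + (j - i) mod N)" by (rule yN)
      moreover have "i + (j - i) mod N + (j - i) div N * N = j" by (simp add: add.assoc)
      moreover have "y (i + (j - i) mod N) \<le> rmax (nat N) y i"
        using N by (intro rmax_ge) (auto intro: less_imp_le)
      ultimately show ?thesis by simp
    qed
    have "rmax (nat N) y i \<le> rmax (nat N) y 0" for i
      by (rule rmax_le) (rule ge)
    moreover have "rmax (nat N) y 0 \<le> rmax (nat N) y i" for i
      by (rule rmax_le) (rule ge)
    ultimately obtain c where c: "rmax (nat N) y = (\<lambda>_. c)"
      by (metis (no_types) order_antisym ext)
    have "rmax (nat N) y \<in> X" using that by (simp add: P_def)
    then have "0 \<le> h (\<lambda>_. c)" unfolding c by (intro h_const_nonneg) auto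
    then show ?thesis unfolding f_def c H_def by (auto intro: sum_nonneg)
  qed
  have xP: "x \<in> P" using x per by (auto simp: P_def)
  have "m \<ge> 0"
  proof (rule ccontr)
    assume "\<not> m \<ge> 0"
    then have "m < 0" by simp
    \<comment> \<open>The excess doubles at most \<open>nat N\<close> times. Starting below
      \<open>- m / ?C\<close>, it stays below \<open>- m\<close>, so the resulting constant chain
      would have negative energy.\<close>
    let ?C = "2 ^ nat N :: real"
    have "Inf (f ` P) < m + - m / ?C" using \<open>m < 0\<close> by (simp add: m_def field_simps)
    then obtain y where y: "y \<in> P" "f y < m - m / ?C"
      using xP bdd by (subst (asm) cInf_less_iff) auto
    then have "?C * (f y - m) < - m" by (simp add: field_simps)
    with excess[OF y(1), of "nat N"] const[OF y(1)] show False by linarith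
  qed
  with m_le[OF xP] show ?thesis by (simp add: f_def)
qed

text \<open>Repeating the segment periodically changes the densities only within \<open>r\<close>
  sites of its two ends, and the periodic chain has nonnegative energy.\<close>

lemma sum_H_lower: "\<exists>K\<ge>0. \<forall>x\<in>X. \<forall>p q. - K \<le> (\<Sum>j\<in>{p..<q}. H j x)"
proof -
  obtain M where M: "M > 0" "\<And>x. x \<in> X \<Longrightarrow> \<bar>h x\<bar> \<le> M"
    using h_bounded by blast
  have "- (2 * M * (2 * of_int r)) \<le> (\<Sum>j\<in>{p..<q}. H j x)" if x: "x \<in> X" for x p q
  proof (cases "p < q")
    case True
    define N where "N = q - p"
    have N: "N > 0" using True by (simp add: N_def)
    define y where "y = (\<lambda>i. x (p + (i - p) mod N))"
    have y: "y \<in> X" using x by (auto simp: y_def band_def)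
    have y_per: "shift p y (i + N) = shift p y i" for i
      by (simp add: y_def)
    have "0 \<le> (\<Sum>j\<in>{0..<N}. H j (shift p y))"
      using band_shift[OF y] N y_per by (rule periodic_sum_nonneg)
    also have "\<dots> = (\<Sum>j\<in>{p..<q}. H j y)"
      unfolding H_shift by (rule sum.reindex_bij_witness[of _ "\<lambda>j. j - p" "\<lambda>j. j + p"]) (auto simp: N_def)
    also have "\<dots> \<le> (\<Sum>j\<in>{p..<q}. H j x) + 2 * M * real (card ({p..<p+r} \<union> {q-r..<q}))"
    proof (rule sum_le_except)
      fix j assume j: "j \<in> {p..<q}"
      show "H j y \<le> H j x + (if j \<in> {p..<p+r} \<union> {q-r..<q} then 2 * M else 0)"
      proof (cases "j \<in> {p..<p+r} \<union> {q-r..<q}")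
        case True
        then show ?thesis using M(2)[OF band_shift[OF x], of j] M(2)[OF band_shift[OF y], of j]
          by (auto simp: H_def)
      next
        case False
        then have "H j y = H j x"
          using j by (intro H_local) (auto simp: y_def N_def)
        then show ?thesis using False M(1) by auto
      qed
    qed (use M in auto)
    also have "card ({p..<p+r} \<union> {q-r..<q}) \<le> 2 * nat r"
      by (rule order_trans[OF card_Un_le]) simp
    finally show ?thesis using M r1 by (simp add: mult_le_cancel_left)
  next
    case False
    then show ?thesis using M r1 by simp
  qed
  moreover have "2 * M * (2 * of_int r) \<ge> 0" using M r1 by simp
  ultimately show ?thesis by blast
qed

subsection \<open>The corrected energy density\<close>

text \<open>The sites from \<open>-r\<close> to \<open>r - 1\<close> form the state: densities at
  negative sites read nothing to their right, and densities at nonnegative sites read nothing to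
  their left. A path may be prolonged across the state without changing its past energy.\<close>

definition path_sums :: "(int \<Rightarrow> real) \<Rightarrow> real set" where
  "path_sums x = {\<Sum>j\<in>{-n..<0}. H j y | n y. 0 \<le> n \<and> y \<in> X \<and> (\<forall>i\<in>{-r..<r}. y i = x i)}"

definition \<phi> :: "(int \<Rightarrow> real) \<Rightarrow> real" where
  "\<phi> x = Inf (path_sums x)"

lemma path_sumsI:
  "0 \<le> n \<Longrightarrow> y \<in> X \<Longrightarrow> (\<And>i. -r \<le> i \<Longrightarrow> i < r \<Longrightarrow> y i = x i) \<Longrightarrow> (\<Sum>j\<in>{-n..<0}. H j y) \<in> path_sums x"
  unfolding path_sums_def mem_Collect_eq by (intro exI[of _ n] exI[of _ y]) auto

lemma path_sums_nonempty: "x \<in> X \<Longrightarrow> 0 \<in> path_sums x"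
  using path_sumsI[of 0 x x] by simp

lemma path_sums_bdd: "bdd_below (path_sums x)"
proof -
  obtain K where "\<And>x p q. x \<in> X \<Longrightarrow> - K \<le> (\<Sum>j\<in>{p..<q}. H j x)"
    using sum_H_lower by blast
  then show ?thesis unfolding path_sums_def by (intro bdd_belowI[of _ "- K"]) auto
qed

lemma \<phi>_bounded: "\<exists>K\<ge>0. \<forall>x\<in>X. \<bar>\<phi> x\<bar> \<le> K"
proof -
  obtain K where K: "K \<ge> 0" "\<And>x p q. x \<in> X \<Longrightarrow> - K \<le> (\<Sum>j\<in>{p..<q}. H j x)"
    using sum_H_lower by blast
  have "\<bar>\<phi> x\<bar> \<le> K" if "x \<in> X" for x
  proof -
    have "\<phi> x \<le> 0"
      unfolding \<phi>_def using path_sums_nonempty[OF that] path_sums_bdd by (rule cInf_lower)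
    moreover have "- K \<le> \<phi> x"
      unfolding \<phi>_def using path_sums_nonempty[OF that] K(2)
      by (intro cInf_greatest) (auto simp: path_sums_def)
    ultimately show ?thesis using K(1) by auto
  qed
  with K(1) show ?thesis by blast
qed

lemma \<phi>_local: "(\<And>i. -r \<le> i \<Longrightarrow> i < r \<Longrightarrow> x i = y i) \<Longrightarrow> \<phi> x = \<phi> y"
  unfolding \<phi>_def path_sums_def by (intro arg_cong[where f = Inf]) auto

text \<open>Replacing the final state of a path affects only the densities from
  \<open>-2 * r\<close> to \<open>-1\<close>, each by at most \<open>\<eta>\<close>.\<close>

lemma \<phi>_le_close:
  assumes x: "x \<in> X" and x': "x' \<in> X" and "\<eta> \<ge> 0"
    and close: "\<And>y y' j. y \<in> X \<Longrightarrow> y' \<in> X \<Longrightarrow> (\<And>i. \<bar>i\<bar> \<le> r \<Longrightarrow> \<bar>y i - y' i\<bar> \<le> \<epsilon>) \<Longrightarrow> \<bar>h y - h y'\<bar> \<le> \<eta>"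
    and eps: "\<epsilon> \<ge> 0" "\<And>i. -r \<le> i \<Longrightarrow> i < r \<Longrightarrow> \<bar>x i - x' i\<bar> \<le> \<epsilon>"
  shows "\<phi> x' \<le> \<phi> x + \<eta> * (2 * of_int r)"
proof -
  have "\<phi> x' - \<eta> * (2 * of_int r) \<le> \<phi> x"
    unfolding \<phi>_def[of x]
  proof (rule cInf_greatest)
    show "path_sums x \<noteq> {}" using path_sums_nonempty[OF x] by auto
    fix z assume "z \<in> path_sums x"
    then obtain n y where z: "z = (\<Sum>j\<in>{-n..<0}. H j y)" and n: "0 \<le> n" and y: "y \<in> X"
      and yx: "\<And>i. -r \<le> i \<Longrightarrow> i < r \<Longrightarrow> y i = x i"
      unfolding path_sums_def by auto
    define y' where "y' = (\<lambda>i. if -r \<le> i \<and> i < r then x' i else y i)"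
    have y': "y' \<in> X" using y x' by (auto simp: band_def y'_def)
    have "\<phi> x' \<le> (\<Sum>j\<in>{-n..<0}. H j y')"
      unfolding \<phi>_def using n y' by (intro cInf_lower path_sums_bdd path_sumsI) (auto simp: y'_def)
    also have "\<dots> \<le> (\<Sum>j\<in>{-n..<0}. H j y) + \<eta> * real (card {-2*r..<0})"
    proof (rule sum_le_except)
      fix j assume j: "j \<in> {-n..<0}"
      show "H j y' \<le> H j y + (if j \<in> {-2*r..<0} then \<eta> else 0)"
      proof (cases "j \<in> {-2*r..<0}")
        case True
        have "\<bar>h (shift j y) - h (shift j y')\<bar> \<le> \<eta>"
          using y y' yx eps by (intro close) (auto simp: y'_def)
        with True show ?thesis by (auto simp: H_def)
      next
        case False
        then have "H j y' = H j y" using j by (intro H_local) (auto simp: y'_def)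
        with False show ?thesis by auto
      qed
    qed (use \<open>\<eta> \<ge> 0\<close> in auto)
    also have "\<dots> = z + \<eta> * (2 * of_int r)" using r1 by (simp add: z)
    finally show "\<phi> x' - \<eta> * (2 * of_int r) \<le> z" by simp
  qed
  then show ?thesis by simp
qed

lemma \<phi>_unif_cont:
  assumes "\<eta> > 0"
  shows "\<exists>\<epsilon>>0. \<forall>x\<in>X. \<forall>y\<in>X. (\<forall>i. -r \<le> i \<and> i < r \<longrightarrow> \<bar>x i - y i\<bar> \<le> \<epsilon>) \<longrightarrow> \<bar>\<phi> x - \<phi> y\<bar> \<le> \<eta>"
proof -
  define \<eta>' where "\<eta>' = \<eta> / (2 * of_int r)"
  have \<eta>': "\<eta>' > 0" "\<eta>' * (2 * of_int r) = \<eta>" using assms r1 by (simp_all add: \<eta>'_def)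
  obtain \<epsilon> where e: "\<epsilon> > 0" "\<And>x y. x \<in> X \<Longrightarrow> y \<in> X \<Longrightarrow> (\<And>i. \<bar>i\<bar> \<le> r \<Longrightarrow> \<bar>x i - y i\<bar> \<le> \<epsilon>) \<Longrightarrow> \<bar>h x - h y\<bar> \<le> \<eta>'"
    using h_unif_cont[OF \<eta>'(1)] by blast
  have le: "\<phi> y \<le> \<phi> x + \<eta>" if "x \<in> X" "y \<in> X" "\<And>i. -r \<le> i \<Longrightarrow> i < r \<Longrightarrow> \<bar>x i - y i\<bar> \<le> \<epsilon>" for x y
    using \<phi>_le_close[OF that(1,2), of \<eta>' \<epsilon>] e \<eta>' that(3) by auto
  have "\<bar>\<phi> x - \<phi> y\<bar> \<le> \<eta>" if *: "x \<in> X" "y \<in> X" "\<And>i. -r \<le> i \<Longrightarrow> i < r \<Longrightarrow> \<bar>x i - y i\<bar> \<le> \<epsilon>" for x y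
    using le[OF *] le[OF *(2,1)] *(3) by (simp add: abs_minus_commute abs_le_iff)
  with e(1) show ?thesis by blast
qed

text \<open>The dynamic programming inequality: a path to \<open>x\<close>, prolonged by one site,
  is a path to the translated state. This is what makes \<open>G\<close> nonnegative.\<close>

lemma \<phi>_shift_le:
  assumes x: "x \<in> X"
  shows "\<phi> (shift 1 x) \<le> \<phi> x + h x"
proof -
  have "\<phi> (shift 1 x) - h x \<le> \<phi> x"
    unfolding \<phi>_def[of x]
  proof (rule cInf_greatest)
    show "path_sums x \<noteq> {}" using path_sums_nonempty[OF x] by auto
    fix z assume "z \<in> path_sums x"
    then obtain n y where z: "z = (\<Sum>j\<in>{-n..<0}. H j y)" and n: "0 \<le> n" and y: "y \<in> X"
      and yx: "\<And>i. -r \<le> i \<Longrightarrow> i < r \<Longrightarrow> y i = x i"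
      unfolding path_sums_def by auto
    \<comment> \<open>The density at 0 reads the sites up to \<open>r\<close>. The path covers them
      up to \<open>r - 1\<close>, where it agrees with \<open>x\<close>, and site \<open>r\<close>
      is taken from \<open>x\<close>.\<close>
    define y' where "y' = (\<lambda>i. if i < r then y i else x i)"
    have y': "y' \<in> X" using y x by (auto simp: band_def y'_def)
    have "\<phi> (shift 1 x) \<le> (\<Sum>j\<in>{-(n+1)..<0}. H j (shift 1 y'))"
      unfolding \<phi>_def using n y' yx by (intro cInf_lower path_sums_bdd path_sumsI) (auto simp: y'_def)
    also have "\<dots> = (\<Sum>j\<in>{-n..<1}. H j y')"
      unfolding H_shift by (rule sum.reindex_bij_witness[of _ "\<lambda>j. j - 1" "\<lambda>j. j + 1"]) auto
    also have "{-n..<1} = insert 0 {-n..<0}" using n by auto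
    also have "(\<Sum>j\<in>insert 0 {-n..<0}. H j y') = H 0 y' + (\<Sum>j\<in>{-n..<0}. H j y')" by simp
    also have "H 0 y' = H 0 x" using yx by (intro H_local) (auto simp: y'_def)
    also have "(\<Sum>j\<in>{-n..<0}. H j y') = z"
      unfolding z by (intro sum.cong H_local) (auto simp: y'_def)
    finally show "\<phi> (shift 1 x) - h x \<le> z" unfolding H_def shift_0 by linarith
  qed
  then show ?thesis by simp
qed

definition G :: "int \<Rightarrow> (int \<Rightarrow> real) \<Rightarrow> real" where
  "G i x = H i x + \<phi> (shift i x) - \<phi> (shift (i + 1) x)"

abbreviation energy :: "int set \<Rightarrow> (int \<Rightarrow> real) \<Rightarrow> real" where
  "energy A x \<equiv> \<Sum>j\<in>A. G j x"

lemma G_nonneg: "x \<in> X \<Longrightarrow> 0 \<le> G i x"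
  using \<phi>_shift_le[OF band_shift, of x i] by (simp add: G_def H_def add.commute)

lemma G_shift: "G i (shift j x) = G (i + j) x"
  by (simp add: G_def H_shift algebra_simps)

lemma G_const: "G i (\<lambda>_. c) = h (\<lambda>_. c)"
  by (simp add: G_def H_def)

lemma G_const_0 [simp]: "c \<in> {a, b} \<Longrightarrow> G i (\<lambda>_. c) = 0"
  using h_const_0[of c] ab by (auto simp: G_const)

lemma G_unif_cont:
  assumes "\<eta> > 0"
  shows "\<exists>\<epsilon>>0. \<forall>x\<in>X. \<forall>y\<in>X. \<forall>i. (\<forall>j. \<bar>j - i\<bar> \<le> r \<longrightarrow> \<bar>x j - y j\<bar> \<le> \<epsilon>) \<longrightarrow> \<bar>G i x - G i y\<bar> \<le> \<eta>"
proof -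
  have \<eta>: "\<eta> / 3 > 0" using assms by simp
  obtain \<epsilon>1 where e1: "\<epsilon>1 > 0" "\<And>x y. x \<in> X \<Longrightarrow> y \<in> X \<Longrightarrow> (\<And>i. \<bar>i\<bar> \<le> r \<Longrightarrow> \<bar>x i - y i\<bar> \<le> \<epsilon>1) \<Longrightarrow> \<bar>h x - h y\<bar> \<le> \<eta> / 3"
    using h_unif_cont[OF \<eta>] by blast
  obtain \<epsilon>2 where e2: "\<epsilon>2 > 0" "\<And>x y. x \<in> X \<Longrightarrow> y \<in> X \<Longrightarrow> (\<And>i. -r \<le> i \<Longrightarrow> i < r \<Longrightarrow> \<bar>x i - y i\<bar> \<le> \<epsilon>2) \<Longrightarrow> \<bar>\<phi> x - \<phi> y\<bar> \<le> \<eta> / 3"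
    using \<phi>_unif_cont[OF \<eta>] by blast
  have "\<bar>G i x - G i y\<bar> \<le> \<eta>"
    if "x \<in> X" "y \<in> X" and c: "\<And>j. \<bar>j - i\<bar> \<le> r \<Longrightarrow> \<bar>x j - y j\<bar> \<le> min \<epsilon>1 \<epsilon>2" for x y i
  proof -
    have "\<bar>h (shift i x) - h (shift i y)\<bar> \<le> \<eta> / 3"
      using that by (intro e1) auto
    moreover have "\<bar>\<phi> (shift i x) - \<phi> (shift i y)\<bar> \<le> \<eta> / 3"
      using that by (intro e2) auto
    moreover have "\<bar>\<phi> (shift (i + 1) x) - \<phi> (shift (i + 1) y)\<bar> \<le> \<eta> / 3"
      using that by (intro e2) auto
    ultimately show ?thesis unfolding G_def H_def by linarith
  qed
  moreover have "min \<epsilon>1 \<epsilon>2 > 0" using e1(1) e2(1) by simp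
  ultimately show ?thesis by blast
qed

lemma G_local:
  assumes "x \<in> X" "y \<in> X" "\<And>j. \<bar>j - i\<bar> \<le> r \<Longrightarrow> x j = y j"
  shows "G i x = G i y"
proof -
  have "\<bar>G i x - G i y\<bar> \<le> 0 + \<eta>" if pos: "\<eta> > 0" for \<eta>
  proof -
    obtain \<epsilon> where "\<epsilon> > 0" "\<forall>x\<in>X. \<forall>y\<in>X. \<forall>i. (\<forall>j. \<bar>j - i\<bar> \<le> r \<longrightarrow> \<bar>x j - y j\<bar> \<le> \<epsilon>) \<longrightarrow> \<bar>G i x - G i y\<bar> \<le> \<eta>"
      using G_unif_cont[OF pos] by blast
    with assms show ?thesis by simp
  qed
  then have "\<bar>G i x - G i y\<bar> \<le> 0" by (rule field_le_epsilon)
  then show ?thesis by simp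
qed

lemma G_tendsto:
  assumes x: "\<And>n. x n \<in> X" and y: "y \<in> X" and lim: "\<And>i. ((\<lambda>n. x n i) \<longlongrightarrow> y i) F"
  shows "((\<lambda>n. G i (x n)) \<longlongrightarrow> G i y) F"
proof (rule tendstoI)
  fix \<eta> :: real assume "\<eta> > 0"
  then have \<eta>2: "\<eta> / 2 > 0" by simp
  obtain \<epsilon> where e: "\<epsilon> > 0" "\<And>x y i. x \<in> X \<Longrightarrow> y \<in> X \<Longrightarrow> (\<And>j. \<bar>j - i\<bar> \<le> r \<Longrightarrow> \<bar>x j - y j\<bar> \<le> \<epsilon>) \<Longrightarrow> \<bar>G i x - G i y\<bar> \<le> \<eta> / 2"
    using G_unif_cont[OF \<eta>2] by blast
  have "\<forall>\<^sub>F n in F. \<forall>j\<in>{i-r..i+r}. dist (x n j) (y j) < \<epsilon>"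
    using lim e(1) by (intro eventually_ball_finite ballI tendstoD) auto
  then show "\<forall>\<^sub>F n in F. dist (G i (x n)) (G i y) < \<eta>"
  proof eventually_elim
    case (elim n)
    have "\<bar>x n j - y j\<bar> \<le> \<epsilon>" if "\<bar>j - i\<bar> \<le> r" for j
    proof -
      have "j \<in> {i-r..i+r}" using that by auto
      with elim show ?thesis by (force simp: dist_real_def)
    qed
    then have "\<bar>G i (x n) - G i y\<bar> \<le> \<eta> / 2" by (intro e(2) x y)
    with \<open>\<eta> > 0\<close> show ?case by (simp add: dist_real_def)
  qed
qed

lemma sum_G:
  assumes "p \<le> q"
  shows "energy {p..<q} x = (\<Sum>j\<in>{p..<q}. H j x) + \<phi> (shift p x) - \<phi> (shift q x)"
  using assms
proof (induction q rule: int_ge_induct)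
  case (step q)
  have "{p..<q+1} = insert q {p..<q}" using step.hyps by auto
  then have "(\<Sum>j\<in>{p..<q+1}. f j) = f q + (\<Sum>j\<in>{p..<q}. f j)" for f :: "int \<Rightarrow> real" by simp
  from this[of "\<lambda>j. G j x"] this[of "\<lambda>j. H j x"] step.IH show ?case
    unfolding G_def[of q] by linarith
qed simp

lemma sum_G_nonneg: "x \<in> X \<Longrightarrow> 0 \<le> energy A x"
  by (intro sum_nonneg G_nonneg)

lemma sum_G_mono: "x \<in> X \<Longrightarrow> finite B \<Longrightarrow> A \<subseteq> B \<Longrightarrow> energy A x \<le> energy B x"
  by (intro sum_mono2 G_nonneg)

text \<open>\<open>energy_le x c\<close> expresses that the possibly infinite sum of all \<open>G j x\<close> is at most \<open>c\<close>.\<close>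

definition energy_le :: "(int \<Rightarrow> real) \<Rightarrow> real \<Rightarrow> bool" where
  "energy_le x c \<longleftrightarrow> (\<forall>A. finite A \<longrightarrow> energy A x \<le> c)"

lemma energy_leD: "energy_le x c \<Longrightarrow> finite A \<Longrightarrow> energy A x \<le> c"
  by (auto simp: energy_le_def)

lemma energy_le_nonneg: "energy_le x c \<Longrightarrow> 0 \<le> c"
  using energy_leD[of x c "{}"] by simp

lemma energy_le_mono: "energy_le x c \<Longrightarrow> c \<le> c' \<Longrightarrow> energy_le x c'"
  unfolding energy_le_def by force

lemma energy_leI:
  assumes x: "x \<in> X" and le: "\<And>n. n \<ge> n0 \<Longrightarrow> energy {-n..<n} x \<le> c"
  shows "energy_le x c"
  unfolding energy_le_def
proof (intro allI impI)
  fix A :: "int set" assume A: "finite A"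
  define n where "n = max n0 (Max (insert 0 (abs ` A)) + 1)"
  have "A \<subseteq> {-n..<n}"
  proof
    fix i assume "i \<in> A"
    then have "\<bar>i\<bar> \<le> Max (insert 0 (abs ` A))" using A by (intro Max_ge) auto
    then show "i \<in> {-n..<n}" by (auto simp: n_def)
  qed
  then have "energy A x \<le> energy {-n..<n} x" using x by (intro sum_G_mono) auto
  also have "\<dots> \<le> c" by (rule le) (simp add: n_def)
  finally show "energy A x \<le> c" .
qed

lemma energy_le_0_iff: "x \<in> X \<Longrightarrow> energy_le x 0 \<longleftrightarrow> (\<forall>i. G i x = 0)"
proof
  assume x: "x \<in> X" "energy_le x 0"
  show "\<forall>i. G i x = 0"
  proof
    fix i show "G i x = 0"
      using energy_leD[OF x(2), of "{i}"] G_nonneg[OF x(1), of i] by simp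
  qed
qed (simp add: energy_le_def)

lemma energy_le_shift: "energy_le x c \<Longrightarrow> energy_le (shift i x) c"
  unfolding energy_le_def G_shift
proof (intro allI impI)
  fix A :: "int set" assume le: "\<forall>A. finite A \<longrightarrow> energy A x \<le> c" and A: "finite A"
  have "(\<Sum>j\<in>A. G (j + i) x) = (\<Sum>j\<in>(\<lambda>j. j + i) ` A. G j x)"
    by (subst sum.reindex) (auto simp: inj_on_def)
  with le A show "(\<Sum>j\<in>A. G (j + i) x) \<le> c" by simp
qed

lemma energy_le_limit:
  assumes "\<And>n. x n \<in> X" "y \<in> X" "\<And>i. (\<lambda>n. x n i) \<longlonglongrightarrow> y i"
    and "\<And>n. energy_le (x n) (c n)" "c \<longlonglongrightarrow> C"
  shows "energy_le y C"
  unfolding energy_le_def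
proof (intro allI impI)
  fix A :: "int set" assume A: "finite A"
  have "(\<lambda>n. \<Sum>j\<in>A. G j (x n)) \<longlonglongrightarrow> energy A y"
    using assms(1-3) by (intro tendsto_sum G_tendsto)
  then show "energy A y \<le> C"
    using assms(4,5) A by (intro LIMSEQ_le[of _ "_::real"]) (auto intro: energy_leD)
qed

text \<open>Submodularity is applied to \<open>H\<close>. The passage between \<open>H\<close> and
  \<open>G\<close> costs two boundary values of \<open>\<phi>\<close> for each of the four chains,
  hence the constant \<open>8 * K\<close>; as both new energies are nonnegative, each is
  bounded.\<close>

lemma energy_sup_inf:
  assumes x: "x \<in> X" "energy_le x c" and y: "y \<in> X" "energy_le y c'"
  shows "\<exists>C. energy_le (sup x y) C" "\<exists>C. energy_le (inf x y) C"
proof -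
  obtain K where K: "\<And>x. x \<in> X \<Longrightarrow> \<bar>\<phi> x\<bar> \<le> K"
    using \<phi>_bounded by blast
  have "energy {-n..<n} (sup x y) + energy {-n..<n} (inf x y) \<le> c + c' + 8 * K"
    if "n \<ge> 0" for n
  proof -
    have "(\<Sum>j\<in>{-n..<n}. H j (sup x y)) + (\<Sum>j\<in>{-n..<n}. H j (inf x y)) \<le> (\<Sum>j\<in>{-n..<n}. H j x) + (\<Sum>j\<in>{-n..<n}. H j y)"
      unfolding sum.distrib[symmetric] by (intro sum_mono H_submodular)
    moreover have "energy {-n..<n} x \<le> c" "energy {-n..<n} y \<le> c'"
      using x y by (auto intro: energy_leD)
    moreover have "\<bar>energy {-n..<n} z - (\<Sum>j\<in>{-n..<n}. H j z)\<bar> \<le> 2 * K" if "z \<in> X" for z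
      using K[OF band_shift[OF that, of n]] K[OF band_shift[OF that, of "-n"]] sum_G[of "-n" n z] \<open>n \<ge> 0\<close>
      by simp
    note this[OF x(1)] this[OF y(1)] this[OF band_sup[OF x(1) y(1)]] this[OF band_inf[OF x(1) y(1)]]
    ultimately show ?thesis by linarith
  qed
  note le = this
  have band: "sup x y \<in> X" "inf x y \<in> X" using x(1) y(1) by (rule band_sup, rule band_inf)
  have "energy {-n..<n} (sup x y) \<le> c + c' + 8 * K" "energy {-n..<n} (inf x y) \<le> c + c' + 8 * K" if "n \<ge> 0" for n
    using le[OF that] sum_G_nonneg[OF band(1), of "{-n..<n}"] sum_G_nonneg[OF band(2), of "{-n..<n}"]
    by linarith+
  then have "energy_le (sup x y) (c + c' + 8 * K)" "energy_le (inf x y) (c + c' + 8 * K)"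
    using band by (blast intro: energy_leI)+
  then show "\<exists>C. energy_le (sup x y) C" "\<exists>C. energy_le (inf x y) C" by blast+
qed

lemma energy_rmax: "x \<in> X \<Longrightarrow> energy_le x c \<Longrightarrow> \<exists>C. energy_le (rmax k x) C"
proof (induction k)
  case (Suc k)
  then obtain C where "energy_le (rmax k x) C" by auto
  with Suc.prems energy_sup_inf(1)[of "rmax k x" C "shift 1 (rmax k x)" C] energy_le_shift[of "rmax k x" C 1]
  show ?case unfolding rmax_simps by (blast intro: rmax_band band_shift)
qed auto

lemma energy_rmin: "x \<in> X \<Longrightarrow> energy_le x c \<Longrightarrow> \<exists>C. energy_le (rmin k x) C"
proof (induction k)
  case (Suc k)
  then obtain C where "energy_le (rmin k x) C" by auto
  with Suc.prems energy_sup_inf(2)[of "rmin k x" C "shift 1 (rmin k x)" C] energy_le_shift[of "rmin k x" C 1]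
  show ?case unfolding rmin_simps by (blast intro: rmin_band band_shift)
qed auto

end

abbreviation ends :: "int filter set" where
  "ends \<equiv> {at_bot, at_top}"

lemma ends_nontrivial: "F \<in> ends \<Longrightarrow> F \<noteq> bot"
  using trivial_limit_at_bot_linorder[where 'a = int] trivial_limit_at_top_linorder[where 'a = int]
  by (metis empty_iff insert_iff)

lemma ends_shift: "F \<in> ends \<Longrightarrow> filterlim (\<lambda>i. i + j) F F"
proof -
  have "filterlim (\<lambda>i::int. i + j) at_top at_top"
    unfolding filterlim_at_top eventually_at_top_linorder
    by (intro allI, rule_tac x = "Z - j" in exI) auto
  moreover have "filterlim (\<lambda>i::int. i + j) at_bot at_bot"
    unfolding filterlim_at_bot eventually_at_bot_linorder
    by (intro allI, rule_tac x = "Z - j" in exI) auto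
  ultimately show "F \<in> ends \<Longrightarrow> filterlim (\<lambda>i. i + j) F F" by auto
qed

lemma ends_abs: "F \<in> ends \<Longrightarrow> \<forall>\<^sub>F i in F. N \<le> \<bar>i\<bar>"
proof -
  have "\<forall>\<^sub>F i in at_top. N \<le> \<bar>i\<bar>"
    using eventually_ge_at_top[of N] by (rule eventually_mono) auto
  moreover have "\<forall>\<^sub>F i in at_bot. N \<le> \<bar>i\<bar>"
    using eventually_le_at_bot[of "-N"] by (rule eventually_mono) auto
  ultimately show "F \<in> ends \<Longrightarrow> \<forall>\<^sub>F i in F. N \<le> \<bar>i\<bar>" by auto
qed

lemma int_mono_const:
  fixes x :: "int \<Rightarrow> real"
  assumes "\<And>i. x i \<le> x (i + 1)" "(x \<longlongrightarrow> c) at_bot" "(x \<longlongrightarrow> c) at_top"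
  shows "x i = c"
proof -
  have mono: "x i \<le> x j" if "i \<le> j" for i j
    using that
  proof (induction j rule: int_ge_induct)
    case (step j)
    with assms(1)[of j] show ?case by simp
  qed simp
  have "x i \<le> c"
    using assms(3) by (rule tendsto_lowerbound) (auto intro!: mono eventually_at_top_linorderI[of i])
  moreover have "c \<le> x i"
    using assms(2) by (rule tendsto_upperbound) (auto intro!: mono eventually_at_bot_linorderI[of i])
  ultimately show ?thesis by simp
qed

definition glue :: "int \<Rightarrow> (int \<Rightarrow> real) \<Rightarrow> (int \<Rightarrow> real) \<Rightarrow> int \<Rightarrow> real" where
  "glue p x y = (\<lambda>i. if i < p then x i else y i)"

lemma glue_band: "x \<in> band a b \<Longrightarrow> y \<in> band a b \<Longrightarrow> glue p x y \<in> band a b"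
  by (auto simp: band_def glue_def)

lemma glue_tendsto:
  "(glue p x y \<longlongrightarrow> c) at_bot \<longleftrightarrow> (x \<longlongrightarrow> c) at_bot"
  "(glue p x y \<longlongrightarrow> c) at_top \<longleftrightarrow> (y \<longlongrightarrow> c) at_top"
proof -
  have "\<forall>\<^sub>F i in at_bot. glue p x y i = x i"
    unfolding glue_def by (rule eventually_at_bot_linorderI[of "p - 1"]) auto
  then show "(glue p x y \<longlongrightarrow> c) at_bot \<longleftrightarrow> (x \<longlongrightarrow> c) at_bot"
    by (rule tendsto_cong)
  have "\<forall>\<^sub>F i in at_top. glue p x y i = y i"
    unfolding glue_def by (rule eventually_at_top_linorderI[of p]) auto
  then show "(glue p x y \<longlongrightarrow> c) at_top \<longleftrightarrow> (y \<longlongrightarrow> c) at_top"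
    by (rule tendsto_cong)
qed

section \<open>Perturbation, calibrated chains and gluing\<close>

context chain
begin

text \<open>On an interval that reaches far enough beyond \<open>i\<close>, the boundary values of
  \<open>\<phi>\<close> do not see site \<open>i\<close>. So the change of the corrected energy is a
  finite sum of changes of \<open>H\<close>, which is differentiable in the value at
  \<open>i\<close>.\<close>

lemma perturb_energy:
  assumes x: "x \<in> X" "x(i := t) \<in> X" and en: "energy_le x c"
  shows "energy_le (x(i := t)) (c + ((\<Sum>j=i-r..i+r. H j (x(i := t))) - (\<Sum>j=i-r..i+r. H j x)))"
proof (rule energy_leI[OF x(2), of "\<bar>i\<bar> + 2 * r + 1"])
  fix n assume n: "\<bar>i\<bar> + 2 * r + 1 \<le> n"
  let ?x = "x(i := t)"
  have "(\<Sum>j\<in>{-n..<n}. H j ?x - H j x) = (\<Sum>j=i-r..i+r. H j ?x - H j x)"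
  proof (rule sum.mono_neutral_right)
    show "\<forall>j\<in>{-n..<n} - {i-r..i+r}. H j ?x - H j x = 0"
    proof
      fix j assume "j \<in> {-n..<n} - {i-r..i+r}"
      then have "H j ?x = H j x" by (intro H_local) auto
      then show "H j ?x - H j x = 0" by simp
    qed
  qed (use n r1 in auto)
  moreover have "\<phi> (shift (-n) ?x) = \<phi> (shift (-n) x)" "\<phi> (shift n ?x) = \<phi> (shift n x)"
    using n r1 by (auto intro!: \<phi>_local)
  moreover have "-n \<le> n" using n r1 by simp
  moreover have "energy {-n..<n} x \<le> c" using en by (auto intro: energy_leD)
  ultimately show "energy {-n..<n} ?x \<le> c + ((\<Sum>j=i-r..i+r. H j ?x) - (\<Sum>j=i-r..i+r. H j x))"
    using sum_G[of "-n" n x] sum_G[of "-n" n ?x] by (simp only: sum_subtractf)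
qed

text \<open>If the sign of \<open>E i x\<close> favours a direction that is not blocked by the band,
  a small move there lowers the energy. The move is kept below \<open>\<epsilon>\<close> so that
  strict pointwise constraints survive it.\<close>

lemma decrease_energy:
  assumes x: "x \<in> X" and en: "energy_le x c" and "\<epsilon> > 0"
    and E: "x i < b \<and> E i x < 0 \<or> a < x i \<and> 0 < E i x"
  shows "\<exists>t c'. \<bar>t - x i\<bar> < \<epsilon> \<and> x(i := t) \<in> X \<and> c' < c \<and> energy_le (x(i := t)) c'"
proof -
  define f where "f t = (\<Sum>j=i-r..i+r. H j (x(i := t)))" for t
  have f': "(f has_real_derivative E i x) (at (x i))"
    unfolding f_def by (rule E_deriv)
  have bd: "a \<le> x i" "x i \<le> b" using x by (auto simp: band_def)
  obtain t where t: "\<bar>t - x i\<bar> < \<epsilon>" "a \<le> t" "t \<le> b" "f t < f (x i)"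
    using E
  proof
    assume *: "x i < b \<and> E i x < 0"
    then obtain d where d: "d > 0" "\<And>s. 0 < s \<Longrightarrow> s < d \<Longrightarrow> f (x i) > f (x i + s)"
      using DERIV_neg_dec_right[OF f'] by blast
    define s where "s = min (min (d / 2) (\<epsilon> / 2)) (b - x i)"
    have "0 < s" "s < d" "s < \<epsilon>" "s \<le> b - x i"
      using * d(1) \<open>\<epsilon> > 0\<close> by (auto simp: s_def)
    with d(2) bd show thesis by (intro that[of "x i + s"]) auto
  next
    assume *: "a < x i \<and> 0 < E i x"
    then obtain d where d: "d > 0" "\<And>s. 0 < s \<Longrightarrow> s < d \<Longrightarrow> f (x i - s) < f (x i)"
      using DERIV_pos_inc_left[OF f'] by blast
    define s where "s = min (min (d / 2) (\<epsilon> / 2)) (x i - a)"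
    have "0 < s" "s < d" "s < \<epsilon>" "s \<le> x i - a"
      using * d(1) \<open>\<epsilon> > 0\<close> by (auto simp: s_def)
    with d(2) bd show thesis by (intro that[of "x i - s"]) auto
  qed
  have band: "x(i := t) \<in> X" using x t by (intro band_upd)
  have "energy_le (x(i := t)) (c + (f t - f (x i)))"
    using perturb_energy[OF x band en] by (simp add: f_def)
  with t band show ?thesis by (intro exI[of _ t] exI[of _ "c + (f t - f (x i))"]) auto
qed

text \<open>A chain is calibrated if \<open>G\<close> vanishes at all sites. Since no energy is
  negative, no move can lower that of a calibrated chain, which gives both variational
  inequalities.\<close>

lemma calibrated_EL:
  assumes "x \<in> X" "energy_le x 0"
  shows "(\<forall>i. E i x = 0) \<and> (x = (\<lambda>_. a) \<or> x = (\<lambda>_. b) \<or> (\<forall>i. a < x i \<and> x i < b))"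
proof (rule one_sided_EL[OF assms(1)])
  have *: "\<not> (x i < b \<and> E i x < 0 \<or> a < x i \<and> 0 < E i x)" for i
    using decrease_energy[OF assms zero_less_one, of i] energy_le_nonneg by force
  show "0 \<le> E i x" if "x i < b" for i using *[of i] that by auto
  show "E i x \<le> 0" if "a < x i" for i using *[of i] that by auto
qed

lemma calibrated_touching:
  assumes "x \<in> X" "energy_le x 0" "y \<in> X" "energy_le y 0" "x \<le> y" "x i = y i"
  shows "x = y"
  using calibrated_EL[OF assms(1,2)] calibrated_EL[OF assms(3,4)] assms(5,6)
  by (intro touching_eq[of x y i]) auto

definition conn :: "real \<Rightarrow> real \<Rightarrow> (int \<Rightarrow> real) set" where
  "conn \<alpha> \<beta> = {x \<in> X. (x \<longlongrightarrow> \<alpha>) at_bot \<and> (x \<longlongrightarrow> \<beta>) at_top}"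

lemma conn_band: "x \<in> conn \<alpha> \<beta> \<Longrightarrow> x \<in> X"
  by (simp add: conn_def)

lemma shift_tendsto: "F \<in> ends \<Longrightarrow> (x \<longlongrightarrow> \<alpha>) F \<Longrightarrow> (shift i x \<longlongrightarrow> \<alpha>) F"
  using filterlim_compose[OF _ ends_shift, of x "nhds \<alpha>" F i]
  by (simp add: shift_def add.commute)

lemma conn_shift: "x \<in> conn \<alpha> \<beta> \<Longrightarrow> shift i x \<in> conn \<alpha> \<beta>"
  unfolding conn_def using shift_tendsto[of at_bot] shift_tendsto[of at_top] by auto

lemma \<phi>_shift_tendsto:
  assumes x: "x \<in> X" and F: "F \<in> ends" "(x \<longlongrightarrow> \<alpha>) F"
  shows "((\<lambda>i. \<phi> (shift i x)) \<longlongrightarrow> \<phi> (\<lambda>_. \<alpha>)) F"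
proof (rule tendstoI)
  fix \<eta> :: real assume "\<eta> > 0"
  then have \<eta>2: "\<eta> / 2 > 0" by simp
  obtain \<epsilon> where e: "\<epsilon> > 0" "\<And>x y. x \<in> X \<Longrightarrow> y \<in> X \<Longrightarrow> (\<And>i. -r \<le> i \<Longrightarrow> i < r \<Longrightarrow> \<bar>x i - y i\<bar> \<le> \<epsilon>) \<Longrightarrow> \<bar>\<phi> x - \<phi> y\<bar> \<le> \<eta> / 2"
    using \<phi>_unif_cont[OF \<eta>2] by blast
  have bd: "\<forall>\<^sub>F i in F. a \<le> x i" "\<forall>\<^sub>F i in F. x i \<le> b"
    using x by (auto simp: band_def)
  have \<alpha>: "(\<lambda>_. \<alpha>) \<in> X"
    using tendsto_lowerbound[OF F(2) bd(1)] tendsto_upperbound[OF F(2) bd(2)] ends_nontrivial[OF F(1)]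
    by simp
  have "\<forall>\<^sub>F i in F. \<forall>j\<in>{-r..r}. dist (x (i + j)) \<alpha> < \<epsilon>"
  proof (intro eventually_ball_finite ballI)
    fix j
    have "((\<lambda>i. x (i + j)) \<longlongrightarrow> \<alpha>) F"
      using filterlim_compose[OF F(2) ends_shift[OF F(1)]] .
    then show "\<forall>\<^sub>F i in F. dist (x (i + j)) \<alpha> < \<epsilon>"
      using e(1) by (rule tendstoD)
  qed simp
  then show "\<forall>\<^sub>F i in F. dist (\<phi> (shift i x)) (\<phi> (\<lambda>_. \<alpha>)) < \<eta>"
  proof eventually_elim
    case (elim i)
    have "\<bar>\<phi> (shift i x) - \<phi> (\<lambda>_. \<alpha>)\<bar> \<le> \<eta> / 2"
    proof (rule e(2)[OF band_shift[OF x] \<alpha>])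
      fix j assume "-r \<le> j" "j < r"
      then have "j \<in> {-r..r}" by auto
      with elim show "\<bar>shift i x j - \<alpha>\<bar> \<le> \<epsilon>" by (force simp: dist_real_def)
    qed
    with \<open>\<eta> > 0\<close> show ?case by (simp add: dist_real_def)
  qed
qed

lemma sup_tendsto: "(x \<longlongrightarrow> \<alpha>) F \<Longrightarrow> (y \<longlongrightarrow> \<beta>) F \<Longrightarrow> (sup x y \<longlongrightarrow> max \<alpha> \<beta>) F"
  and inf_tendsto: "(x \<longlongrightarrow> \<alpha>) F \<Longrightarrow> (y \<longlongrightarrow> \<beta>) F \<Longrightarrow> (inf x y \<longlongrightarrow> min \<alpha> \<beta>) F"
  for x y :: "int \<Rightarrow> real"
  unfolding sup_fun_def inf_fun_def sup_real_def inf_real_def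
  by (rule tendsto_max tendsto_min; assumption)+

text \<open>For chains with limits the boundary terms vanish: if \<open>x\<close> and
  \<open>y\<close> tend to s and t at an end, then supremum and infimum tend to s and t in some
  order, so the four values of \<open>\<phi>\<close> cancel. Submodularity then bounds the sum of
  two nonnegative energies by 0.\<close>

lemma calibrated_inf:
  assumes x: "x \<in> conn \<alpha> \<beta>" "energy_le x 0" and y: "y \<in> conn \<alpha>' \<beta>'" "energy_le y 0"
  shows "energy_le (inf x y) 0"
proof -
  have X: "x \<in> X" "y \<in> X" "sup x y \<in> X" "inf x y \<in> X"
    using x y by (auto simp: conn_def)
  define B where "B i = \<phi> (shift i (sup x y)) + \<phi> (shift i (inf x y)) - \<phi> (shift i x) - \<phi> (shift i y)" for i
  have B: "(B \<longlongrightarrow> 0) F" if "F \<in> ends" "(x \<longlongrightarrow> s) F" "(y \<longlongrightarrow> t) F" for F s t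
  proof -
    have "(B \<longlongrightarrow> \<phi> (\<lambda>_. max s t) + \<phi> (\<lambda>_. min s t) - \<phi> (\<lambda>_. s) - \<phi> (\<lambda>_. t)) F"
      unfolding B_def using that X by (intro tendsto_intros \<phi>_shift_tendsto sup_tendsto inf_tendsto)
    then show ?thesis by (cases "s \<le> t") (simp_all add: max_def min_def)
  qed
  have lim: "((\<lambda>n. B (-n) - B n) \<longlongrightarrow> 0 - 0) at_top"
  proof (rule tendsto_diff)
    have "(B \<longlongrightarrow> 0) at_bot" using x y B[of at_bot] by (auto simp: conn_def)
    then show "((\<lambda>n. B (-n)) \<longlongrightarrow> 0) at_top"
      by (rule filterlim_compose) (simp add: filterlim_at_bot eventually_at_top_linorder, metis minus_le_iff)
    show "(B \<longlongrightarrow> 0) at_top" using x y B[of at_top] by (auto simp: conn_def)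
  qed
  have le: "energy {-n..<n} (inf x y) \<le> B (-n) - B n" if "n \<ge> 0" for n
  proof -
    have "(\<Sum>j\<in>{-n..<n}. H j (sup x y)) + (\<Sum>j\<in>{-n..<n}. H j (inf x y)) \<le> (\<Sum>j\<in>{-n..<n}. H j x) + (\<Sum>j\<in>{-n..<n}. H j y)"
      unfolding sum.distrib[symmetric] by (intro sum_mono H_submodular)
    moreover have "energy {-n..<n} x \<le> 0" "energy {-n..<n} y \<le> 0"
      using x y by (auto intro: energy_leD)
    moreover have "energy {-n..<n} (sup x y) \<ge> 0"
      using X by (intro sum_G_nonneg)
    moreover have "energy {-n..<n} z = (\<Sum>j\<in>{-n..<n}. H j z) + \<phi> (shift (-n) z) - \<phi> (shift n z)" for z
      using that by (intro sum_G) simp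
    note this[of x] this[of y] this[of "sup x y"] this[of "inf x y"]
    ultimately show ?thesis unfolding B_def by linarith
  qed
  show ?thesis
  proof (rule energy_leI[OF X(4), of 0])
    fix n :: int assume n: "n \<ge> 0"
    have "\<forall>\<^sub>F m in at_top. energy {-n..<n} (inf x y) \<le> B (-m) - B m"
      using eventually_ge_at_top[of n]
    proof eventually_elim
      case (elim m)
      have "energy {-n..<n} (inf x y) \<le> energy {-m..<m} (inf x y)"
        using elim by (intro sum_G_mono X) auto
      with le[of m] elim n show ?case by linarith
    qed
    from tendsto_lowerbound[OF lim this] show "energy {-n..<n} (inf x y) \<le> 0" by simp
  qed
qed

text \<open>The infimum of \<open>x\<close> and its translate is calibrated and touches one of them
  at site 0, so it equals that one. Hence \<open>x\<close> is monotone, and equal limits make it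
  constant.\<close>

lemma calibrated_homoclinic:
  assumes x: "x \<in> conn \<alpha> \<alpha>" "energy_le x 0"
  shows "x = (\<lambda>_. \<alpha>)"
proof -
  let ?y = "shift 1 x" and ?z = "inf x (shift 1 x)"
  have y: "?y \<in> conn \<alpha> \<alpha>" "energy_le ?y 0"
    using x by (auto intro: conn_shift energy_le_shift)
  have X: "x \<in> X" "?y \<in> X" "?z \<in> X" using x y by (auto simp: conn_def)
  have z: "energy_le ?z 0" using x y by (rule calibrated_inf)
  have "?z 0 = x 0 \<or> ?z 0 = ?y 0" by (auto simp: inf_real_def min_def)
  then have "?z = x \<or> ?z = ?y"
    using calibrated_touching[OF X(3) z X(1) x(2), of 0] calibrated_touching[OF X(3) z X(2) y(2), of 0]
    by auto
  then show ?thesis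
  proof
    assume z_eq: "?z = x"
    have mono: "x i \<le> x (i + 1)" for i
      using fun_cong[OF z_eq, of i] by (simp add: inf_real_def add.commute split: if_splits)
    have "x i = \<alpha>" for i
      by (rule int_mono_const[where x = x, OF mono]) (use x(1) in \<open>simp_all add: conn_def\<close>)
    then show ?thesis by auto
  next
    assume z_eq: "?z = ?y"
    have mono: "- x i \<le> - x (i + 1)" for i
      using fun_cong[OF z_eq, of i] by (simp add: inf_real_def add.commute split: if_splits)
    have "- x i = - \<alpha>" for i
      by (rule int_mono_const[where x = "\<lambda>i. - x i", OF mono])
        (use x(1) in \<open>simp_all add: conn_def tendsto_minus\<close>)
    then show ?thesis by auto
  qed
qed

text \<open>Only densities within \<open>r\<close> of the seam can read both pieces. They read sites
  within \<open>2 * r\<close> of it, where the glued chain is close to a ground state, for which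
  \<open>G\<close> is 0.\<close>

lemma glue_energy:
  assumes "\<eta> > 0"
  shows "\<exists>\<epsilon>>0. \<forall>x\<in>X. \<forall>y\<in>X. \<forall>\<alpha>\<in>{a, b}. \<forall>p A.
    (\<forall>i. \<bar>i - p\<bar> \<le> 2 * r \<longrightarrow> \<bar>x i - \<alpha>\<bar> \<le> \<epsilon> \<and> \<bar>y i - \<alpha>\<bar> \<le> \<epsilon>) \<longrightarrow>
    energy A (glue p x y) \<le> (\<Sum>j\<in>A. if j < p then G j x else G j y) + \<eta>"
proof -
  define \<eta>' where "\<eta>' = \<eta> / (2 * of_int r)"
  have \<eta>': "\<eta>' > 0" "\<eta>' * (2 * of_int r) = \<eta>" using assms r1 by (simp_all add: \<eta>'_def)
  obtain \<epsilon> where e: "\<epsilon> > 0" "\<forall>x\<in>X. \<forall>y\<in>X. \<forall>i. (\<forall>j. \<bar>j - i\<bar> \<le> r \<longrightarrow> \<bar>x j - y j\<bar> \<le> \<epsilon>) \<longrightarrow> \<bar>G i x - G i y\<bar> \<le> \<eta>'"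
    using G_unif_cont[OF \<eta>'(1)] by blast
  have "energy A (glue p x y) \<le> (\<Sum>j\<in>A. if j < p then G j x else G j y) + \<eta>"
    if x: "x \<in> X" and y: "y \<in> X" and \<alpha>: "\<alpha> \<in> {a, b}"
      and near: "\<And>i. \<bar>i - p\<bar> \<le> 2 * r \<Longrightarrow> \<bar>x i - \<alpha>\<bar> \<le> \<epsilon> \<and> \<bar>y i - \<alpha>\<bar> \<le> \<epsilon>" for x y \<alpha> p A
  proof -
    have X: "glue p x y \<in> X" "(\<lambda>_. \<alpha>) \<in> X" using x y \<alpha> ab by (auto intro: glue_band)
    have "energy A (glue p x y) \<le> (\<Sum>j\<in>A. if j < p then G j x else G j y) + \<eta>' * real (card {p-r..<p+r})"
    proof (rule sum_le_except)
      fix j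
      show "G j (glue p x y) \<le> (if j < p then G j x else G j y) + (if j \<in> {p-r..<p+r} then \<eta>' else 0)"
      proof (cases "j \<in> {p-r..<p+r}")
        case True
        then have "\<bar>G j (glue p x y) - G j (\<lambda>_. \<alpha>)\<bar> \<le> \<eta>'"
          using near X by (intro e(2)[rule_format]) (auto simp: glue_def)
        with True \<alpha> show ?thesis using G_nonneg[OF x, of j] G_nonneg[OF y, of j] by auto
      next
        case False
        then have "j < p \<Longrightarrow> G j (glue p x y) = G j x" "\<not> j < p \<Longrightarrow> G j (glue p x y) = G j y"
          using x y X(1) by (auto intro!: G_local simp: glue_def)
        with False show ?thesis by auto
      qed
    qed (use \<eta>' in auto)
    also have "\<eta>' * real (card {p-r..<p+r}) = \<eta>" using \<eta>'(2) r1 by simp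
    finally show ?thesis .
  qed
  with e(1) show ?thesis by blast
qed

subsection \<open>Cutting and completing chains near ground states\<close>

definition near :: "real \<Rightarrow> real \<Rightarrow> int \<Rightarrow> (int \<Rightarrow> real) \<Rightarrow> bool" where
  "near \<epsilon> \<alpha> p x \<longleftrightarrow> (\<forall>i. \<bar>i - p\<bar> \<le> 2 * r \<longrightarrow> \<bar>x i - \<alpha>\<bar> \<le> \<epsilon>)"

definition clamp :: "real \<Rightarrow> int \<Rightarrow> real \<Rightarrow> int \<Rightarrow> (int \<Rightarrow> real) \<Rightarrow> int \<Rightarrow> real" where
  "clamp \<alpha> p \<beta> q x = glue p (\<lambda>_. \<alpha>) (glue q x (\<lambda>_. \<beta>))"

lemma clamp_apply: "p \<le> i \<Longrightarrow> i < q \<Longrightarrow> clamp \<alpha> p \<beta> q x i = x i"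
  by (simp add: clamp_def glue_def)

lemma clamp_conn: "x \<in> X \<Longrightarrow> \<alpha> \<in> {a, b} \<Longrightarrow> \<beta> \<in> {a, b} \<Longrightarrow> clamp \<alpha> p \<beta> q x \<in> conn \<alpha> \<beta>"
  using ab by (auto simp: conn_def clamp_def glue_tendsto intro!: glue_band)

lemma glue_energy_near:
  assumes "\<delta> > 0"
  shows "\<exists>\<epsilon>>0. \<forall>x\<in>X. \<forall>y\<in>X. \<forall>\<alpha>\<in>{a, b}. \<forall>p A. near \<epsilon> \<alpha> p x \<longrightarrow> near \<epsilon> \<alpha> p y \<longrightarrow>
    energy A (glue p x y) \<le> (\<Sum>j\<in>A. if j < p then G j x else G j y) + \<delta>"
  using glue_energy[OF assms] unfolding near_def by blast

lemma near_const: "\<epsilon> > 0 \<Longrightarrow> near \<epsilon> \<alpha> p (\<lambda>_. \<alpha>)"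
  by (simp add: near_def)

text \<open>\<open>tolerance \<delta> \<epsilon>\<close> says that a piece whose two ends are \<open>\<epsilon>\<close>-close to ground states can be
  completed by these ground states at an extra cost of at most \<open>\<delta>\<close>.\<close>

definition tolerance :: "real \<Rightarrow> real \<Rightarrow> bool" where
  "tolerance \<delta> \<epsilon> \<longleftrightarrow> \<epsilon> > 0 \<and> (\<forall>x\<in>X. \<forall>\<alpha>\<in>{a, b}. \<forall>\<beta>\<in>{a, b}. \<forall>p q.
    p + 2 * r < q \<longrightarrow> near \<epsilon> \<alpha> p x \<longrightarrow> near \<epsilon> \<beta> q x \<longrightarrow>
    energy_le (clamp \<alpha> p \<beta> q x) (energy {p..<q} x + \<delta>))"

lemma toleranceD:
  assumes "tolerance \<delta> \<epsilon>"
  shows "\<epsilon> > 0"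
    and "x \<in> X \<Longrightarrow> \<alpha> \<in> {a, b} \<Longrightarrow> \<beta> \<in> {a, b} \<Longrightarrow> p + 2 * r < q \<Longrightarrow> near \<epsilon> \<alpha> p x \<Longrightarrow> near \<epsilon> \<beta> q x \<Longrightarrow>
      energy_le (clamp \<alpha> p \<beta> q x) (energy {p..<q} x + \<delta>)"
  using assms unfolding tolerance_def by blast+

lemma tolerance_exists:
  assumes "\<delta> > 0"
  shows "\<exists>\<epsilon>. tolerance \<delta> \<epsilon>"
proof -
  from assms have \<delta>2: "\<delta> / 2 > 0" by simp
  obtain \<epsilon> where e: "\<epsilon> > 0"
    "\<And>x y \<alpha> p A. x \<in> X \<Longrightarrow> y \<in> X \<Longrightarrow> \<alpha> \<in> {a, b} \<Longrightarrow> near \<epsilon> \<alpha> p x \<Longrightarrow> near \<epsilon> \<alpha> p y \<Longrightarrow>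
      energy A (glue p x y) \<le> (\<Sum>j\<in>A. if j < p then G j x else G j y) + \<delta> / 2"
    using glue_energy_near[OF \<delta>2] by blast
  have "energy_le (clamp \<alpha> p \<beta> q x) (energy {p..<q} x + \<delta>)"
    if x: "x \<in> X" and \<alpha>: "\<alpha> \<in> {a, b}" and \<beta>: "\<beta> \<in> {a, b}" and pq: "p + 2 * r < q"
      and near: "near \<epsilon> \<alpha> p x" "near \<epsilon> \<beta> q x" for x \<alpha> \<beta> p q
    unfolding energy_le_def
  proof (intro allI impI)
    fix A :: "int set" assume A: "finite A"
    let ?y = "glue q x (\<lambda>_. \<beta>)"
    have c: "(\<lambda>_. \<alpha>) \<in> X" "(\<lambda>_. \<beta>) \<in> X" using \<alpha> \<beta> ab by auto
    have y: "?y \<in> X" using x c(2) by (rule glue_band)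
    \<comment> \<open>\<open>p + 2 * r < q\<close> keeps the seam at \<open>q\<close> away from the
      block around \<open>p\<close>.\<close>
    have near_y: "near \<epsilon> \<alpha> p ?y" using near(1) pq by (auto simp: near_def glue_def)
    have "energy A (clamp \<alpha> p \<beta> q x) \<le> (\<Sum>j\<in>A. if j < p then G j (\<lambda>_. \<alpha>) else G j ?y) + \<delta> / 2"
      unfolding clamp_def using c(1) y \<alpha> near_const[OF e(1)] near_y by (rule e(2))
    also have "(\<Sum>j\<in>A. if j < p then G j (\<lambda>_. \<alpha>) else G j ?y) = energy (A \<inter> {p..}) ?y"
      using A \<alpha> by (intro sum.mono_neutral_cong_right) auto
    also have "\<dots> \<le> (\<Sum>j\<in>A \<inter> {p..}. if j < q then G j x else G j (\<lambda>_. \<beta>)) + \<delta> / 2"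
      using x c(2) \<beta> near(2) near_const[OF e(1)] by (rule e(2))
    also have "(\<Sum>j\<in>A \<inter> {p..}. if j < q then G j x else G j (\<lambda>_. \<beta>)) = energy (A \<inter> {p..<q}) x"
      using A \<beta> by (intro sum.mono_neutral_cong_right) auto
    also have "\<dots> \<le> energy {p..<q} x" by (intro sum_G_mono x) auto
    finally show "energy A (clamp \<alpha> p \<beta> q x) \<le> energy {p..<q} x + \<delta>" by simp
  qed
  with e(1) show ?thesis unfolding tolerance_def by blast
qed

text \<open>For ground states this is the infimum $c_1$ up to the constant
  \<open>\<phi> (\<lambda>_. \<beta>) - \<phi> (\<lambda>_. \<alpha>)\<close>. It is a real number
  there, because a sharp step between ground states has finite energy.\<close>

definition e :: "real \<Rightarrow> real \<Rightarrow> real" where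
  "e \<alpha> \<beta> = Inf {c. \<exists>x\<in>conn \<alpha> \<beta>. energy_le x c}"

lemma e_le: "x \<in> conn \<alpha> \<beta> \<Longrightarrow> energy_le x c \<Longrightarrow> e \<alpha> \<beta> \<le> c"
  unfolding e_def by (intro cInf_lower bdd_belowI[of _ 0]) (auto dest: energy_le_nonneg)

lemma step_conn: "\<alpha> \<in> {a, b} \<Longrightarrow> \<beta> \<in> {a, b} \<Longrightarrow> glue p (\<lambda>_. \<alpha>) (\<lambda>_. \<beta>) \<in> conn \<alpha> \<beta>"
  using ab by (auto simp: conn_def glue_tendsto intro!: glue_band)

lemma step_energy:
  assumes "\<alpha> \<in> {a, b}" "\<beta> \<in> {a, b}"
  shows "\<exists>c. energy_le (glue p (\<lambda>_. \<alpha>) (\<lambda>_. \<beta>)) c"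
proof
  let ?x = "glue p (\<lambda>_. \<alpha>) (\<lambda>_. \<beta>)"
  have X: "?x \<in> X" "(\<lambda>_. \<alpha>) \<in> X" "(\<lambda>_. \<beta>) \<in> X"
    using step_conn[OF assms] assms ab by (auto simp: conn_def)
  have 0: "G j ?x = 0" if "j \<notin> {p-r..<p+r}" for j
  proof (cases "j < p")
    case True
    then have "G j ?x = G j (\<lambda>_. \<alpha>)" using that X by (intro G_local) (auto simp: glue_def)
    with assms show ?thesis by simp
  next
    case False
    then have "G j ?x = G j (\<lambda>_. \<beta>)" using that X by (intro G_local) (auto simp: glue_def)
    with assms show ?thesis by simp
  qed
  show "energy_le ?x (energy {p-r..<p+r} ?x)"
    unfolding energy_le_def
  proof (intro allI impI)
    fix A :: "int set" assume "finite A"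
    then have "energy A ?x = energy (A \<inter> {p-r..<p+r}) ?x"
      using 0 by (intro sum.mono_neutral_cong_right) auto
    also have "\<dots> \<le> energy {p-r..<p+r} ?x" by (intro sum_G_mono X) auto
    finally show "energy A ?x \<le> energy {p-r..<p+r} ?x" .
  qed
qed

lemma e_set_nonempty:
  assumes "\<alpha> \<in> {a, b}" "\<beta> \<in> {a, b}"
  shows "{c. \<exists>x\<in>conn \<alpha> \<beta>. energy_le x c} \<noteq> {}"
  using step_conn[OF assms, of 0] step_energy[OF assms, of 0] by blast

lemma e_nonneg: "\<alpha> \<in> {a, b} \<Longrightarrow> \<beta> \<in> {a, b} \<Longrightarrow> 0 \<le> e \<alpha> \<beta>"
  unfolding e_def using e_set_nonempty[of \<alpha> \<beta>] by (intro cInf_greatest) (auto dest: energy_le_nonneg)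

lemma e_approx:
  assumes "\<alpha> \<in> {a, b}" "\<beta> \<in> {a, b}" "e \<alpha> \<beta> < c"
  shows "\<exists>x\<in>conn \<alpha> \<beta>. energy_le x c"
proof -
  have "\<exists>c'\<in>{c. \<exists>x\<in>conn \<alpha> \<beta>. energy_le x c}. c' < c"
    using assms(3) e_set_nonempty[OF assms(1,2)] unfolding e_def
    by (subst (asm) cInf_less_iff) (auto intro!: bdd_belowI[of _ 0] dest: energy_le_nonneg)
  then obtain c' x where "c' < c" "x \<in> conn \<alpha> \<beta>" "energy_le x c'" by blast
  with energy_le_mono[of x c' c] show ?thesis by auto
qed

end

subsection \<open>Behaviour of finite energy chains at infinity\<close>

lemma sum_int_concat:
  fixes f :: "int \<Rightarrow> real"
  assumes "p \<le> q" "q \<le> s"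
  shows "(\<Sum>j\<in>{p..<s}. f j) = (\<Sum>j\<in>{p..<q}. f j) + (\<Sum>j\<in>{q..<s}. f j)"
  using assms by (subst sum.union_disjoint[symmetric]) (auto simp: ivl_disj_un)

lemma limsup_exists:
  fixes x :: "int \<Rightarrow> real"
  assumes "F \<noteq> bot" "\<And>i. A \<le> x i" "\<And>i. x i \<le> B"
  shows "\<exists>S. (\<forall>\<epsilon>>0. \<forall>\<^sub>F i in F. x i < S + \<epsilon>) \<and> (\<forall>\<epsilon>>0. \<exists>\<^sub>F i in F. S - \<epsilon> < x i)"
proof -
  let ?C = "{c. \<forall>\<^sub>F i in F. x i \<le> c}"
  have B: "B \<in> ?C" using assms(3) by simp
  have lower: "A \<le> c" if "c \<in> ?C" for c
  proof -
    have "\<exists>i. x i \<le> c"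
      using that assms(1) by (intro eventually_happens'[of F]) auto
    with assms(2) show ?thesis by (meson order_trans)
  qed
  then have bdd: "bdd_below ?C" by (intro bdd_belowI) auto
  have "\<forall>\<^sub>F i in F. x i < Inf ?C + \<epsilon>" if "\<epsilon> > 0" for \<epsilon>
  proof -
    have "\<exists>c\<in>?C. c < Inf ?C + \<epsilon>"
      using B bdd that by (subst cInf_less_iff[symmetric]) auto
    then show ?thesis by (auto elim: eventually_mono)
  qed
  moreover have "\<exists>\<^sub>F i in F. Inf ?C - \<epsilon> < x i" if "\<epsilon> > 0" for \<epsilon>
  proof (rule ccontr)
    assume "\<not> (\<exists>\<^sub>F i in F. Inf ?C - \<epsilon> < x i)"
    then have "Inf ?C - \<epsilon> \<in> ?C" by (simp add: not_frequently not_less)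
    then have "Inf ?C \<le> Inf ?C - \<epsilon>" using bdd by (rule cInf_lower)
    with that show False by simp
  qed
  ultimately show ?thesis by blast
qed

context chain
begin

text \<open>The basic lower bound: completed by its ground states, the segment is a competitor for
  \<open>e \<alpha> \<beta>\<close>.\<close>

lemma e_le_segment:
  assumes "tolerance \<delta> \<epsilon>" "x \<in> X" "\<alpha> \<in> {a, b}" "\<beta> \<in> {a, b}" "p + 2 * r < q" "near \<epsilon> \<alpha> p x" "near \<epsilon> \<beta> q x"
  shows "e \<alpha> \<beta> \<le> energy {p..<q} x + \<delta>"
  using e_le[OF clamp_conn[OF assms(2-4)] toleranceD(2)[OF assms]] .

lemma near_mono: "near \<epsilon> \<alpha> p x \<Longrightarrow> \<epsilon> \<le> \<epsilon>' \<Longrightarrow> near \<epsilon>' \<alpha> p x"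
  by (force simp: near_def)

lemma near_shift: "near \<epsilon> \<alpha> p (shift i x) \<longleftrightarrow> near \<epsilon> \<alpha> (i + p) x"
proof
  assume *: "near \<epsilon> \<alpha> p (shift i x)"
  show "near \<epsilon> \<alpha> (i + p) x"
    unfolding near_def
  proof (intro allI impI)
    fix j assume "\<bar>j - (i + p)\<bar> \<le> 2 * r"
    with *[unfolded near_def, rule_format, of "j - i"] show "\<bar>x j - \<alpha>\<bar> \<le> \<epsilon>"
      by (simp add: algebra_simps)
  qed
qed (auto simp: near_def)

lemma near_limit:
  assumes "\<And>i. ((\<lambda>n. x n i) \<longlongrightarrow> y i) F" "near \<epsilon> \<alpha> p y" "\<epsilon> < \<epsilon>'"
  shows "\<forall>\<^sub>F n in F. near \<epsilon>' \<alpha> p (x n)"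
proof -
  have "\<forall>\<^sub>F n in F. \<forall>i\<in>{p-2*r..p+2*r}. dist (x n i) (y i) < \<epsilon>' - \<epsilon>"
    using assms(1,3) by (intro eventually_ball_finite ballI tendstoD) auto
  then show ?thesis
  proof eventually_elim
    case (elim n)
    show ?case
      unfolding near_def
    proof (intro allI impI)
      fix i assume i: "\<bar>i - p\<bar> \<le> 2 * r"
      then have "i \<in> {p-2*r..p+2*r}" by auto
      with elim have "\<bar>x n i - y i\<bar> < \<epsilon>' - \<epsilon>" by (force simp: dist_real_def)
      moreover have "\<bar>y i - \<alpha>\<bar> \<le> \<epsilon>" using assms(2) i by (simp add: near_def)
      ultimately show "\<bar>x n i - \<alpha>\<bar> \<le> \<epsilon>'" by linarith
    qed
  qed
qed

lemma near_end:
  assumes "F \<in> ends" "(x \<longlongrightarrow> \<alpha>) F" "\<epsilon> > 0"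
  shows "\<forall>\<^sub>F p in F. near \<epsilon> \<alpha> p x"
proof -
  have "\<forall>\<^sub>F p in F. near \<epsilon> \<alpha> 0 (shift p x)"
  proof (rule near_limit)
    show "((\<lambda>p. shift p x i) \<longlongrightarrow> (\<lambda>_. \<alpha>) i) F" for i
      using filterlim_compose[OF assms(2) ends_shift[OF assms(1)]] by simp
    show "near (\<epsilon> / 2) \<alpha> 0 (\<lambda>_. \<alpha>)" using assms(3) by (intro near_const) simp
  qed (use assms(3) in simp)
  then show ?thesis by (simp add: near_shift)
qed

lemma conn_near:
  assumes "x \<in> conn \<alpha> \<beta>" "\<epsilon> > 0"
  obtains p q where "\<And>i. i \<le> p \<Longrightarrow> near \<epsilon> \<alpha> i x" "\<And>i. q \<le> i \<Longrightarrow> near \<epsilon> \<beta> i x"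
proof -
  have "\<forall>\<^sub>F i in at_bot. near \<epsilon> \<alpha> i x" "\<forall>\<^sub>F i in at_top. near \<epsilon> \<beta> i x"
    using assms by (auto simp: conn_def intro!: near_end)
  then show thesis
    using that unfolding eventually_at_bot_linorder eventually_at_top_linorder by blast
qed

text \<open>A finite set whose energy is within \<open>\<delta>\<close> of the supremum leaves less
  than \<open>\<delta>\<close> for every finite set disjoint from it.\<close>

lemma energy_tail:
  assumes x: "x \<in> X" "energy_le x c" and "\<delta> > 0"
  shows "\<exists>N. \<forall>A. finite A \<longrightarrow> (\<forall>i\<in>A. N \<le> \<bar>i\<bar>) \<longrightarrow> energy A x < \<delta>"
proof -
  let ?S = "(\<lambda>A. \<Sum>j\<in>A. G j x) ` {A. finite A}"
  have bdd: "bdd_above ?S" using x(2) by (auto simp: energy_le_def bdd_above_def)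
  have "\<exists>s\<in>?S. Sup ?S - \<delta> < s"
    using bdd \<open>\<delta> > 0\<close> by (subst less_cSup_iff[symmetric]) auto
  then obtain A0 where A0: "finite A0" "Sup ?S - \<delta> < energy A0 x" by auto
  define N where "N = Max (insert 0 (abs ` A0)) + 1"
  have "energy A x < \<delta>" if A: "finite A" "\<forall>i\<in>A. N \<le> \<bar>i\<bar>" for A
  proof -
    have "A \<inter> A0 = {}"
    proof (rule ccontr)
      assume "A \<inter> A0 \<noteq> {}"
      then obtain i where i: "i \<in> A" "i \<in> A0" by auto
      then have "\<bar>i\<bar> \<le> Max (insert 0 (abs ` A0))" using A0(1) by (intro Max_ge) auto
      with A(2) i show False by (auto simp: N_def)
    qed
    then have "energy A x + energy A0 x = energy (A \<union> A0) x"
      using A A0 by (simp add: sum.union_disjoint)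
    also have "\<dots> \<le> Sup ?S" using A A0 bdd by (intro cSup_upper) auto
    finally show ?thesis using A0(2) by linarith
  qed
  then show ?thesis by blast
qed

lemma G_tendsto_0:
  assumes "x \<in> X" "energy_le x c" "F \<in> ends"
  shows "((\<lambda>i. G i x) \<longlongrightarrow> 0) F"
proof (rule tendstoI)
  fix \<delta> :: real assume "\<delta> > 0"
  then obtain N where N: "\<And>A. finite A \<Longrightarrow> (\<forall>i\<in>A. N \<le> \<bar>i\<bar>) \<Longrightarrow> energy A x < \<delta>"
    using energy_tail[OF assms(1,2)] by blast
  show "\<forall>\<^sub>F i in F. dist (G i x) 0 < \<delta>"
    using ends_abs[OF assms(3), of N]
  proof eventually_elim
    case (elim i)
    then show ?case using N[of "{i}"] G_nonneg[OF assms(1), of i] by simp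
  qed
qed

text \<open>Sites with values near \<open>S\<close> are moved to the origin and compactness is
  applied to the translates. The condition \<open>Q k\<close> pushes the k-th site out to the end
  \<open>F\<close>.\<close>

lemma cluster:
  assumes x: "x \<in> X" and F: "F \<in> ends" and S: "\<And>\<epsilon>. \<epsilon> > 0 \<Longrightarrow> \<exists>\<^sub>F i in F. \<bar>x i - S\<bar> < \<epsilon>"
  shows "\<exists>(n :: nat \<Rightarrow> int) y. filterlim n F sequentially \<and> y \<in> X \<and> y 0 = S \<and> (\<forall>i. (\<lambda>k. x (n k + i)) \<longlonglongrightarrow> y i)"
proof -
  define Q where "Q k i \<longleftrightarrow> (if F = at_top then int k \<le> i else i \<le> - int k)" for k i
  define R where "R k i \<longleftrightarrow> \<bar>x i - S\<bar> < 1 / real (Suc k) \<and> Q k i" for k i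
  have ev: "\<forall>\<^sub>F i in F. Q k i" for k
  proof (cases "F = at_top")
    case True
    then show ?thesis by (simp add: Q_def eventually_ge_at_top)
  next
    case False
    with F have "F = at_bot" by auto
    with False show ?thesis by (simp add: Q_def eventually_le_at_bot)
  qed
  have "\<exists>i. R k i" for k
    unfolding R_def using frequently_eventually_frequently[OF S ev, of "1 / real (Suc k)" k]
    by (intro frequently_ex[of _ F]) auto
  then obtain m where m: "\<And>k. R k (m k)" by metis
  have lim_m: "filterlim m F sequentially"
  proof (cases "F = at_top")
    case True
    then have "int k \<le> m k" for k using m[of k] by (simp add: R_def Q_def)
    then have "filterlim m at_top sequentially"
      using filterlim_at_top_mono[OF filterlim_int_sequentially] by simp
    with True show ?thesis by simp
  next
    case False
    then have "int k \<le> - m k" for k using m[of k] by (auto simp: R_def Q_def)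
    then have le: "m k \<le> Z" if "k \<ge> nat (- Z)" for k Z
      using that by (metis add.inverse_inverse minus_le_iff nat_le_iff order_trans neg_le_iff_le)
    have "filterlim m at_bot sequentially"
      unfolding filterlim_at_bot eventually_sequentially using le by blast
    moreover have "F = at_bot" using False F by auto
    ultimately show ?thesis by simp
  qed
  have band: "shift (m k) x \<in> X" for k using x by simp
  obtain y \<sigma> where y: "y \<in> X" "strict_mono (\<sigma> :: nat \<Rightarrow> nat)" "\<And>i. (\<lambda>k. shift (m (\<sigma> k)) x i) \<longlonglongrightarrow> y i"
    using band_seq_compact[where x = "\<lambda>k. shift (m k) x", OF band] by blast
  have "(\<lambda>k. x (m k) - S) \<longlonglongrightarrow> 0"
  proof (rule Lim_null_comparison)
    show "\<forall>\<^sub>F k in sequentially. norm (x (m k) - S) \<le> 1 / real (Suc k)"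
      using m by (auto simp: R_def intro!: always_eventually less_imp_le)
    show "(\<lambda>k. 1 / real (Suc k)) \<longlonglongrightarrow> 0"
      using LIMSEQ_inverse_real_of_nat by (simp add: inverse_eq_divide)
  qed
  then have "(\<lambda>k. x (m k)) \<longlonglongrightarrow> S" by (simp add: LIM_zero_iff)
  then have "(\<lambda>k. x (m (\<sigma> k))) \<longlonglongrightarrow> S"
    using LIMSEQ_subseq_LIMSEQ[OF _ y(2)] by (auto simp: o_def)
  then have "y 0 = S" using y(3)[of 0] by (auto intro: LIMSEQ_unique)
  moreover have "filterlim (\<lambda>k. m (\<sigma> k)) F sequentially"
    using filterlim_compose[OF lim_m filterlim_subseq[OF y(2)]] .
  ultimately show ?thesis using y by (intro exI[of _ "\<lambda>k. m (\<sigma> k)"] exI[of _ y]) auto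
qed

lemma shift_rmax: "shift i (rmax k x) = rmax k (shift i x)"
  and shift_rmin: "shift i (rmin k x) = rmin k (shift i x)"
proof -
  have comm: "shift i (shift 1 z) = shift 1 (shift i z)" for z by (simp add: add.commute)
  show "shift i (rmax k x) = rmax k (shift i x)"
    by (induction k) (simp_all only: rmax_simps shift_sup comm)
  show "shift i (rmin k x) = rmin k (shift i x)"
    by (induction k) (simp_all only: rmin_simps shift_inf comm)
qed

lemma rmax_tendsto: "(\<And>i. ((\<lambda>n. x n i) \<longlongrightarrow> y i) F) \<Longrightarrow> ((\<lambda>n. rmax k (x n) i) \<longlongrightarrow> rmax k y i) F"
  and rmin_tendsto: "(\<And>i. ((\<lambda>n. x n i) \<longlongrightarrow> y i) F) \<Longrightarrow> ((\<lambda>n. rmin k (x n) i) \<longlongrightarrow> rmin k y i) F"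
  by (induction k arbitrary: i) (auto simp: sup_real_def inf_real_def intro!: tendsto_max tendsto_min)

text \<open>Along translates to an end, \<open>G\<close> tends to 0 for every chain of finite
  energy. Running extrema keep finite energy, commute with translation and are continuous, so the
  same limit argument applies to them.\<close>

lemma cluster_calibrated:
  assumes x: "x \<in> X" "energy_le x c" and F: "F \<in> ends"
    and n: "filterlim n F sequentially" "y \<in> X" "\<And>i. (\<lambda>k. x (n k + i)) \<longlonglongrightarrow> y i"
  shows "G i (rmax m y) = 0" "G i (rmin m y) = 0"
proof -
  have lim: "G i (f y) = 0"
    if f: "\<And>x. x \<in> X \<Longrightarrow> f x \<in> X" "f x \<in> X" "energy_le (f x) C" "\<And>j x. shift j (f x) = f (shift j x)"
      "\<And>i. (\<lambda>k. f (shift (n k) x) i) \<longlonglongrightarrow> f y i" for f C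
  proof -
    have "(\<lambda>k. G i (f (shift (n k) x))) \<longlonglongrightarrow> G i (f y)"
      using f x(1) n(2) by (intro G_tendsto) auto
    moreover have "(\<lambda>k. G (n k + i) (f x)) \<longlonglongrightarrow> 0"
      using filterlim_compose[OF G_tendsto_0[OF f(2,3) F] filterlim_compose[OF ends_shift[OF F] n(1)]] .
    moreover have "G (n k + i) (f x) = G i (f (shift (n k) x))" for k
      unfolding f(4)[symmetric] G_shift by (simp add: add.commute)
    ultimately show ?thesis by (auto intro: LIMSEQ_unique)
  qed
  have sh: "\<And>i. (\<lambda>k. shift (n k) x i) \<longlonglongrightarrow> y i" using n(3) by simp
  obtain C where "energy_le (rmax m x) C" using energy_rmax[OF x] by blast
  then show "G i (rmax m y) = 0"
    using x by (intro lim[of "rmax m" C] rmax_tendsto sh) (simp_all only: shift_rmax rmax_band)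
  obtain C where "energy_le (rmin m x) C" using energy_rmin[OF x] by blast
  then show "G i (rmin m y) = 0"
    using x by (intro lim[of "rmin m" C] rmin_tendsto sh) (simp_all only: shift_rmin rmin_band)
qed

lemma calibrated_max:
  assumes y: "y \<in> X" "\<And>i m. G i (rmax m y) = 0" "\<And>i. y i \<le> y 0"
  shows "y 0 \<in> {a, b}"
proof -
  have S: "a \<le> y 0" "y 0 \<le> b" using y(1) by (auto simp: band_def)
  \<comment> \<open>The running maximum is constant on a whole interaction range, so \<open>G\<close> sees a constant chain.\<close>
  have "rmax (nat (2 * r)) y j = y 0" if "\<bar>j - (- r)\<bar> \<le> r" for j
    using that y(3) by (intro order_antisym rmax_le rmax_ge) auto
  then have "G (-r) (rmax (nat (2 * r)) y) = G (-r) (\<lambda>_. y 0)"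
    using y(1) S by (intro G_local) auto
  then have "h (\<lambda>_. y 0) = 0" using y(2) by (simp add: G_const)
  with h_const_0[OF S] show ?thesis by simp
qed

lemma calibrated_min:
  assumes y: "y \<in> X" "\<And>i m. G i (rmin m y) = 0" "\<And>i. y 0 \<le> y i"
  shows "y 0 \<in> {a, b}"
proof -
  have S: "a \<le> y 0" "y 0 \<le> b" using y(1) by (auto simp: band_def)
  have "rmin (nat (2 * r)) y j = y 0" if "\<bar>j - (- r)\<bar> \<le> r" for j
    using that y(3) by (intro order_antisym rmin_ge rmin_le) auto
  then have "G (-r) (rmin (nat (2 * r)) y) = G (-r) (\<lambda>_. y 0)"
    using y(1) S by (intro G_local) auto
  then have "h (\<lambda>_. y 0) = 0" using y(2) by (simp add: G_const)
  with h_const_0[OF S] show ?thesis by simp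
qed

text \<open>Single values near a ground state become whole blocks near it: the limit of the
  translates is calibrated and takes the value \<open>\<alpha>\<close>, so by strong comparison it
  is constant.\<close>

lemma frequently_near_end:
  assumes x: "x \<in> X" "energy_le x c" and F: "F \<in> ends" and n: "filterlim n F sequentially" "y \<in> X" "\<And>i. (\<lambda>k. x (n k + i)) \<longlonglongrightarrow> y i"
    and y: "y 0 = \<alpha>" "\<alpha> \<in> {a, b}" and "\<epsilon> > 0"
  shows "\<exists>\<^sub>F p in F. near \<epsilon> \<alpha> p x"
proof -
  have "energy_le y 0"
    using cluster_calibrated(1)[OF x F n, of _ 0] n(2) by (simp add: energy_le_0_iff)
  then have "y = (\<lambda>_. a) \<or> y = (\<lambda>_. b) \<or> (\<forall>i. a < y i \<and> y i < b)"
    using calibrated_EL[OF n(2)] by blast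
  with y have "y = (\<lambda>_. \<alpha>)" by force
  then have "near (\<epsilon> / 2) \<alpha> 0 y" using \<open>\<epsilon> > 0\<close> by (simp add: near_const)
  then have "\<forall>\<^sub>F k in sequentially. near \<epsilon> \<alpha> 0 (shift (n k) x)"
    using n(3) \<open>\<epsilon> > 0\<close> by (intro near_limit[where x = "\<lambda>k. shift (n k) x" and y = y and \<epsilon> = "\<epsilon> / 2"]) auto
  then have "\<forall>\<^sub>F k in sequentially. near \<epsilon> \<alpha> (n k) x" by (simp add: near_shift)
  then have "\<exists>\<^sub>F p in filtermap n sequentially. near \<epsilon> \<alpha> p x"
    by (intro eventually_frequently) (auto simp: eventually_filtermap filtermap_bot_iff)
  then show ?thesis
    using n(1) unfolding filterlim_def frequently_def by (auto dest: filter_leD)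
qed

end

text \<open>The gap condition on transitions supplies minimal transitions in both directions, since
  an adjacent pair consists of minimizers.\<close>

locale chain_min = chain +
  assumes min_ab: "\<exists>x\<in>conn a b. energy_le x (e a b)" and min_ba: "\<exists>x\<in>conn b a. energy_le x (e b a)"
begin

lemma loop_pos: "0 < e a b + e b a"
proof (rule ccontr)
  \<comment> \<open>Otherwise the lower envelope of two minimal transitions has \<open>G = 0\<close> and touches the first one.\<close>
  assume "\<not> 0 < e a b + e b a"
  then have "e a b = 0" "e b a = 0" using e_nonneg[of a b] e_nonneg[of b a] by auto
  then obtain x y where x: "x \<in> conn a b" "energy_le x 0" and y: "y \<in> conn b a" "energy_le y 0"
    using min_ab min_ba by auto
  have lim: "(x \<longlongrightarrow> a) at_bot" "(x \<longlongrightarrow> b) at_top" "(y \<longlongrightarrow> b) at_bot" "(y \<longlongrightarrow> a) at_top"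
    using x y by (auto simp: conn_def)
  have X: "x \<in> X" "inf x y \<in> X" using x y by (auto simp: conn_def)
  have "\<forall>\<^sub>F i in at_bot. x i < (a + b) / 2" "\<forall>\<^sub>F i in at_bot. (a + b) / 2 < y i"
    using order_tendstoD(2)[OF lim(1), of "(a + b) / 2"] order_tendstoD(1)[OF lim(3), of "(a + b) / 2"] ab
    by simp_all
  then have "\<forall>\<^sub>F i in at_bot. x i < y i" by eventually_elim linarith
  then obtain i where "x i < y i" using eventually_happens' trivial_limit_at_bot_linorder by blast
  then have "inf x y i = x i" by (simp add: inf_real_def)
  moreover have "energy_le (inf x y) 0" using x y by (rule calibrated_inf)
  ultimately have "inf x y = x" using X x by (intro calibrated_touching) auto
  moreover have "(inf x y \<longlongrightarrow> min b a) at_top" using lim by (intro inf_tendsto)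
  ultimately have "(x \<longlongrightarrow> a) at_top" using ab by simp
  with lim(2) have "a = b" by (intro tendsto_unique[of at_top x]) auto
  with ab show False by simp
qed

lemma no_loops_at_end:
  assumes x: "x \<in> X" "energy_le x c" and F: "F \<in> ends"
    and a: "\<And>\<epsilon>. \<epsilon> > 0 \<Longrightarrow> \<exists>\<^sub>F p in F. near \<epsilon> a p x" and b: "\<And>\<epsilon>. \<epsilon> > 0 \<Longrightarrow> \<exists>\<^sub>F p in F. near \<epsilon> b p x"
  shows False
proof -
  \<comment> \<open>A loop costs at least \<open>3 * \<delta>\<close> minus two tolerances, that is
    \<open>\<delta>\<close>, whereas the whole tail has energy below
    \<open>\<delta>\<close>.\<close>
  define \<delta> where "\<delta> = (e a b + e b a) / 3"
  have "\<delta> > 0" using loop_pos by (simp add: \<delta>_def)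
  obtain \<epsilon> where tol: "tolerance \<delta> \<epsilon>"
    using tolerance_exists[OF \<open>\<delta> > 0\<close>] by blast
  note eps = toleranceD(1)[OF tol] e_le_segment[OF tol]
  obtain N where N: "\<And>A. finite A \<Longrightarrow> (\<forall>i\<in>A. N \<le> \<bar>i\<bar>) \<Longrightarrow> energy A x < \<delta>"
    using energy_tail[OF x \<open>\<delta> > 0\<close>] by blast
  have "\<exists>p q s. near \<epsilon> a p x \<and> near \<epsilon> b q x \<and> near \<epsilon> a s x \<and> p + 2 * r < q \<and> q + 2 * r < s \<and> (\<forall>i\<in>{p..<s}. N \<le> \<bar>i\<bar>)"
  proof (cases "F = at_top")
    case True
    have ex: "\<exists>p>M. near \<epsilon> \<alpha> p x" if "\<exists>\<^sub>F p in F. near \<epsilon> \<alpha> p x" for M \<alpha>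
      using frequently_eventually_frequently[OF that, of "\<lambda>p. p > M"] True
      by (auto dest: frequently_ex simp: eventually_gt_at_top)
    obtain p where "p > \<bar>N\<bar>" "near \<epsilon> a p x" using ex[OF a[OF eps(1)]] by blast
    moreover obtain q where "q > p + 2 * r" "near \<epsilon> b q x" using ex[OF b[OF eps(1)]] by blast
    moreover obtain s where "s > q + 2 * r" "near \<epsilon> a s x" using ex[OF a[OF eps(1)]] by blast
    ultimately show ?thesis by (intro exI[of _ p] exI[of _ q] exI[of _ s]) auto
  next
    case False
    have ex: "\<exists>p<M. near \<epsilon> \<alpha> p x" if "\<exists>\<^sub>F p in F. near \<epsilon> \<alpha> p x" for M \<alpha>
    proof -
      have "\<forall>\<^sub>F p in F. p \<le> M - 1" using False F eventually_le_at_bot[of "M - 1"] by auto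
      from frequently_ex[OF frequently_eventually_frequently[OF that this]] show ?thesis by auto
    qed
    obtain s where "s < - \<bar>N\<bar>" "near \<epsilon> a s x" using ex[OF a[OF eps(1)]] by blast
    moreover obtain q where "q < s - 2 * r" "near \<epsilon> b q x" using ex[OF b[OF eps(1)]] by blast
    moreover obtain p where "p < q - 2 * r" "near \<epsilon> a p x" using ex[OF a[OF eps(1)]] by blast
    ultimately show ?thesis by (intro exI[of _ p] exI[of _ q] exI[of _ s]) auto
  qed
  then obtain p q s where pqs: "near \<epsilon> a p x" "near \<epsilon> b q x" "near \<epsilon> a s x" "p + 2 * r < q" "q + 2 * r < s"
      "\<forall>i\<in>{p..<s}. N \<le> \<bar>i\<bar>"
    by blast
  have "e a b \<le> energy {p..<q} x + \<delta>" "e b a \<le> energy {q..<s} x + \<delta>"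
    using pqs by (auto intro!: eps(2) x)
  moreover have "energy {p..<s} x = energy {p..<q} x + energy {q..<s} x"
    using pqs r1 by (intro sum_int_concat) auto
  moreover have "energy {p..<s} x < \<delta>" using pqs(6) by (intro N) auto
  moreover have "3 * \<delta> = e a b + e b a" by (simp add: \<delta>_def)
  ultimately show False by linarith
qed

text \<open>Limsup and liminf are both ground state values, by the running maximum and the running
  minimum. If they differed, blocks near \<open>a\<close> and near \<open>b\<close> would alternate
  forever, producing loops at the end.\<close>

lemma end_limits:
  assumes x: "x \<in> X" "energy_le x c" and F: "F \<in> ends"
  shows "(x \<longlongrightarrow> a) F \<or> (x \<longlongrightarrow> b) F"
proof -
  have bd: "a \<le> x i" "x i \<le> b" for i using x by (auto simp: band_def)
  obtain S where S: "\<And>\<epsilon>. \<epsilon> > 0 \<Longrightarrow> \<forall>\<^sub>F i in F. x i < S + \<epsilon>" "\<And>\<epsilon>. \<epsilon> > 0 \<Longrightarrow> \<exists>\<^sub>F i in F. S - \<epsilon> < x i"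
    using limsup_exists[OF ends_nontrivial[OF F], of a x b] bd by blast
  \<comment> \<open>The liminf is treated as the limsup of \<open>- x\<close>.\<close>
  obtain I' where "\<And>\<epsilon>. \<epsilon> > 0 \<Longrightarrow> \<forall>\<^sub>F i in F. - x i < I' + \<epsilon>" "\<And>\<epsilon>. \<epsilon> > 0 \<Longrightarrow> \<exists>\<^sub>F i in F. I' - \<epsilon> < - x i"
    using limsup_exists[OF ends_nontrivial[OF F], of "- b" "\<lambda>i. - x i" "- a"] bd by auto
  note I' = this
  define I where "I = - I'"
  have I: "\<forall>\<^sub>F i in F. I - \<epsilon> < x i" "\<exists>\<^sub>F i in F. x i < I + \<epsilon>" if "\<epsilon> > 0" for \<epsilon>
    using eventually_mono[OF I'(1)[OF that], of "\<lambda>i. I - \<epsilon> < x i"]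
      frequently_elim1[OF I'(2)[OF that], of "\<lambda>i. x i < I + \<epsilon>"] by (auto simp: I_def)
  have "\<exists>\<^sub>F i in F. \<bar>x i - S\<bar> < \<epsilon>" if "\<epsilon> > 0" for \<epsilon>
    using frequently_eventually_frequently[OF S(2)[OF that] S(1)[OF that]] by (rule frequently_elim1) auto
  then obtain n y where n: "filterlim n F sequentially" "y \<in> X" "\<And>i. (\<lambda>k. x (n k + i)) \<longlonglongrightarrow> y i" and y0: "y 0 = S"
    using cluster[OF x(1) F, of S] by blast
  have "\<exists>\<^sub>F i in F. \<bar>x i - I\<bar> < \<epsilon>" if "\<epsilon> > 0" for \<epsilon>
    using frequently_eventually_frequently[OF I(2)[OF that] I(1)[OF that]] by (rule frequently_elim1) auto
  then obtain m z where m: "filterlim m F sequentially" "z \<in> X" "\<And>i. (\<lambda>k. x (m k + i)) \<longlonglongrightarrow> z i" and z0: "z 0 = I"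
    using cluster[OF x(1) F, of I] by blast
  have y_le: "y i \<le> y 0" for i
  proof (rule field_le_epsilon)
    fix \<epsilon> :: real assume "\<epsilon> > 0"
    have "\<forall>\<^sub>F k in sequentially. x (n k + i) < S + \<epsilon>"
      using S(1)[OF \<open>\<epsilon> > 0\<close>] filterlim_compose[OF ends_shift[OF F] n(1)] by (auto simp: filterlim_iff)
    then have "\<forall>\<^sub>F k in sequentially. x (n k + i) \<le> S + \<epsilon>" by (rule eventually_mono) simp
    then show "y i \<le> y 0 + \<epsilon>" unfolding y0 by (intro tendsto_upperbound[OF n(3)]) auto
  qed
  have z_ge: "z 0 \<le> z i" for i
  proof (rule field_le_epsilon)
    fix \<epsilon> :: real assume "\<epsilon> > 0"
    have "\<forall>\<^sub>F k in sequentially. I - \<epsilon> < x (m k + i)"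
      using I(1)[OF \<open>\<epsilon> > 0\<close>] filterlim_compose[OF ends_shift[OF F] m(1)] by (auto simp: filterlim_iff)
    then have "\<forall>\<^sub>F k in sequentially. I - \<epsilon> \<le> x (m k + i)" by (rule eventually_mono) simp
    then have "I - \<epsilon> \<le> z i" by (intro tendsto_lowerbound[OF m(3)]) auto
    then show "z 0 \<le> z i + \<epsilon>" using z0 by simp
  qed
  have SI: "S \<in> {a, b}" "I \<in> {a, b}"
    using calibrated_max[OF n(2) cluster_calibrated(1)[OF x F n] y_le]
      calibrated_min[OF m(2) cluster_calibrated(2)[OF x F m] z_ge] y0 z0 by auto
  consider "S = a" | "I = b" | "S = b" "I = a" using SI by auto
  then show ?thesis
  proof cases
    case 1
    have "(x \<longlongrightarrow> a) F"
    proof (rule tendstoI)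
      fix \<epsilon> :: real assume "\<epsilon> > 0"
      from S(1)[OF this] show "\<forall>\<^sub>F i in F. dist (x i) a < \<epsilon>"
        by (rule eventually_mono) (use bd 1 in \<open>simp add: dist_real_def\<close>)
    qed
    then show ?thesis ..
  next
    case 2
    have "(x \<longlongrightarrow> b) F"
    proof (rule tendstoI)
      fix \<epsilon> :: real assume "\<epsilon> > 0"
      from I(1)[OF this] show "\<forall>\<^sub>F i in F. dist (x i) b < \<epsilon>"
      proof (rule eventually_mono)
        fix i assume "I - \<epsilon> < x i"
        with bd(2)[of i] 2 show "dist (x i) b < \<epsilon>" by (simp add: dist_real_def)
      qed
    qed
    then show ?thesis ..
  next
    case 3
    have "\<exists>\<^sub>F p in F. near \<epsilon> a p x" "\<exists>\<^sub>F p in F. near \<epsilon> b p x" if "\<epsilon> > 0" for \<epsilon>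
      using frequently_near_end[OF x F m _ _ that, of a] frequently_near_end[OF x F n _ _ that, of b] y0 z0 3
      by auto
    then show ?thesis using no_loops_at_end[OF x F] by blast
  qed
qed

end

section \<open>Lossless gluing and transitions of bounded width\<close>

context chain
begin

lemma conn_upd:
  assumes "x \<in> conn \<alpha> \<beta>" "x(i := t) \<in> X"
  shows "x(i := t) \<in> conn \<alpha> \<beta>"
proof -
  have "\<forall>\<^sub>F j in F. x j = (x(i := t)) j" if "F \<in> ends" for F
    using ends_abs[OF that, of "\<bar>i\<bar> + 1"] by (rule eventually_mono) auto
  then have "(x(i := t) \<longlongrightarrow> c) F" if "F \<in> ends" "(x \<longlongrightarrow> c) F" for c F
    using Lim_transform_eventually[OF that(2)] that(1) by blast
  with assms show ?thesis by (simp only: conn_def mem_Collect_eq insert_iff simp_thms)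
qed

text \<open>If the pieces agree on the \<open>2 * r\<close> sites around the seam, every density of
  the glued chain equals a density of one piece, so the seam costs nothing.\<close>

lemma glue_exact:
  assumes "x \<in> X" "y \<in> X" "\<And>i. q - r \<le> i \<Longrightarrow> i < q + r \<Longrightarrow> x i = y i"
    and "energy_le x c" "energy_le y c'"
  shows "energy_le (glue q x y) (c + c')"
  unfolding energy_le_def
proof (intro allI impI)
  fix A :: "int set" assume A: "finite A"
  have X: "glue q x y \<in> X" using assms by (intro glue_band)
  have "G j (glue q x y) = (if j < q then G j x else G j y)" for j
    using assms(1-3) X by (auto intro!: G_local simp: glue_def)
  then have "energy A (glue q x y) \<le> (\<Sum>j\<in>A. G j x + G j y)"
    using G_nonneg[OF assms(1)] G_nonneg[OF assms(2)] by (intro sum_mono) (auto simp: add_increasing add_increasing2)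
  also have "\<dots> \<le> c + c'"
    unfolding sum.distrib using energy_leD[OF assms(4) A] energy_leD[OF assms(5) A] by (rule add_mono)
  finally show "energy A (glue q x y) \<le> c + c'" .
qed

lemma step_transition:
  assumes "\<alpha> \<in> {a, b}" "\<beta> \<in> {a, b}"
  shows "\<exists>x c. x \<in> X \<and> (\<forall>i<0. x i = \<alpha>) \<and> (\<forall>i\<ge>0. x i = \<beta>) \<and> energy_le x c"
  using step_conn[OF assms, of 0] step_energy[OF assms, of 0] conn_band
  by (intro exI[of _ "glue 0 (\<lambda>_. \<alpha>) (\<lambda>_. \<beta>)"]) (auto simp: glue_def)

text \<open>A chain in \<open>conn \<alpha> \<beta>\<close> may reach its limits only
  asymptotically. Cutting off its tails makes the width \<open>w\<close> finite, so copies can be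
  glued without loss.\<close>

lemma near_optimal_transition:
  assumes \<alpha>\<beta>: "\<alpha> \<in> {a, b}" "\<beta> \<in> {a, b}" and "\<delta> > 0"
  shows "\<exists>x w. x \<in> X \<and> w \<ge> 0 \<and> (\<forall>i<0. x i = \<alpha>) \<and> (\<forall>i\<ge>w. x i = \<beta>) \<and> energy_le x (e \<alpha> \<beta> + \<delta>)"
proof -
  have \<delta>2: "\<delta> / 2 > 0" using \<open>\<delta> > 0\<close> by simp
  obtain x where x: "x \<in> conn \<alpha> \<beta>" "energy_le x (e \<alpha> \<beta> + \<delta> / 2)"
    using e_approx[OF \<alpha>\<beta>, of "e \<alpha> \<beta> + \<delta> / 2"] \<delta>2 by auto
  have X: "x \<in> X" using x by (simp add: conn_def)
  obtain \<epsilon> where eps: "tolerance (\<delta> / 2) \<epsilon>"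
    using tolerance_exists[OF \<delta>2] by blast
  obtain p0 q0 where pq0: "\<And>p. p \<le> p0 \<Longrightarrow> near \<epsilon> \<alpha> p x" "\<And>q. q \<ge> q0 \<Longrightarrow> near \<epsilon> \<beta> q x"
    using conn_near[OF x(1) toleranceD(1)[OF eps]] by blast
  define p q where "p = p0" and "q = max q0 (p0 + 2 * r + 1)"
  have en: "energy_le (clamp \<alpha> p \<beta> q x) (energy {p..<q} x + \<delta> / 2)"
    using X pq0 \<alpha>\<beta> by (intro toleranceD(2)[OF eps]) (auto simp: p_def q_def)
  have "energy {p..<q} x \<le> e \<alpha> \<beta> + \<delta> / 2" using x(2) by (intro energy_leD) auto
  then have "energy_le (clamp \<alpha> p \<beta> q x) (e \<alpha> \<beta> + \<delta>)"
    by (intro energy_le_mono[OF en]) simp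
  then have "energy_le (shift p (clamp \<alpha> p \<beta> q x)) (e \<alpha> \<beta> + \<delta>)" by (rule energy_le_shift)
  moreover have "shift p (clamp \<alpha> p \<beta> q x) \<in> X"
    using clamp_conn[OF X \<alpha>\<beta>] conn_band by (intro band_shift) blast
  ultimately show ?thesis
    using r1 by (intro exI[of _ "shift p (clamp \<alpha> p \<beta> q x)"] exI[of _ "q - p"])
      (auto simp: clamp_def glue_def p_def q_def)
qed

end

section \<open>Forced closeness to ground states, escaping energy and excess\<close>

context chain_min
begin

definition forces_near :: "real \<Rightarrow> int \<Rightarrow> real \<Rightarrow> real \<Rightarrow> real \<Rightarrow> bool" where
  "forces_near C l \<alpha> \<theta> \<epsilon> \<longleftrightarrow> (\<forall>x\<in>X. \<forall>i0. energy_le x C \<longrightarrow> (\<forall>i. i0 \<le> i \<and> i < i0 + l \<longrightarrow> \<bar>x i - \<alpha>\<bar> \<le> \<theta>) \<longrightarrow>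
    (\<exists>p. i0 \<le> p \<and> p < i0 + l \<and> near \<epsilon> \<alpha> p x))"

lemma near_choice:
  assumes "forces_near C l \<alpha> \<theta> \<epsilon>" "x \<in> X" "energy_le x C"
    and "\<And>j i. j < (k::nat) \<Longrightarrow> i0 j \<le> i \<Longrightarrow> i < i0 j + l \<Longrightarrow> \<bar>x i - \<alpha>\<bar> \<le> \<theta>"
  obtains p where "\<And>j. j < k \<Longrightarrow> i0 j \<le> p j \<and> p j < i0 j + l \<and> near \<epsilon> \<alpha> (p j) x"
proof -
  have "\<exists>p. j < k \<longrightarrow> i0 j \<le> p \<and> p < i0 j + l \<and> near \<epsilon> \<alpha> p x" for j
    using assms unfolding forces_near_def by blast
  then show thesis using that by metis
qed

text \<open>Otherwise longer and longer windows, recentred, have a limit of finite energy that stays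
  within \<open>\<rho>\<close> of \<open>\<alpha>\<close> on the whole line. It converges to a
  ground state, which is \<open>\<alpha>\<close> because \<open>\<rho> < b - a\<close>, and so the
  approximants come near \<open>\<alpha>\<close> as well.\<close>

lemma window_near:
  assumes \<alpha>: "\<alpha> \<in> {a, b}" and \<rho>: "\<rho> < b - a" and "\<epsilon> > 0"
  shows "\<exists>l0. \<forall>l\<ge>l0. forces_near C l \<alpha> \<rho> \<epsilon>"
proof (rule ccontr)
  assume neg: "\<not> ?thesis"
  define R where "R L z \<longleftrightarrow> z \<in> X \<and> energy_le z C \<and> (\<forall>j. \<bar>j\<bar> \<le> int L \<longrightarrow> \<bar>z j - \<alpha>\<bar> \<le> \<rho> \<and> \<not> near \<epsilon> \<alpha> j z)" for L z
  have "\<exists>z. R L z" for L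
  proof -
    \<comment> \<open>A window of at least \<open>2 * int L + 1\<close> sites leaves
      \<open>L\<close> sites on either side of the new origin.\<close>
    obtain x i0 l where x: "x \<in> X" "energy_le x C" "l \<ge> 2 * int L + 1" "\<forall>i. i0 \<le> i \<and> i < i0 + l \<longrightarrow> \<bar>x i - \<alpha>\<bar> \<le> \<rho>"
      "\<not> (\<exists>p. i0 \<le> p \<and> p < i0 + l \<and> near \<epsilon> \<alpha> p x)"
      using neg unfolding forces_near_def by blast
    have "R L (shift (i0 + int L) x)"
      unfolding R_def near_shift
    proof (intro conjI allI impI)
      fix j assume "\<bar>j\<bar> \<le> int L"
      then have "i0 \<le> i0 + int L + j" "i0 + int L + j < i0 + l" using x(3) by auto
      with x(4,5) show "\<bar>shift (i0 + int L) x j - \<alpha>\<bar> \<le> \<rho>" "\<not> near \<epsilon> \<alpha> (i0 + int L + j) x"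
        by auto
    qed (use x in \<open>auto intro: energy_le_shift\<close>)
    then show ?thesis by blast
  qed
  then obtain z where z: "\<And>L. R L (z L)" by metis
  then have zX: "z L \<in> X" for L by (simp add: R_def)
  obtain y \<sigma> where y: "y \<in> X" "strict_mono (\<sigma> :: nat \<Rightarrow> nat)" "\<And>i. (\<lambda>n. z (\<sigma> n) i) \<longlonglongrightarrow> y i"
    using band_seq_compact[where x = z, OF zX] by blast
  have en: "energy_le y C"
    using z by (intro energy_le_limit[OF zX y(1) y(3), of "\<lambda>_. C"]) (auto simp: R_def)
  have large: "\<forall>\<^sub>F n in sequentially. \<bar>j\<bar> \<le> int (\<sigma> n)" for j
    using eventually_ge_at_top[of "nat \<bar>j\<bar>"]
  proof eventually_elim
    case (elim n)
    with seq_suble[OF y(2), of n] show ?case by linarith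
  qed
  have y_le: "\<bar>y j - \<alpha>\<bar> \<le> \<rho>" for j
  proof (rule tendsto_upperbound)
    show "(\<lambda>n. \<bar>z (\<sigma> n) j - \<alpha>\<bar>) \<longlonglongrightarrow> \<bar>y j - \<alpha>\<bar>" by (intro tendsto_intros y(3))
    show "\<forall>\<^sub>F n in sequentially. \<bar>z (\<sigma> n) j - \<alpha>\<bar> \<le> \<rho>"
      using large[of j] by (rule eventually_mono) (use z in \<open>auto simp: R_def\<close>)
  qed simp
  obtain \<beta> where \<beta>: "\<beta> \<in> {a, b}" "(y \<longlongrightarrow> \<beta>) at_top" using end_limits[OF y(1) en, of at_top] by blast
  have "\<bar>\<beta> - \<alpha>\<bar> \<le> \<rho>"
    by (rule tendsto_upperbound[of "\<lambda>j. \<bar>y j - \<alpha>\<bar>" _ at_top])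
      (use \<beta> y_le in \<open>auto intro!: tendsto_intros\<close>)
  then have "\<beta> = \<alpha>" using \<alpha> \<beta>(1) \<rho> ab by auto
  then have "\<forall>\<^sub>F p in at_top. near (\<epsilon> / 2) \<alpha> p y"
    using \<beta>(2) \<open>\<epsilon> > 0\<close> by (intro near_end) auto
  then obtain p where "near (\<epsilon> / 2) \<alpha> p y"
    using eventually_happens' trivial_limit_at_top_linorder by blast
  then have "\<forall>\<^sub>F n in sequentially. near \<epsilon> \<alpha> p (z (\<sigma> n))"
    using y(3) \<open>\<epsilon> > 0\<close> by (intro near_limit[where y = y and \<epsilon> = "\<epsilon> / 2"]) auto
  with large[of p] have "\<forall>\<^sub>F n in sequentially. False"
    by eventually_elim (use z in \<open>auto simp: R_def\<close>)
  then show False by simp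
qed

text \<open>If the limit of a minimizing sequence has other limits at infinity than the sequence itself, the
  energy of the missing transitions has escaped to infinity.\<close>

lemma limit_energy_split:
  assumes \<alpha>\<beta>: "\<alpha> \<in> {a, b}" "\<beta> \<in> {a, b}"
    and z: "\<And>n. z n \<in> conn \<alpha> \<beta>" "\<And>n. energy_le (z n) (c n)" "c \<longlonglongrightarrow> e \<alpha> \<beta>"
    and y: "\<And>i. (\<lambda>n. z n i) \<longlonglongrightarrow> y i" "y \<in> conn \<alpha>' \<beta>'" and \<alpha>\<beta>': "\<alpha>' \<in> {a, b}" "\<beta>' \<in> {a, b}"
  shows "energy_le y (e \<alpha> \<beta> - e \<alpha> \<alpha>' - e \<beta>' \<beta>)"
  unfolding energy_le_def
proof (intro allI impI)
  fix A :: "int set" assume A: "finite A"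
  have X: "z n \<in> X" "y \<in> X" for n using z y by (auto simp: conn_def)
  have "energy A y \<le> (e \<alpha> \<beta> - e \<alpha> \<alpha>' - e \<beta>' \<beta>) + \<eta>" if "\<eta> > 0" for \<eta>
  proof -
    \<comment> \<open>Four losses: the two escaping transitions, the passage from \<open>z n\<close>
      to \<open>y\<close> on \<open>A\<close>, and \<open>c n\<close> above its limit.\<close>
    define \<delta> where "\<delta> = \<eta> / 4"
    have \<delta>: "\<delta> > 0" "\<eta> = 4 * \<delta>" using that by (auto simp: \<delta>_def)
    obtain \<epsilon> where tol: "tolerance \<delta> \<epsilon>"
      using tolerance_exists[OF \<delta>(1)] by blast
    note eps = toleranceD(1)[OF tol] e_le_segment[OF tol]
    define N where "N = Max (insert 0 (abs ` A)) + 1"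
    have N: "\<bar>i\<bar> < N" if "i \<in> A" for i
    proof -
      have "\<bar>i\<bar> \<le> Max (insert 0 (abs ` A))" using A that by (intro Max_ge) auto
      then show ?thesis by (simp add: N_def)
    qed
    obtain P0 Q0 where PQ0: "\<And>p. p \<le> P0 \<Longrightarrow> near (\<epsilon> / 2) \<alpha>' p y" "\<And>q. q \<ge> Q0 \<Longrightarrow> near (\<epsilon> / 2) \<beta>' q y"
      using conn_near[OF y(2), of "\<epsilon> / 2"] eps(1) by auto
    define P Q where "P = min P0 (- \<bar>N\<bar>)" and "Q = max Q0 \<bar>N\<bar>"
    have PQ: "P \<le> Q" "A \<subseteq> {P..<Q}" using N by (force simp: P_def Q_def)+
    have "\<forall>\<^sub>F n in sequentially. near \<epsilon> \<alpha>' P (z n)" "\<forall>\<^sub>F n in sequentially. near \<epsilon> \<beta>' Q (z n)"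
      using PQ0(1)[of P] PQ0(2)[of Q] y(1) eps(1)
      by (auto simp: P_def Q_def intro!: near_limit[where y = y and \<epsilon> = "\<epsilon> / 2"])
    moreover have "\<forall>\<^sub>F n in sequentially. c n < e \<alpha> \<beta> + \<delta>"
      using order_tendstoD(2)[OF z(3)] \<delta>(1) by simp
    moreover have "(\<lambda>n. \<Sum>j\<in>A. G j (z n)) \<longlonglongrightarrow> energy A y"
      using X y(1) by (intro tendsto_sum G_tendsto)
    then have "\<forall>\<^sub>F n in sequentially. energy A y - \<delta> < energy A (z n)"
      using \<delta>(1) by (intro order_tendstoD(1)) auto
    ultimately have "\<forall>\<^sub>F n in sequentially. near \<epsilon> \<alpha>' P (z n) \<and> near \<epsilon> \<beta>' Q (z n) \<and> c n < e \<alpha> \<beta> + \<delta> \<and>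
        energy A y - \<delta> < energy A (z n)"
      by eventually_elim simp
    then obtain n where n: "near \<epsilon> \<alpha>' P (z n)" "near \<epsilon> \<beta>' Q (z n)" "c n < e \<alpha> \<beta> + \<delta>"
        "energy A y - \<delta> < energy A (z n)"
      using eventually_happens' sequentially_bot by blast
    obtain p0 q0 where pq0: "\<And>p. p \<le> p0 \<Longrightarrow> near \<epsilon> \<alpha> p (z n)" "\<And>q. q \<ge> q0 \<Longrightarrow> near \<epsilon> \<beta> q (z n)"
      using conn_near[OF z(1) eps(1)] by blast
    define p q where "p = min p0 (P - 2 * r - 1)" and "q = max q0 (Q + 2 * r + 1)"
    have "e \<alpha> \<alpha>' \<le> energy {p..<P} (z n) + \<delta>"
      using X \<alpha>\<beta> \<alpha>\<beta>' n(1) pq0(1) by (intro eps) (auto simp: p_def)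
    moreover have "e \<beta>' \<beta> \<le> energy {Q..<q} (z n) + \<delta>"
      using X \<alpha>\<beta> \<alpha>\<beta>' n(2) pq0(2) by (intro eps) (auto simp: q_def)
    moreover have "energy A (z n) \<le> energy {P..<Q} (z n)"
      using PQ X by (intro sum_G_mono) auto
    moreover have "energy {p..<q} (z n) = energy {p..<P} (z n) + energy {P..<Q} (z n) + energy {Q..<q} (z n)"
      using sum_int_concat[of p P Q "\<lambda>j. G j (z n)"] sum_int_concat[of p Q q "\<lambda>j. G j (z n)"] PQ(1) r1
      by (simp add: p_def q_def)
    moreover have "energy {p..<q} (z n) \<le> c n" using z(2) by (intro energy_leD) auto
    ultimately show ?thesis using n(3,4) \<delta>(2) by linarith
  qed
  then show "energy A y \<le> e \<alpha> \<beta> - e \<alpha> \<alpha>' - e \<beta>' \<beta>" by (rule field_le_epsilon)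
qed

text \<open>Otherwise nearly minimal transitions through \<open>t\<close>, recentred there, converge
  to some \<open>y\<close> with \<open>y 0 = t\<close>. If \<open>y\<close> has the same limits, it
  is a forbidden minimizer; if its two limits agree, the escaped energy leaves it calibrated, hence
  constant; if they are interchanged, \<open>y\<close> would contradict the positive cost of a
  loop.\<close>

lemma excess:
  assumes \<alpha>\<beta>: "\<alpha> \<in> {a, b}" "\<beta> \<in> {a, b}" "\<alpha> \<noteq> \<beta>" and t: "a < t" "t < b"
    and no_min: "\<And>x. x \<in> conn \<alpha> \<beta> \<Longrightarrow> energy_le x (e \<alpha> \<beta>) \<Longrightarrow> x 0 \<noteq> t"
  shows "\<exists>\<mu>>0. \<forall>x\<in>conn \<alpha> \<beta>. \<forall>i c. x i = t \<longrightarrow> energy_le x c \<longrightarrow> e \<alpha> \<beta> + \<mu> \<le> c"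
proof (rule ccontr)
  assume neg: "\<not> ?thesis"
  define R where "R n z \<longleftrightarrow> z \<in> conn \<alpha> \<beta> \<and> z 0 = t \<and> energy_le z (e \<alpha> \<beta> + 1 / real (Suc n))" for n z
  have "\<exists>z. R n z" for n
  proof -
    have "1 / real (Suc n) > 0" by simp
    then obtain x i c where x: "x \<in> conn \<alpha> \<beta>" "x i = t" "energy_le x c" "c < e \<alpha> \<beta> + 1 / real (Suc n)"
      using neg unfolding not_le[symmetric] by blast
    then have "R n (shift i x)"
      unfolding R_def by (auto intro: conn_shift energy_le_shift energy_le_mono)
    then show ?thesis by blast
  qed
  then obtain z where z: "\<And>n. R n (z n)" by metis
  then have zX: "z n \<in> X" for n by (simp add: R_def conn_def)
  obtain y \<sigma> where y: "y \<in> X" "strict_mono (\<sigma> :: nat \<Rightarrow> nat)" "\<And>i. (\<lambda>n. z (\<sigma> n) i) \<longlonglongrightarrow> y i"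
    using band_seq_compact[where x = z, OF zX] by blast
  define c where "c n = e \<alpha> \<beta> + 1 / real (Suc (\<sigma> n))" for n
  have "(\<lambda>n. e \<alpha> \<beta> + 1 / real (Suc n)) \<longlonglongrightarrow> e \<alpha> \<beta> + 0"
    using LIMSEQ_inverse_real_of_nat by (intro tendsto_intros) (simp add: inverse_eq_divide)
  from LIMSEQ_subseq_LIMSEQ[OF this y(2)] have c: "c \<longlonglongrightarrow> e \<alpha> \<beta>" by (simp add: c_def[abs_def] o_def)
  have zs: "z (\<sigma> n) \<in> conn \<alpha> \<beta>" "energy_le (z (\<sigma> n)) (c n)" "z (\<sigma> n) 0 = t" for n
    using z[of "\<sigma> n"] by (auto simp: R_def c_def)
  have "(\<lambda>n. z (\<sigma> n) 0) \<longlonglongrightarrow> t" using zs by simp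
  then have y0: "y 0 = t" using y(3)[of 0] by (auto intro: LIMSEQ_unique)
  have en: "energy_le y (e \<alpha> \<beta>)" using zs(2) c by (rule energy_le_limit[OF zX y(1) y(3)])
  obtain \<alpha>' where \<alpha>': "\<alpha>' \<in> {a, b}" "(y \<longlongrightarrow> \<alpha>') at_bot" using end_limits[OF y(1) en, of at_bot] by blast
  obtain \<beta>' where \<beta>': "\<beta>' \<in> {a, b}" "(y \<longlongrightarrow> \<beta>') at_top" using end_limits[OF y(1) en, of at_top] by blast
  have conn: "y \<in> conn \<alpha>' \<beta>'" using y(1) \<alpha>' \<beta>' by (simp add: conn_def)
  have split: "energy_le y (e \<alpha> \<beta> - e \<alpha> \<alpha>' - e \<beta>' \<beta>)"
    using limit_energy_split[OF \<alpha>\<beta>(1,2) zs(1,2) c y(3) conn \<alpha>'(1) \<beta>'(1)] .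
  have nonneg: "0 \<le> e s t" if "s \<in> {a, b}" "t \<in> {a, b}" for s t using that by (rule e_nonneg)
  have not_const: "y \<noteq> (\<lambda>_. s)" if "s \<in> {a, b}" for s using y0 t that by auto
  consider "\<alpha>' = \<alpha>" "\<beta>' = \<beta>" | "\<alpha>' = \<beta>'" | "\<alpha>' = \<beta>" "\<beta>' = \<alpha>"
    using \<alpha>\<beta> \<alpha>'(1) \<beta>'(1) by auto
  then show False
  proof cases
    case 1
    with conn en y0 no_min show False by blast
  next
    case 2
    then have "e \<alpha> \<beta> - e \<alpha> \<alpha>' - e \<beta>' \<beta> \<le> 0"
      using \<alpha>\<beta> \<alpha>'(1) nonneg[of \<alpha> \<alpha>] nonneg[of \<beta> \<beta>] by auto
    then have "energy_le y 0" by (rule energy_le_mono[OF split])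
    with calibrated_homoclinic conn 2 not_const[OF \<alpha>'(1)] show False by blast
  next
    case 3
    with split have "energy_le y (- e \<alpha> \<beta>)" by simp
    with conn 3 have "e \<beta> \<alpha> \<le> - e \<alpha> \<beta>" by (intro e_le) auto
    with loop_pos \<alpha>\<beta> show False by auto
  qed
qed

subsection \<open>Minimizers under pointwise constraints\<close>

text \<open>A triple \<open>(i, c, \<rho>)\<close> stands for the constraint \<open>\<bar>x i - c\<bar> \<le> \<rho>\<close>.\<close>

definition Ycon :: "(int \<times> real \<times> real) set \<Rightarrow> (int \<Rightarrow> real) set" where
  "Ycon K = {x \<in> conn a a. \<forall>(i, c, \<rho>)\<in>K. \<bar>x i - c\<bar> \<le> \<rho>}"

lemma YconD: "x \<in> Ycon K \<Longrightarrow> (i, c, \<rho>) \<in> K \<Longrightarrow> \<bar>x i - c\<bar> \<le> \<rho>"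
  by (auto simp: Ycon_def)

definition minimizer :: "(int \<times> real \<times> real) set \<Rightarrow> (int \<Rightarrow> real) \<Rightarrow> real \<Rightarrow> bool" where
  "minimizer K x c \<longleftrightarrow> x \<in> Ycon K \<and> energy_le x c \<and> (\<forall>y\<in>Ycon K. \<forall>c'. energy_le y c' \<longrightarrow> c \<le> c')"

text \<open>The outermost windows force blocks near \<open>a\<close>. If the limit of a minimizing
  sequence tended to \<open>b\<close> beyond one of them, late members would go from
  \<open>a\<close> to \<open>b\<close> and back there. Replacing the chain by \<open>a\<close>
  beyond the block saves energy and respects the constraints, since all those on that side are
  centred at \<open>a\<close>.\<close>

lemma minimizer_exists:
  assumes \<rho>: "\<rho> < b - a" "\<rho>' < b - a"
  shows "\<exists>l0. \<forall>l\<ge>l0. \<forall>K i0 i1.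
    (\<forall>i\<in>{i0..<i0+l}. (i, a, \<rho>) \<in> K) \<longrightarrow> (\<forall>i\<in>{i1..<i1+l}. (i, a, \<rho>') \<in> K) \<longrightarrow>
    (\<forall>(i, c, s)\<in>K. i < i0 + l \<or> i1 \<le> i \<longrightarrow> c = a \<and> 0 \<le> s) \<longrightarrow>
    (\<exists>x\<in>Ycon K. energy_le x C) \<longrightarrow> (\<exists>U c. minimizer K U c)"
proof -
  \<comment> \<open>A loop costs at least \<open>5 * \<delta>\<close> minus two tolerances; after
    paying \<open>\<delta>\<close> for the seam, cutting saves \<open>2 * \<delta>\<close>, more
    than the distance \<open>\<delta>\<close> of a late member from the infimum.\<close>
  define \<delta> where "\<delta> = (e a b + e b a) / 5"
  have \<delta>: "\<delta> > 0" "e a b + e b a = 5 * \<delta>" using loop_pos by (auto simp: \<delta>_def)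
  obtain \<epsilon>1 where tol: "tolerance \<delta> \<epsilon>1"
    using tolerance_exists[OF \<delta>(1)] by blast
  obtain \<epsilon>2 where e2: "\<epsilon>2 > 0"
    "\<And>x y \<alpha> p A. x \<in> X \<Longrightarrow> y \<in> X \<Longrightarrow> \<alpha> \<in> {a, b} \<Longrightarrow> near \<epsilon>2 \<alpha> p x \<Longrightarrow> near \<epsilon>2 \<alpha> p y \<Longrightarrow>
      energy A (glue p x y) \<le> (\<Sum>j\<in>A. if j < p then G j x else G j y) + \<delta>"
    using glue_energy_near[OF \<delta>(1)] by blast
  define \<epsilon> where "\<epsilon> = min \<epsilon>1 \<epsilon>2"
  have \<epsilon>: "\<epsilon> > 0" "\<epsilon> / 2 > 0" "near \<epsilon> s p x \<Longrightarrow> near \<epsilon>1 s p x" "near \<epsilon> s p x \<Longrightarrow> near \<epsilon>2 s p x" for s p x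
    using toleranceD(1)[OF tol] e2(1) by (auto simp: \<epsilon>_def elim: near_mono)
  have aab: "a \<in> {a, b}" "b \<in> {a, b}" by auto
  have aX: "(\<lambda>_. a) \<in> X" using ab by simp
  \<comment> \<open>The loop from \<open>s\<close> over \<open>p\<close> to \<open>q\<close> is
    removed together with everything to its left in the first version, and to its right in the
    second.\<close>
  have cut: "energy_le (glue q (\<lambda>_. a) x) (c - 2 * \<delta>)" "energy_le (glue s x (\<lambda>_. a)) (c - 2 * \<delta>)"
    if x: "x \<in> X" "energy_le x c" and near: "near \<epsilon> a s x" "near \<epsilon> b p x" "near \<epsilon> a q x"
      and spq: "s + 2 * r < p" "p + 2 * r < q" for x s p q c
  proof -
    have "e a b \<le> energy {s..<p} x + \<delta>" "e b a \<le> energy {p..<q} x + \<delta>"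
      using x near spq by (auto intro!: e_le_segment[OF tol] \<epsilon>)
    moreover have "energy {s..<q} x = energy {s..<p} x + energy {p..<q} x"
      using spq r1 by (intro sum_int_concat) auto
    ultimately have loop: "3 * \<delta> \<le> energy {s..<q} x" using \<delta>(2) by linarith
    have rest: "energy B x \<le> c - 3 * \<delta>" if "finite B" "B \<inter> {s..<q} = {}" for B
    proof -
      have "energy B x + energy {s..<q} x = energy (B \<union> {s..<q}) x"
        using that by (simp add: sum.union_disjoint)
      also have "\<dots> \<le> c" using that by (intro energy_leD x) auto
      finally show ?thesis using loop by linarith
    qed
    show "energy_le (glue q (\<lambda>_. a) x) (c - 2 * \<delta>)"
      unfolding energy_le_def
    proof (intro allI impI)
      fix A :: "int set" assume A: "finite A"
      have "energy A (glue q (\<lambda>_. a) x) \<le> (\<Sum>j\<in>A. if j < q then G j (\<lambda>_. a) else G j x) + \<delta>"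
        by (rule e2(2)[OF aX x(1) aab(1) near_const[OF e2(1)] \<epsilon>(4)[OF near(3)]])
      also have "(\<Sum>j\<in>A. if j < q then G j (\<lambda>_. a) else G j x) = energy (A \<inter> {q..}) x"
        using A by (intro sum.mono_neutral_cong_right) auto
      also have "\<dots> \<le> c - 3 * \<delta>" using A by (intro rest) auto
      finally show "energy A (glue q (\<lambda>_. a) x) \<le> c - 2 * \<delta>" by simp
    qed
    show "energy_le (glue s x (\<lambda>_. a)) (c - 2 * \<delta>)"
      unfolding energy_le_def
    proof (intro allI impI)
      fix A :: "int set" assume A: "finite A"
      have "energy A (glue s x (\<lambda>_. a)) \<le> (\<Sum>j\<in>A. if j < s then G j x else G j (\<lambda>_. a)) + \<delta>"
        by (rule e2(2)[OF x(1) aX aab(1) \<epsilon>(4)[OF near(1)] near_const[OF e2(1)]])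
      also have "(\<Sum>j\<in>A. if j < s then G j x else G j (\<lambda>_. a)) = energy (A \<inter> {..<s}) x"
        using A by (intro sum.mono_neutral_cong_right) auto
      also have "\<dots> \<le> c - 3 * \<delta>" using A by (intro rest) auto
      finally show "energy A (glue s x (\<lambda>_. a)) \<le> c - 2 * \<delta>" by simp
    qed
  qed
  obtain l1 where l1: "\<And>l. l \<ge> l1 \<Longrightarrow> forces_near C l a \<rho> (\<epsilon> / 2)"
    using window_near[OF aab(1) \<rho>(1) \<epsilon>(2)] by blast
  obtain l2 where l2: "\<And>l. l \<ge> l2 \<Longrightarrow> forces_near C l a \<rho>' (\<epsilon> / 2)"
    using window_near[OF aab(1) \<rho>(2) \<epsilon>(2)] by blast
  have "\<exists>U c. minimizer K U c"
    if l: "l \<ge> max l1 l2" and K0: "\<forall>i\<in>{i0..<i0+l}. (i, a, \<rho>) \<in> K" and K1: "\<forall>i\<in>{i1..<i1+l}. (i, a, \<rho>') \<in> K"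
      and K: "\<forall>(i, c, s)\<in>K. i < i0 + l \<or> i1 \<le> i \<longrightarrow> c = a \<and> 0 \<le> s"
      and ex: "\<exists>x\<in>Ycon K. energy_le x C" for l K i0 i1
  proof -
    define S where "S = {c. \<exists>u\<in>Ycon K. energy_le u c}"
    have bdd: "bdd_below S" unfolding S_def by (intro bdd_belowI[of _ 0]) (auto dest: energy_le_nonneg)
    have S_ne: "C \<in> S" using ex by (auto simp: S_def)
    define m where "m = Inf S"
    have m_le: "m \<le> c" if "u \<in> Ycon K" "energy_le u c" for u c
      unfolding m_def using that bdd by (intro cInf_lower) (auto simp: S_def)
    define R where "R n u \<longleftrightarrow> u \<in> Ycon K \<and> energy_le u (m + 1 / real (Suc n))" for n u
    have "\<exists>u. R n u" for n
    proof -
      have "m < m + 1 / real (Suc n)" by simp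
      then have "\<exists>c\<in>S. c < m + 1 / real (Suc n)"
        using S_ne bdd unfolding m_def by (subst (asm) cInf_less_iff) auto
      then obtain c u where "c < m + 1 / real (Suc n)" "u \<in> Ycon K" "energy_le u c" by (auto simp: S_def)
      then have "R n u" unfolding R_def using energy_le_mono[of u c "m + 1 / real (Suc n)"] by auto
      then show ?thesis by blast
    qed
    then obtain u0 where u0: "\<And>n. R n (u0 n)" by metis
    then have u0X: "u0 n \<in> X" for n by (simp add: R_def Ycon_def conn_def)
    obtain U \<sigma> where U: "U \<in> X" "strict_mono (\<sigma> :: nat \<Rightarrow> nat)" "\<And>i. (\<lambda>n. u0 (\<sigma> n) i) \<longlonglongrightarrow> U i"
      using band_seq_compact[where x = u0, OF u0X] by blast
    define u where "u n = u0 (\<sigma> n)" for n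
    define c where "c n = m + 1 / real (Suc (\<sigma> n))" for n
    have u: "u n \<in> Ycon K" "energy_le (u n) (c n)" for n
      using u0[of "\<sigma> n"] by (auto simp: R_def u_def c_def)
    have uX: "u n \<in> X" for n using u0X by (simp add: u_def)
    have Ulim: "(\<lambda>n. u n i) \<longlonglongrightarrow> U i" for i using U(3) by (simp add: u_def)
    have "(\<lambda>n. m + 1 / real (Suc n)) \<longlonglongrightarrow> m + 0"
      using LIMSEQ_inverse_real_of_nat by (intro tendsto_intros) (simp add: inverse_eq_divide)
    from LIMSEQ_subseq_LIMSEQ[OF this U(2)] have c: "c \<longlonglongrightarrow> m" by (simp add: c_def[abs_def] o_def)
    have enU: "energy_le U m" using u(2) c by (rule energy_le_limit[OF uX U(1) Ulim])
    have "m \<le> C" using S_ne bdd by (auto simp: m_def intro: cInf_lower)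
    then have enC: "energy_le U C" by (rule energy_le_mono[OF enU])
    have UK: "\<bar>U i - s\<bar> \<le> \<theta>" if "(i, s, \<theta>) \<in> K" for i s \<theta>
    proof (rule tendsto_upperbound)
      show "(\<lambda>n. \<bar>u n i - s\<bar>) \<longlonglongrightarrow> \<bar>U i - s\<bar>" by (intro tendsto_intros Ulim)
      show "\<forall>\<^sub>F n in sequentially. \<bar>u n i - s\<bar> \<le> \<theta>"
        using YconD[OF u(1) that] by simp
    qed simp
    have ev: "\<forall>\<^sub>F n in sequentially. near \<epsilon> s p (u n)" if "near (\<epsilon> / 2) s p U" for s p
      using Ulim that \<epsilon>(1) by (intro near_limit[where y = U and \<epsilon> = "\<epsilon> / 2"]) auto
    have ev_c: "\<forall>\<^sub>F n in sequentially. c n < m + \<delta>" using order_tendstoD(2)[OF c] \<delta>(1) by simp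
    obtain wl where wl: "wl < i0 + l" "near (\<epsilon> / 2) a wl U"
      using l1[unfolded forces_near_def, rule_format, OF _ U(1) enC, of l i0] l K0 UK by auto
    obtain wr where wr: "i1 \<le> wr" "near (\<epsilon> / 2) a wr U"
      using l2[unfolded forces_near_def, rule_format, OF _ U(1) enC, of l i1] l K1 UK by auto
    have "(U \<longlongrightarrow> a) F" if F: "F = at_bot \<and> w = wl \<or> F = at_top \<and> w = wr" for F w
    proof (rule ccontr)
      assume "\<not> (U \<longlongrightarrow> a) F"
      then have Ub: "(U \<longlongrightarrow> b) F" using end_limits[OF U(1) enC, of F] F by auto
      define beyond where "beyond p q \<longleftrightarrow> (if F = at_bot then q + 2 * r < p else p + 2 * r < q)" for p q
      have bt: "at_bot \<noteq> (at_top :: int filter)"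
      proof
        assume "at_bot = (at_top :: int filter)"
        then have "\<forall>\<^sub>F i::int in at_top. i \<le> 0" using eventually_le_at_bot[of "0::int"] by simp
        with eventually_gt_at_top[of "0::int"] have "\<forall>\<^sub>F i::int in at_top. False"
          by eventually_elim simp
        then show False by simp
      qed
      have ex: "\<exists>q. P q \<and> beyond p q" if "\<forall>\<^sub>F q in F. P q" for P p
      proof -
        have "\<forall>\<^sub>F q in F. beyond p q"
          using F eventually_le_at_bot[of "p - 2 * r - 1"] eventually_gt_at_top[of "p + 2 * r"] bt
          by (auto simp: beyond_def elim!: eventually_mono)
        with that have "\<forall>\<^sub>F q in F. P q \<and> beyond p q" by (rule eventually_conj)
        then show ?thesis using F by (intro eventually_happens'[OF ends_nontrivial]) auto
      qed
      obtain p where p: "near (\<epsilon> / 2) b p U" "beyond w p"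
        using ex[OF near_end[OF _ Ub \<epsilon>(2)]] F by blast
      have "near (\<epsilon> / 2) a w U" using F wl wr by auto
      from ev[OF this] ev[OF p(1)] ev_c
      have "\<forall>\<^sub>F n in sequentially. near \<epsilon> a w (u n) \<and> near \<epsilon> b p (u n) \<and> c n < m + \<delta>"
        by eventually_elim simp
      then obtain n where n: "near \<epsilon> a w (u n)" "near \<epsilon> b p (u n)" "c n < m + \<delta>"
        using eventually_happens' sequentially_bot by blast
      have un: "u n \<in> conn a a" using u(1) by (simp add: Ycon_def)
      then have "(u n \<longlongrightarrow> a) F" using F by (auto simp: conn_def)
      then obtain s where s: "near \<epsilon> a s (u n)" "beyond p s"
        using ex[OF near_end[OF _ _ \<epsilon>(1)]] F by blast
      define z where "z = (if F = at_bot then glue w (\<lambda>_. a) (u n) else glue w (u n) (\<lambda>_. a))"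
      have "energy_le z (c n - 2 * \<delta>)"
        using cut(1)[OF uX u(2) s(1) n(2,1)] cut(2)[OF uX u(2) n(1,2) s(1)] s(2) p(2) F bt
        by (auto simp: z_def beyond_def)
      moreover have "z \<in> conn a a"
        using un aX by (auto simp: z_def conn_def glue_tendsto intro: glue_band)
      \<comment> \<open>Only sites left of \<open>wl\<close> or from \<open>wr\<close> on are
        changed, and every constraint there has centre \<open>a\<close> and nonnegative
        radius.\<close>
      moreover have "\<bar>z i - t\<bar> \<le> \<theta>" if "(i, t, \<theta>) \<in> K" for i t \<theta>
        using that K YconD[OF u(1)[of n] that] wl(1) wr(1) F bt by (fastforce simp: z_def glue_def)
      ultimately have "m \<le> c n - 2 * \<delta>" by (intro m_le[of z]) (auto simp: Ycon_def)
      with n(3) \<delta>(1) show False by simp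
    qed
    then have "(U \<longlongrightarrow> a) at_bot" "(U \<longlongrightarrow> a) at_top" by blast+
    then have "U \<in> Ycon K" using U(1) UK by (auto simp: Ycon_def conn_def)
    then have "minimizer K U m" using enU m_le by (auto simp: minimizer_def)
    then show ?thesis by blast
  qed
  then show ?thesis by blast
qed

text \<open>Finitely many strict constraints leave a common margin, so a small energy-decreasing
  move would stay admissible.\<close>

lemma interior_minimizer_EL:
  assumes K: "finite K" and U: "minimizer K U c" and strict: "\<And>i s \<theta>. (i, s, \<theta>) \<in> K \<Longrightarrow> \<bar>U i - s\<bar> < \<theta>"
  shows "E i U = 0"
proof -
  have UY: "U \<in> Ycon K" and en: "energy_le U c" using U by (auto simp: minimizer_def)
  have X: "U \<in> X" using UY by (simp add: Ycon_def conn_def)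
  have *: "\<not> (U i < b \<and> E i U < 0 \<or> a < U i \<and> 0 < E i U)" for i
  proof
    assume bad: "U i < b \<and> E i U < 0 \<or> a < U i \<and> 0 < E i U"
    \<comment> \<open>The element 1 keeps the minimum meaningful when there are no
      constraints.\<close>
    define \<epsilon> where "\<epsilon> = Min (insert 1 ((\<lambda>(j, s, \<theta>). \<theta> - \<bar>U j - s\<bar>) ` K))"
    have "\<epsilon> > 0" unfolding \<epsilon>_def using K strict by (subst Min_gr_iff) auto
    have \<epsilon>_le: "\<epsilon> \<le> \<theta> - \<bar>U j - s\<bar>" if "(j, s, \<theta>) \<in> K" for j s \<theta>
      unfolding \<epsilon>_def using K that by (intro Min_le) force+
    obtain t c' where t: "\<bar>t - U i\<bar> < \<epsilon>" "U(i := t) \<in> X" "c' < c" "energy_le (U(i := t)) c'"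
      using decrease_energy[OF X en \<open>\<epsilon> > 0\<close> bad] by blast
    have "\<bar>(U(i := t)) j - s\<bar> \<le> \<theta>" if "(j, s, \<theta>) \<in> K" for j s \<theta>
    proof (cases "j = i")
      case True
      with \<epsilon>_le[OF that] t(1) show ?thesis by auto
    next
      case False
      with strict[OF that] show ?thesis by simp
    qed
    moreover have "U(i := t) \<in> conn a a" using UY t(2) by (intro conn_upd) (auto simp: Ycon_def)
    ultimately have "U(i := t) \<in> Ycon K" by (auto simp: Ycon_def)
    with U t(3,4) show False by (fastforce simp: minimizer_def)
  qed
  have "0 \<le> E i U" if "U i < b" for i using *[of i] that by auto
  moreover have "E i U \<le> 0" if "a < U i" for i using *[of i] that by auto
  ultimately show ?thesis using one_sided_EL[OF X] by blast
qed

end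

subsection \<open>Minimizers with many transitions\<close>

definition admissible :: "nat \<Rightarrow> (nat \<Rightarrow> int) \<Rightarrow> int \<Rightarrow> bool" where
  "admissible k m l \<longleftrightarrow> (\<forall>i. 1 \<le> i \<and> i < 4 * k \<longrightarrow> m i < m (i + 1)) \<and>
    (\<forall>j. 1 \<le> j \<and> j < 4 * k \<and> even j \<longrightarrow> m j + 2 * l < m (j + 1))"

lemma admissible_block:
  assumes "admissible k m l" "j < k"
  shows "m (1 + 4 * j) < m (2 + 4 * j)" "m (2 + 4 * j) + 2 * l < m (3 + 4 * j)" "m (3 + 4 * j) < m (4 + 4 * j)"
proof -
  have less: "m i < m (i + 1)" if "1 \<le> i" "i < 4 * k" for i
    using assms(1) that by (simp add: admissible_def)
  have gap: "m i + 2 * l < m (i + 1)" if "1 \<le> i" "i < 4 * k" "even i" for i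
    using assms(1) that by (simp add: admissible_def)
  show "m (1 + 4 * j) < m (2 + 4 * j)"
    using less[of "1 + 4 * j"] assms(2) by (simp add: numeral_eq_Suc)
  show "m (2 + 4 * j) + 2 * l < m (3 + 4 * j)"
    using gap[of "2 + 4 * j"] assms(2) by (simp add: numeral_3_eq_3)
  show "m (3 + 4 * j) < m (4 + 4 * j)"
    using less[of "3 + 4 * j"] assms(2) by (simp add: numeral_eq_Suc)
qed

lemma admissible_order:
  assumes "admissible k m l" "l \<ge> 0" "j < j'" "j' < k"
  shows "m (4 + 4 * j) + 2 * l < m (1 + 4 * j')"
  using assms(3,4)
proof (induction j')
  case (Suc j')
  have gap: "m (4 + 4 * j') + 2 * l < m (1 + 4 * Suc j')"
  proof -
    have "m (4 + 4 * j') + 2 * l < m (4 + 4 * j' + 1)"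
      using assms(1)[unfolded admissible_def, THEN conjunct2, rule_format, of "4 + 4 * j'"] Suc.prems(2)
      by simp
    moreover have "4 + 4 * j' + 1 = 1 + 4 * Suc j'" by simp
    ultimately show ?thesis by (simp only:)
  qed
  show ?case
  proof (cases "j = j'")
    case True
    with gap show ?thesis by simp
  next
    case False
    with Suc have "m (4 + 4 * j) + 2 * l < m (1 + 4 * j')" by simp
    moreover have "m (1 + 4 * j') < m (4 + 4 * j')"
      using admissible_block[OF assms(1), of j'] Suc.prems assms(2) by linarith
    ultimately show ?thesis using gap assms(2) by linarith
  qed
qed simp

context chain
begin

definition windows :: "real \<Rightarrow> real \<Rightarrow> real \<Rightarrow> real \<Rightarrow> nat \<Rightarrow> (nat \<Rightarrow> int) \<Rightarrow> int \<Rightarrow> (int \<times> real \<times> real) set" where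
  "windows \<rho>1 \<rho>2 \<rho>3 \<rho>4 k m l = (\<Union>j<k.
    {m (1 + 4 * j) - l..m (1 + 4 * j) - 1} \<times> {(a, \<rho>1)} \<union>
    {m (2 + 4 * j)..m (2 + 4 * j) + l - 1} \<times> {(b, \<rho>2)} \<union>
    {m (3 + 4 * j) - l..m (3 + 4 * j) - 1} \<times> {(b, \<rho>3)} \<union>
    {m (4 + 4 * j)..m (4 + 4 * j) + l - 1} \<times> {(a, \<rho>4)})"

lemma windows_finite: "finite (windows \<rho>1 \<rho>2 \<rho>3 \<rho>4 k m l)"
  unfolding windows_def by (intro finite_UN_I finite_UnI finite_cartesian_product) auto

lemma windows_cases:
  assumes "(i, s, \<theta>) \<in> windows \<rho>1 \<rho>2 \<rho>3 \<rho>4 k m l"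
  obtains
    (1) j where "j < k" "m (1 + 4 * j) - l \<le> i" "i < m (1 + 4 * j)" "s = a" "\<theta> = \<rho>1"
  | (2) j where "j < k" "m (2 + 4 * j) \<le> i" "i < m (2 + 4 * j) + l" "s = b" "\<theta> = \<rho>2"
  | (3) j where "j < k" "m (3 + 4 * j) - l \<le> i" "i < m (3 + 4 * j)" "s = b" "\<theta> = \<rho>3"
  | (4) j where "j < k" "m (4 + 4 * j) \<le> i" "i < m (4 + 4 * j) + l" "s = a" "\<theta> = \<rho>4"
  using assms unfolding windows_def by (auto simp: algebra_simps)

lemma windowsI:
  assumes "j < k"
  shows "m (1 + 4 * j) - l \<le> i \<Longrightarrow> i < m (1 + 4 * j) \<Longrightarrow> (i, a, \<rho>1) \<in> windows \<rho>1 \<rho>2 \<rho>3 \<rho>4 k m l"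
    and "m (2 + 4 * j) \<le> i \<Longrightarrow> i < m (2 + 4 * j) + l \<Longrightarrow> (i, b, \<rho>2) \<in> windows \<rho>1 \<rho>2 \<rho>3 \<rho>4 k m l"
    and "m (3 + 4 * j) - l \<le> i \<Longrightarrow> i < m (3 + 4 * j) \<Longrightarrow> (i, b, \<rho>3) \<in> windows \<rho>1 \<rho>2 \<rho>3 \<rho>4 k m l"
    and "m (4 + 4 * j) \<le> i \<Longrightarrow> i < m (4 + 4 * j) + l \<Longrightarrow> (i, a, \<rho>4) \<in> windows \<rho>1 \<rho>2 \<rho>3 \<rho>4 k m l"
  unfolding windows_def using assms by (intro UN_I[of j]; force)+

text \<open>Induction over the number of loops. That the partial chain is already constant
  \<open>a\<close> from \<open>m (4 * n)\<close> on lets the next loop be attached without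
  loss.\<close>

lemma multi_transition_partial:
  assumes adm: "admissible k m l" and l: "l \<ge> r"
    and x: "x \<in> X" "\<And>i. i < 0 \<Longrightarrow> x i = a" "\<And>i. i \<ge> w \<Longrightarrow> x i = b" "energy_le x c"
    and y: "y \<in> X" "\<And>i. i < 0 \<Longrightarrow> y i = b" "\<And>i. i \<ge> w \<Longrightarrow> y i = a" "energy_le y c'"
    and w: "\<And>j. j < k \<Longrightarrow> m (1 + 4 * j) + w \<le> m (2 + 4 * j)" "\<And>j. j < k \<Longrightarrow> m (3 + 4 * j) + w \<le> m (4 + 4 * j)"
    and "n \<le> k"
  shows "\<exists>u\<in>X. (\<exists>p. \<forall>i<p. u i = a) \<and> (\<forall>i. n = 0 \<or> m (4 * n) \<le> i \<longrightarrow> u i = a) \<and>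
    energy_le u (real n * (c + c')) \<and>
    (\<forall>j<n. \<forall>i. (m (1 + 4 * j) - l \<le> i \<and> i < m (1 + 4 * j) \<longrightarrow> u i = a) \<and>
      (m (2 + 4 * j) \<le> i \<and> i < m (2 + 4 * j) + l \<longrightarrow> u i = b) \<and>
      (m (3 + 4 * j) - l \<le> i \<and> i < m (3 + 4 * j) \<longrightarrow> u i = b) \<and>
      (m (4 + 4 * j) \<le> i \<and> i < m (4 + 4 * j) + l \<longrightarrow> u i = a))"
  using \<open>n \<le> k\<close>
proof (induction n)
  case 0
  have "energy_le (\<lambda>_. a) 0" by (simp add: energy_le_def)
  with ab show ?case by (intro bexI[of _ "\<lambda>_. a"]) auto
next
  case (Suc n)
  then obtain u p where u: "u \<in> X" "\<And>i. i < p \<Longrightarrow> u i = a" "\<And>i. n = 0 \<or> m (4 * n) \<le> i \<Longrightarrow> u i = a"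
      "energy_le u (real n * (c + c'))"
    and uw: "\<And>j i. j < n \<Longrightarrow> m (1 + 4 * j) - l \<le> i \<Longrightarrow> i < m (1 + 4 * j) \<Longrightarrow> u i = a"
      "\<And>j i. j < n \<Longrightarrow> m (2 + 4 * j) \<le> i \<Longrightarrow> i < m (2 + 4 * j) + l \<Longrightarrow> u i = b"
      "\<And>j i. j < n \<Longrightarrow> m (3 + 4 * j) - l \<le> i \<Longrightarrow> i < m (3 + 4 * j) \<Longrightarrow> u i = b"
      "\<And>j i. j < n \<Longrightarrow> m (4 + 4 * j) \<le> i \<Longrightarrow> i < m (4 + 4 * j) + l \<Longrightarrow> u i = a"
    using Suc_leD[OF Suc.prems] by blast
  have n: "n < k" using Suc.prems by simp
  note bl = admissible_block[OF adm n]
  define m1 m2 m3 m4 where "m1 = m (1 + 4 * n)" and "m2 = m (2 + 4 * n)" and "m3 = m (3 + 4 * n)" and "m4 = m (4 + 4 * n)"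
  have M: "m1 < m2" "m2 + 2 * l < m3" "m3 < m4" "m1 + w \<le> m2" "m3 + w \<le> m4"
    using bl w[OF n] by (auto simp: m1_def m2_def m3_def m4_def)
  have l0: "l \<ge> 0" "l \<ge> 1" using l r1 by auto
  have prev: "m (4 + 4 * j) + 2 * l < m1" if "j < n" for j
    using admissible_order[OF adm l0(1) that n] by (simp add: m1_def)
  have prev4: "m (4 * n) + 2 * l < m1" if n0: "n \<noteq> 0"
  proof -
    obtain j where "n = Suc j" using n0 by (cases n) auto
    with prev[of j] show ?thesis by simp
  qed
  define x' y' where "x' = shift (- m1) x" and "y' = shift (- m3) y"
  have x': "x' \<in> X" "energy_le x' c" "\<And>i. i < m1 \<Longrightarrow> x' i = a" "\<And>i. m2 \<le> i \<Longrightarrow> x' i = b"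
    using x M by (auto simp: x'_def intro: energy_le_shift)
  have y': "y' \<in> X" "energy_le y' c'" "\<And>i. i < m3 \<Longrightarrow> y' i = b" "\<And>i. m4 \<le> i \<Longrightarrow> y' i = a"
    using y M by (auto simp: y'_def intro: energy_le_shift)
  \<comment> \<open>Since \<open>r \<le> l\<close> and \<open>m2 + 2 * l < m3\<close>, both
    transitions equal \<open>b\<close> on all \<open>2 * r\<close> sites around this seam.\<close>
  define v where "v = glue (m2 + l) x' y'"
  have v: "v \<in> X" "energy_le v (c + c')"
    unfolding v_def using x' y' M l by (auto intro!: glue_band glue_exact)
  have vi: "\<And>i. i < m1 \<Longrightarrow> v i = a" "\<And>i. m2 \<le> i \<Longrightarrow> i < m3 \<Longrightarrow> v i = b" "\<And>i. m4 \<le> i \<Longrightarrow> v i = a"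
    using x' y' M l0 by (auto simp: v_def glue_def)
  \<comment> \<open>The gap of more than \<open>2 * l\<close> sites before \<open>m1\<close> makes
    both pieces equal to \<open>a\<close> around this seam.\<close>
  define u' where "u' = glue (m1 - l) u v"
  have "energy_le u' (real n * (c + c') + (c + c'))"
    unfolding u'_def
  proof (rule glue_exact[OF u(1) v(1) _ u(4) v(2)])
    fix i assume i: "m1 - l - r \<le> i" "i < m1 - l + r"
    have "n = 0 \<or> m (4 * n) \<le> i" using i prev4 l by linarith
    then show "u i = v i" using i l u(3) vi(1) by auto
  qed
  then have "energy_le u' (real (Suc n) * (c + c'))" by (simp add: algebra_simps)
  moreover have "u' \<in> X" unfolding u'_def using u(1) v(1) by (rule glue_band)
  moreover have "\<exists>p. \<forall>i<p. u' i = a"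
    using u(2) by (intro exI[of _ "min p (m1 - l)"]) (auto simp: u'_def glue_def)
  moreover have "u' i = a" if "m (4 * Suc n) \<le> i" for i
  proof -
    have "m4 \<le> i" using that by (simp add: m4_def)
    with vi(3)[of i] M l0 show ?thesis by (auto simp: u'_def glue_def)
  qed
  moreover have "(m (1 + 4 * j) - l \<le> i \<and> i < m (1 + 4 * j) \<longrightarrow> u' i = a) \<and>
      (m (2 + 4 * j) \<le> i \<and> i < m (2 + 4 * j) + l \<longrightarrow> u' i = b) \<and>
      (m (3 + 4 * j) - l \<le> i \<and> i < m (3 + 4 * j) \<longrightarrow> u' i = b) \<and>
      (m (4 + 4 * j) \<le> i \<and> i < m (4 + 4 * j) + l \<longrightarrow> u' i = a)" if "j < Suc n" for j i
  proof (cases "j = n")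
    case True
    have "(m1 - l \<le> i \<and> i < m1 \<longrightarrow> u' i = a) \<and> (m2 \<le> i \<and> i < m2 + l \<longrightarrow> u' i = b) \<and>
      (m3 - l \<le> i \<and> i < m3 \<longrightarrow> u' i = b) \<and> (m4 \<le> i \<and> i < m4 + l \<longrightarrow> u' i = a)"
      using vi M l0 by (auto simp: u'_def glue_def)
    then show ?thesis unfolding True m1_def m2_def m3_def m4_def .
  next
    case False
    with that have j: "j < n" by simp
    then have jk: "j < k" using n by simp
    have "u' i = u i" if "i < m (4 + 4 * j) + l" for i
      using that prev[OF j] l0 by (auto simp: u'_def glue_def)
    then show ?thesis
      using admissible_block[OF adm jk] uw[OF j, of i] l0 by auto
  qed
  ultimately show ?case by blast
qed

end

context chain_min
begin

lemma multi_transition: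
  assumes adm: "admissible k m l" and l: "l \<ge> r" and k: "k \<ge> 1"
    and x: "x \<in> X" "\<And>i. i < 0 \<Longrightarrow> x i = a" "\<And>i. i \<ge> w \<Longrightarrow> x i = b" "energy_le x c"
    and y: "y \<in> X" "\<And>i. i < 0 \<Longrightarrow> y i = b" "\<And>i. i \<ge> w \<Longrightarrow> y i = a" "energy_le y c'"
    and w: "\<And>j. j < k \<Longrightarrow> m (1 + 4 * j) + w \<le> m (2 + 4 * j)" "\<And>j. j < k \<Longrightarrow> m (3 + 4 * j) + w \<le> m (4 + 4 * j)"
    and \<rho>: "\<rho>1 \<ge> 0" "\<rho>2 \<ge> 0" "\<rho>3 \<ge> 0" "\<rho>4 \<ge> 0"
  shows "\<exists>u\<in>Ycon (windows \<rho>1 \<rho>2 \<rho>3 \<rho>4 k m l). energy_le u (real k * (c + c'))"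
proof -
  obtain u p where u: "u \<in> X" "\<And>i. i < p \<Longrightarrow> u i = a" "\<And>i. k = 0 \<or> m (4 * k) \<le> i \<Longrightarrow> u i = a"
      "energy_le u (real k * (c + c'))"
    and uw: "\<And>j i. j < k \<Longrightarrow> m (1 + 4 * j) - l \<le> i \<Longrightarrow> i < m (1 + 4 * j) \<Longrightarrow> u i = a"
      "\<And>j i. j < k \<Longrightarrow> m (2 + 4 * j) \<le> i \<Longrightarrow> i < m (2 + 4 * j) + l \<Longrightarrow> u i = b"
      "\<And>j i. j < k \<Longrightarrow> m (3 + 4 * j) - l \<le> i \<Longrightarrow> i < m (3 + 4 * j) \<Longrightarrow> u i = b"
      "\<And>j i. j < k \<Longrightarrow> m (4 + 4 * j) \<le> i \<Longrightarrow> i < m (4 + 4 * j) + l \<Longrightarrow> u i = a"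
    using multi_transition_partial[OF adm l x y w order_refl] by blast
  have "\<forall>\<^sub>F i in at_bot. u i = a" using u(2) by (intro eventually_at_bot_linorderI[of "p - 1"]) auto
  moreover have "\<forall>\<^sub>F i in at_top. u i = a" using u(3) by (intro eventually_at_top_linorderI[of "m (4 * k)"]) auto
  ultimately have "u \<in> conn a a" using u(1) by (simp add: conn_def tendsto_eventually)
  moreover have "\<bar>u i - s\<bar> \<le> \<theta>" if "(i, s, \<theta>) \<in> windows \<rho>1 \<rho>2 \<rho>3 \<rho>4 k m l" for i s \<theta>
    using that by (cases rule: windows_cases) (simp_all add: uw \<rho>)
  ultimately have "u \<in> Ycon (windows \<rho>1 \<rho>2 \<rho>3 \<rho>4 k m l)" by (auto simp: Ycon_def)
  with u(4) show ?thesis by blast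
qed

text \<open>The sites \<open>P 0 < Q 0 < P 1 < \<dots> < P k\<close> split the chain into \<open>2 k\<close> transitions. One of them
  passes through a value that costs at least \<open>\<mu>\<close> more than a minimal transition.\<close>

lemma pivot_excess:
  assumes tol: "tolerance \<delta> \<epsilon>" and x: "x \<in> X" "energy_le x c"
    and P: "\<And>j. j \<le> k \<Longrightarrow> near \<epsilon> a (P j) x" and Q: "\<And>j. j < k \<Longrightarrow> near \<epsilon> b (Q j) x"
    and gap: "\<And>j. j < k \<Longrightarrow> P j + 2 * r < Q j" "\<And>j. j < k \<Longrightarrow> Q j + 2 * r < P (Suc j)"
    and n: "n < k"
    and ex: "P n \<le> i \<and> i < Q n \<and> (\<forall>z\<in>conn a b. \<forall>i' c'. z i' = x i \<longrightarrow> energy_le z c' \<longrightarrow> e a b + \<mu> \<le> c') \<or>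
      Q n \<le> i \<and> i < P (Suc n) \<and> (\<forall>z\<in>conn b a. \<forall>i' c'. z i' = x i \<longrightarrow> energy_le z c' \<longrightarrow> e b a + \<mu> \<le> c')"
  shows "real k * (e a b + e b a) + \<mu> \<le> c + real (2 * k) * \<delta>"
proof -
  \<comment> \<open>Completing the segment by ground states keeps its value at site
    \<open>i\<close>, so the completed chain passes through the expensive value.\<close>
  have seg: "e \<alpha> \<beta> + \<mu> \<le> energy {p..<q} x + \<delta>"
    if "\<alpha> \<in> {a, b}" "\<beta> \<in> {a, b}" "p + 2 * r < q" "near \<epsilon> \<alpha> p x" "near \<epsilon> \<beta> q x" "p \<le> i" "i < q"
      "\<forall>z\<in>conn \<alpha> \<beta>. \<forall>i' c'. z i' = x i \<longrightarrow> energy_le z c' \<longrightarrow> e \<alpha> \<beta> + \<mu> \<le> c'" for \<alpha> \<beta> p q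
    using that(8) clamp_conn[OF x(1) that(1,2)] clamp_apply[OF that(6,7)] toleranceD(2)[OF tol x(1) that(1-5)]
    by blast
  have step: "e a b + e b a + (if j = n then \<mu> else 0) \<le> energy {P j..<P (Suc j)} x + 2 * \<delta>" if j: "j < k" for j
  proof -
    have near: "near \<epsilon> a (P j) x" "near \<epsilon> b (Q j) x" "near \<epsilon> a (P (Suc j)) x" using P Q j by auto
    have "energy {P j..<P (Suc j)} x = energy {P j..<Q j} x + energy {Q j..<P (Suc j)} x"
      using gap[OF j] r1 by (intro sum_int_concat) auto
    moreover have "e a b \<le> energy {P j..<Q j} x + \<delta>" "e b a \<le> energy {Q j..<P (Suc j)} x + \<delta>"
      using gap[OF j] near by (auto intro!: e_le_segment[OF tol x(1)])
    moreover have "e a b + \<mu> \<le> energy {P j..<Q j} x + \<delta> \<or> e b a + \<mu> \<le> energy {Q j..<P (Suc j)} x + \<delta>" if "j = n"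
      using ex that gap[OF j] near seg[of a b "P j" "Q j"] seg[of b a "Q j" "P (Suc j)"] by blast
    ultimately show ?thesis by auto
  qed
  have "real k * (e a b + e b a) + \<mu> = (\<Sum>j<k. e a b + e b a + (if j = n then \<mu> else 0))"
    using n by (simp add: sum.distrib)
  also have "\<dots> \<le> (\<Sum>j<k. energy {P j..<P (Suc j)} x + 2 * \<delta>)"
    using step by (intro sum_mono) auto
  also have "\<dots> = (\<Sum>j<k. energy {P j..<P (Suc j)} x) + real (2 * k) * \<delta>" by (simp add: sum.distrib)
  finally have le: "real k * (e a b + e b a) + \<mu> \<le> (\<Sum>j<k. energy {P j..<P (Suc j)} x) + real (2 * k) * \<delta>" .
  have "P 0 \<le> P j \<and> (\<Sum>j<j. energy {P j..<P (Suc j)} x) = energy {P 0..<P j} x" if "j \<le> k" for j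
    using that
  proof (induction j)
    case (Suc j)
    then have "P 0 \<le> P j" "P j \<le> P (Suc j)" using gap[of j] r1 by auto
    then show ?case using Suc sum_int_concat[of "P 0" "P j" "P (Suc j)" "\<lambda>j. G j x"] by simp
  qed simp
  then have "(\<Sum>j<k. energy {P j..<P (Suc j)} x) \<le> c" using x(2) by (auto intro: energy_leD)
  with le show ?thesis by simp
qed

theorem multi_transition_minimizers:
  assumes k: "k \<ge> 1"
    and \<rho>: "0 < \<rho>1" "\<rho>1 < b - a" "0 < \<rho>2" "\<rho>2 < b - a" "0 < \<rho>3" "\<rho>3 < b - a" "0 < \<rho>4" "\<rho>4 < b - a"
    and avoid: "\<And>x. x \<in> conn a b \<Longrightarrow> energy_le x (e a b) \<Longrightarrow> x 0 \<noteq> a + \<rho>1"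
      "\<And>x. x \<in> conn a b \<Longrightarrow> energy_le x (e a b) \<Longrightarrow> x 0 \<noteq> b - \<rho>2"
      "\<And>x. x \<in> conn b a \<Longrightarrow> energy_le x (e b a) \<Longrightarrow> x 0 \<noteq> b - \<rho>3"
      "\<And>x. x \<in> conn b a \<Longrightarrow> energy_le x (e b a) \<Longrightarrow> x 0 \<noteq> a + \<rho>4"
  shows "\<exists>l0. \<forall>l\<ge>l0. \<exists>N. \<forall>m. admissible k m l \<longrightarrow>
    (\<exists>U c. minimizer (windows \<rho>1 \<rho>2 \<rho>3 \<rho>4 k m l) U c \<and>
      ((\<forall>i\<in>{1..2*k}. N \<le> m (2 * i) - m (2 * i - 1)) \<longrightarrow> (\<forall>i. E i U = 0)))"
proof -
  have aab: "a \<in> {a, b}" "b \<in> {a, b}" by auto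
  obtain xs cx where xs: "xs \<in> X" "\<And>i. i < 0 \<Longrightarrow> xs i = a" "\<And>i. i \<ge> 0 \<Longrightarrow> xs i = b" "energy_le xs cx"
    using step_transition[OF aab] by blast
  obtain ys cy where ys: "ys \<in> X" "\<And>i. i < 0 \<Longrightarrow> ys i = b" "\<And>i. i \<ge> 0 \<Longrightarrow> ys i = a" "energy_le ys cy"
    using step_transition[OF aab(2,1)] by blast
  \<comment> \<open>Sharp steps have width 0, so a competitor of this energy exists for every
    admissible \<open>m\<close>; the bound depends on neither \<open>l\<close> nor
    \<open>m\<close>.\<close>
  define C where "C = real k * (cx + cy)"
  obtain l1 where l1: "\<forall>l\<ge>l1. \<forall>K i0 i1.
    (\<forall>i\<in>{i0..<i0+l}. (i, a, \<rho>1) \<in> K) \<longrightarrow> (\<forall>i\<in>{i1..<i1+l}. (i, a, \<rho>4) \<in> K) \<longrightarrow>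
    (\<forall>(i, c, s)\<in>K. i < i0 + l \<or> i1 \<le> i \<longrightarrow> c = a \<and> 0 \<le> s) \<longrightarrow>
    (\<exists>x\<in>Ycon K. energy_le x C) \<longrightarrow> (\<exists>U c. minimizer K U c)"
    using minimizer_exists[OF \<rho>(2,8), of C] ..
  obtain \<mu>1 where \<mu>1: "\<mu>1 > 0" "\<And>x i c. x \<in> conn a b \<Longrightarrow> x i = a + \<rho>1 \<Longrightarrow> energy_le x c \<Longrightarrow> e a b + \<mu>1 \<le> c"
    using excess[OF aab, of "a + \<rho>1"] ab \<rho> avoid(1) by auto
  obtain \<mu>2 where \<mu>2: "\<mu>2 > 0" "\<And>x i c. x \<in> conn a b \<Longrightarrow> x i = b - \<rho>2 \<Longrightarrow> energy_le x c \<Longrightarrow> e a b + \<mu>2 \<le> c"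
    using excess[OF aab, of "b - \<rho>2"] ab \<rho> avoid(2) by auto
  obtain \<mu>3 where \<mu>3: "\<mu>3 > 0" "\<And>x i c. x \<in> conn b a \<Longrightarrow> x i = b - \<rho>3 \<Longrightarrow> energy_le x c \<Longrightarrow> e b a + \<mu>3 \<le> c"
    using excess[OF aab(2,1), of "b - \<rho>3"] ab \<rho> avoid(3) by auto
  obtain \<mu>4 where \<mu>4: "\<mu>4 > 0" "\<And>x i c. x \<in> conn b a \<Longrightarrow> x i = a + \<rho>4 \<Longrightarrow> energy_le x c \<Longrightarrow> e b a + \<mu>4 \<le> c"
    using excess[OF aab(2,1), of "a + \<rho>4"] ab \<rho> avoid(4) by auto
  define \<mu> where "\<mu> = min (min \<mu>1 \<mu>2) (min \<mu>3 \<mu>4)"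
  have \<mu>: "\<mu> > 0" "\<mu> \<le> \<mu>1" "\<mu> \<le> \<mu>2" "\<mu> \<le> \<mu>3" "\<mu> \<le> \<mu>4" using \<mu>1 \<mu>2 \<mu>3 \<mu>4 by (auto simp: \<mu>_def)
  \<comment> \<open>The glued competitor and the lower bound over the pivots each lose
    \<open>\<delta>\<close> on \<open>2 * k\<close> transitions. Each loss is
    \<open>\<mu> / 4\<close>, so together they are less than the excess.\<close>
  define \<delta> where "\<delta> = \<mu> / real (8 * k)"
  have \<delta>: "\<delta> > 0" "real (2 * k) * \<delta> = \<mu> / 4" using \<mu>(1) k by (simp_all add: \<delta>_def field_simps)
  obtain \<epsilon> where \<epsilon>: "tolerance \<delta> \<epsilon>"
    using tolerance_exists[OF \<delta>(1)] by blast
  note forces = window_near[OF _ _ toleranceD(1)[OF \<epsilon>], of _ _ C]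
  obtain la where la: "\<And>l. l \<ge> la \<Longrightarrow> forces_near C l a \<rho>1 \<epsilon>" using forces[OF aab(1) \<rho>(2)] by blast
  obtain lb where lb: "\<And>l. l \<ge> lb \<Longrightarrow> forces_near C l b \<rho>2 \<epsilon>" using forces[OF aab(2) \<rho>(4)] by blast
  obtain lc where lc: "\<And>l. l \<ge> lc \<Longrightarrow> forces_near C l b \<rho>3 \<epsilon>" using forces[OF aab(2) \<rho>(6)] by blast
  obtain ld where ld: "\<And>l. l \<ge> ld \<Longrightarrow> forces_near C l a \<rho>4 \<epsilon>" using forces[OF aab(1) \<rho>(8)] by blast
  obtain xo wx where xo: "xo \<in> X" "\<And>i. i < 0 \<Longrightarrow> xo i = a" "\<And>i. i \<ge> wx \<Longrightarrow> xo i = b" "energy_le xo (e a b + \<delta>)"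
    using near_optimal_transition[OF aab \<delta>(1)] by blast
  obtain yo wy where yo: "yo \<in> X" "\<And>i. i < 0 \<Longrightarrow> yo i = b" "\<And>i. i \<ge> wy \<Longrightarrow> yo i = a" "energy_le yo (e b a + \<delta>)"
    using near_optimal_transition[OF aab(2,1) \<delta>(1)] by blast
  \<comment> \<open>A transition that starts at an odd-indexed \<open>m (2 * i - 1)\<close> must be
    complete at \<open>m (2 * i)\<close>.\<close>
  define N where "N = max wx wy"
  \<comment> \<open>Consecutive pivots turn out to be more than \<open>l\<close> apart;
    \<open>2 * r \<le> l\<close> gives the separation that the tolerance requires.\<close>
  define l0 where "l0 = max (max (max la lb) (max lc ld)) (max l1 (2 * r))"
  have "\<exists>U c. minimizer (windows \<rho>1 \<rho>2 \<rho>3 \<rho>4 k m l) U c \<and>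
      ((\<forall>i\<in>{1..2*k}. N \<le> m (2 * i) - m (2 * i - 1)) \<longrightarrow> (\<forall>i. E i U = 0))"
    if l: "l \<ge> l0" and adm: "admissible k m l" for l m
  proof -
    have lge: "l \<ge> la" "l \<ge> lb" "l \<ge> lc" "l \<ge> ld" "l \<ge> l1" "l \<ge> 2 * r" "l \<ge> r" "l \<ge> 1" "l \<ge> 0"
      using l r1 by (auto simp: l0_def)
    let ?K = "windows \<rho>1 \<rho>2 \<rho>3 \<rho>4 k m l"
    note block = admissible_block[OF adm]
    note order = admissible_order[OF adm lge(9)]
    obtain k' where k': "k = Suc k'" using k by (cases k) auto
    have first: "m 1 \<le> m (1 + 4 * j)" if "j < k" for j
      using order[of 0 j] block[of 0] lge that by (cases "j = 0") auto
    have last: "m (4 + 4 * j) \<le> m (4 * k)" if "j < k" for j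
    proof (cases "j = k'")
      case False
      then show ?thesis using order[of j k'] block[of k'] lge that by (auto simp: k')
    qed (simp add: k')
    have ex: "\<exists>x\<in>Ycon ?K. energy_le x C"
      unfolding C_def using \<rho> block by (intro multi_transition[OF adm lge(7) k xs ys]) (auto intro: less_imp_le)
    have "\<exists>U c. minimizer ?K U c"
    proof (rule l1[THEN spec, THEN mp, OF lge(5), THEN spec, THEN spec, THEN spec, THEN mp, THEN mp, THEN mp, THEN mp, OF _ _ _ ex])
      show "\<forall>i\<in>{m 1 - l..<m 1 - l + l}. (i, a, \<rho>1) \<in> ?K"
        using windowsI(1)[of 0 k m l] k by auto
      show "\<forall>i\<in>{m (4 * k)..<m (4 * k) + l}. (i, a, \<rho>4) \<in> ?K"
        using windowsI(4)[of k' k m _ l] by (auto simp: k')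
      show "\<forall>(i, c, s)\<in>?K. i < m 1 - l + l \<or> m (4 * k) \<le> i \<longrightarrow> c = a \<and> 0 \<le> s"
      proof (clarify)
        fix i s \<theta> assume "(i, s, \<theta>) \<in> ?K" and i: "i < m 1 - l + l \<or> m (4 * k) \<le> i"
        then show "s = a \<and> 0 \<le> \<theta>"
        proof (cases rule: windows_cases)
          case (2 j)
          then show ?thesis using i first[of j] last[of j] block[of j] lge by linarith
        next
          case (3 j)
          then show ?thesis using i first[of j] last[of j] block[of j] lge by linarith
        qed (use \<rho> in auto)
      qed
    qed
    then obtain U c where min: "minimizer ?K U c" by blast
    have UK: "U \<in> Ycon ?K" and enU: "energy_le U c" using min by (auto simp: minimizer_def)
    have U: "U \<in> conn a a" "U \<in> X" using UK by (auto simp: Ycon_def conn_def)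
    have bd: "a \<le> U i" "U i \<le> b" for i using U by (auto simp: band_def)
    have "c \<le> C" using ex min by (auto simp: minimizer_def)
    then have enC: "energy_le U C" by (rule energy_le_mono[OF enU])
    have "E i U = 0" if big: "\<forall>i\<in>{1..2*k}. N \<le> m (2 * i) - m (2 * i - 1)" for i
    proof -
      have "m (1 + 4 * j) + N \<le> m (2 + 4 * j)" "m (3 + 4 * j) + N \<le> m (4 + 4 * j)" if "j < k" for j
      proof -
        have eq: "2 * (1 + 2 * j) = 2 + 4 * j" "2 + 4 * j - 1 = 1 + 4 * j"
            "2 * (2 + 2 * j) = 4 + 4 * j" "4 + 4 * j - 1 = 3 + 4 * j" by auto
        have "N \<le> m (2 + 4 * j) - m (1 + 4 * j)" "N \<le> m (4 + 4 * j) - m (3 + 4 * j)"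
          using bspec[OF big, of "1 + 2 * j"] bspec[OF big, of "2 + 2 * j"] that unfolding eq by auto
        then show "m (1 + 4 * j) + N \<le> m (2 + 4 * j)" "m (3 + 4 * j) + N \<le> m (4 + 4 * j)" by auto
      qed
      then have "\<exists>x\<in>Ycon ?K. energy_le x (real k * ((e a b + \<delta>) + (e b a + \<delta>)))"
        using \<rho> xo yo
        by (intro multi_transition[OF adm lge(7) k, of xo N _ yo]) (auto simp: N_def intro: less_imp_le)
      then have "c \<le> real k * ((e a b + \<delta>) + (e b a + \<delta>))"
        using min by (auto simp: minimizer_def)
      also have "\<dots> = real k * (e a b + e b a) + real (2 * k) * \<delta>" by (simp add: algebra_simps)
      finally have c_le: "c \<le> real k * (e a b + e b a) + \<mu> / 4" by (simp only: \<delta>)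
      have no_excess: False if "real k * (e a b + e b a) + \<mu>' \<le> c + real (2 * k) * \<delta>" "\<mu> \<le> \<mu>'" for \<mu>'
        using that c_le \<mu>(1) unfolding \<delta>(2) by linarith
      obtain pa where pa: "\<And>j. j < k \<Longrightarrow> m (1 + 4 * j) - l \<le> pa j \<and> pa j < m (1 + 4 * j) \<and> near \<epsilon> a (pa j) U"
        using near_choice[OF la[OF lge(1)] U(2) enC, of k "\<lambda>j. m (1 + 4 * j) - l"] YconD[OF UK windowsI(1)] by auto
      obtain pb where pb: "\<And>j. j < k \<Longrightarrow> m (2 + 4 * j) \<le> pb j \<and> pb j < m (2 + 4 * j) + l \<and> near \<epsilon> b (pb j) U"
        using near_choice[OF lb[OF lge(2)] U(2) enC, of k "\<lambda>j. m (2 + 4 * j)"] YconD[OF UK windowsI(2)] by auto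
      obtain pc where pc: "\<And>j. j < k \<Longrightarrow> m (3 + 4 * j) - l \<le> pc j \<and> pc j < m (3 + 4 * j) \<and> near \<epsilon> b (pc j) U"
        using near_choice[OF lc[OF lge(3)] U(2) enC, of k "\<lambda>j. m (3 + 4 * j) - l"] YconD[OF UK windowsI(3)] by auto
      obtain pd where pd: "\<And>j. j < k \<Longrightarrow> m (4 + 4 * j) \<le> pd j \<and> pd j < m (4 + 4 * j) + l \<and> near \<epsilon> a (pd j) U"
        using near_choice[OF ld[OF lge(4)] U(2) enC, of k "\<lambda>j. m (4 + 4 * j)"] YconD[OF UK windowsI(4)] by auto
      \<comment> \<open>The outermost pivots, left of the first window and right of the last one,
        come from the limits of \<open>U\<close> at infinity.\<close>
      obtain p0 q0 where "\<And>p. p \<le> p0 \<Longrightarrow> near \<epsilon> a p U" "\<And>p. p \<ge> q0 \<Longrightarrow> near \<epsilon> a p U"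
        using conn_near[OF U(1) toleranceD(1)[OF \<epsilon>]] by blast
      then obtain pl pr where pl: "pl < m 1 - l - 2 * r" "near \<epsilon> a pl U"
        and pr: "pr > m (4 * k) + l + 2 * r" "near \<epsilon> a pr U"
        by (intro that[of "min p0 (m 1 - l - 2 * r - 1)" "max q0 (m (4 * k) + l + 2 * r + 1)"]) auto
      \<comment> \<open>A pivot may not lie in the window of the active constraint: the pivots \<open>P\<close>, \<open>pb\<close> serve windows
        1 and 3, the pivots \<open>R\<close>, \<open>pc\<close> serve windows 2 and 4.\<close>
      define P where "P j = (if j = 0 then pl else pd (j - 1))" for j
      define R where "R j = (if j = k then pr else pa j)" for j
      have P: "near \<epsilon> a (P j) U" "P (Suc j) = pd j" if "j \<le> k" for j
        using pl pd[of "j - 1"] that by (auto simp: P_def)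
      have R: "near \<epsilon> a (R j) U" "j < k \<Longrightarrow> R j = pa j" if "j \<le> k" for j
        using pr pa[of j] that by (auto simp: R_def)
      have P0: "P j < m (1 + 4 * j) - l" if j: "j < k" for j
      proof (cases j)
        case 0
        with pl r1 show ?thesis by (simp add: P_def)
      next
        case (Suc j')
        with j pd[of j'] order[of j' j] lge show ?thesis by (simp add: P_def)
      qed
      have RS: "R (Suc j) > m (4 + 4 * j) + l" if j: "j < k" for j
      proof (cases "Suc j = k")
        case True
        then have "m (4 + 4 * j) = m (4 * k)" "R (Suc j) = pr" by (auto simp: R_def)
        with pr r1 show ?thesis by linarith
      next
        case False
        then have "Suc j < k" using j by simp
        then show ?thesis using order[of j "Suc j"] pa[of "Suc j"] R(2)[of "Suc j"] lge by simp
      qed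
      have P_gap: "P j + 2 * r < pb j" "pb j + 2 * r < P (Suc j)" if j: "j < k" for j
        using P0[OF j] P(2)[of j] pb[OF j] pd[OF j] block[OF j] lge r1 j by linarith+
      have R_gap: "R j + 2 * r < pc j" "pc j + 2 * r < R (Suc j)" if j: "j < k" for j
        using RS[OF j] R(2)[of j] pa[OF j] pc[OF j] block[OF j] lge r1 j by linarith+
      have near: "near \<epsilon> b (pb j) U" "near \<epsilon> b (pc j) U" if "j < k" for j
        using pb[OF that] pc[OF that] by auto
      note excess_P = pivot_excess[where P = P and Q = pb and k = k, OF \<epsilon> U(2) enU P(1) near(1) P_gap]
      note excess_R = pivot_excess[where P = R and Q = pc and k = k, OF \<epsilon> U(2) enU R(1) near(2) R_gap]
      have strict: "\<bar>U i - s\<bar> < \<theta>" if iK: "(i, s, \<theta>) \<in> ?K" for i s \<theta>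
      proof (rule ccontr)
        assume "\<not> \<bar>U i - s\<bar> < \<theta>"
        with YconD[OF UK iK] have eq: "\<bar>U i - s\<bar> = \<theta>" by simp
        from iK show False
        proof (cases rule: windows_cases)
          case (1 j)
          with eq bd[of i] have "U i = a + \<rho>1" by simp
          moreover have "P j \<le> i" "i < pb j" using P0[of j] pb[of j] block[of j] 1 lge by linarith+
          ultimately show False
            using excess_P[of j i \<mu>1] \<mu>1(2) no_excess \<mu>(2) 1 by auto
        next
          case (2 j)
          with eq bd[of i] have "U i = b - \<rho>2" by simp
          moreover have "R j \<le> i" "i < pc j" using R(2)[of j] pa[of j] pc[of j] block[of j] 2 lge by linarith+
          ultimately show False
            using excess_R[of j i \<mu>2] \<mu>2(2) no_excess \<mu>(3) 2 by auto
        next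
          case (3 j)
          with eq bd[of i] have "U i = b - \<rho>3" by simp
          moreover have "pb j \<le> i" "i < P (Suc j)" using P(2)[of j] pb[of j] pd[of j] block[of j] 3 lge by linarith+
          ultimately show False
            using excess_P[of j i \<mu>3] \<mu>3(2) no_excess \<mu>(4) 3 by auto
        next
          case (4 j)
          with eq bd[of i] have "U i = a + \<rho>4" by simp
          moreover have "pc j \<le> i" "i < R (Suc j)" using RS[of j] pc[of j] block[of j] 4 lge by linarith+
          ultimately show False
            using excess_R[of j i \<mu>4] \<mu>4(2) no_excess \<mu>(5) 4 by auto
        qed
      qed
      show ?thesis by (rule interior_minimizer_EL[OF windows_finite min strict])
    qed
    with min show ?thesis by blast
  qed
  then show ?thesis by blast
qed

end

subsection \<open>Functions with continuous partial derivatives\<close>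

lemma continuous_map_tendsto:
  assumes g: "continuous_map (powertop_real I) euclideanreal g"
    and x: "\<And>n. x n \<in> extensional I" "y \<in> extensional I" "\<And>i. i \<in> I \<Longrightarrow> ((\<lambda>n. x n i) \<longlongrightarrow> y i) F"
  shows "((\<lambda>n. g (x n)) \<longlongrightarrow> g y) F"
proof -
  have "limitin (powertop_real I) x y F"
    unfolding limitin_componentwise using x by (auto simp: PiE_UNIV_domain PiE_def)
  from continuous_map_limit[OF g this] show ?thesis by (simp add: o_def)
qed

lemma extensional_upd: "u \<in> extensional I \<Longrightarrow> k \<in> I \<Longrightarrow> u(k := t) \<in> extensional I"
  by (auto simp: extensional_def)

lemma C1_on_has_pderiv:
  assumes "C1_on I f" "u \<in> extensional I" "k \<in> I"
  shows "((\<lambda>s. f (u(k := s))) has_real_derivative pderiv_at k f (u(k := t))) (at t)"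
proof -
  have "u(k := t) \<in> extensional I" using assms(2,3) by (rule extensional_upd)
  then have "(\<lambda>s. f ((u(k := t))(k := s))) field_differentiable at ((u(k := t)) k)"
    using assms(1,3) unfolding C1_on_def by blast
  then show ?thesis
    unfolding pderiv_at_def by (simp add: DERIV_deriv_iff_field_differentiable)
qed

lemma C1_on_MVT:
  assumes "C1_on I f" "u \<in> extensional I" "k \<in> I"
  shows "\<exists>\<xi>. \<bar>\<xi> - s\<bar> \<le> \<bar>t\<bar> \<and> f (u(k := s + t)) - f (u(k := s)) = t * pderiv_at k f (u(k := \<xi>))"
proof -
  define g where "g = (\<lambda>s. f (u(k := s)))"
  have g: "(g has_real_derivative pderiv_at k f (u(k := s))) (at s)" for s
    unfolding g_def using assms by (rule C1_on_has_pderiv)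
  consider "t = 0" | "t > 0" | "t < 0" by linarith
  then show ?thesis
  proof cases
    case 2
    then obtain \<xi> where "s < \<xi>" "\<xi> < s + t" "g (s + t) - g s = (s + t - s) * pderiv_at k f (u(k := \<xi>))"
      using MVT2[of s "s + t" g "\<lambda>s. pderiv_at k f (u(k := s))"] g by auto
    then show ?thesis by (intro exI[of _ \<xi>]) (auto simp: g_def)
  next
    case 3
    then obtain \<xi> where "s + t < \<xi>" "\<xi> < s" "g s - g (s + t) = (s - (s + t)) * pderiv_at k f (u(k := \<xi>))"
      using MVT2[of "s + t" s g "\<lambda>s. pderiv_at k f (u(k := s))"] g by auto
    then show ?thesis by (intro exI[of _ \<xi>]) (auto simp: g_def algebra_simps)
  qed auto
qed

text \<open>Needed because one site of the chain stands for a whole layer of lattice sites, which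
  move together. The coordinates are added one at a time; the mean value theorem treats the new one,
  and joint continuity of its partial derivative gives the limit.\<close>

lemma C1_on_directional:
  assumes C1: "C1_on I f" and u: "u \<in> extensional I" and K: "finite K" "K \<subseteq> I"
  shows "((\<lambda>t. f (\<lambda>i. if i \<in> K then u i + t else u i)) has_real_derivative (\<Sum>k\<in>K. pderiv_at k f u)) (at 0)"
  using K
proof (induction K)
  case (insert k K)
  define w where "w t = (\<lambda>i. if i \<in> K then u i + t else u i)" for t
  have k: "k \<in> I" "k \<notin> K" using insert by auto
  have w: "w t \<in> extensional I" for t using u insert.prems by (auto simp: w_def extensional_def)
  have w_eq: "(\<lambda>i. if i \<in> insert k K then u i + t else u i) = (w t)(k := u k + t)"
    "(\<lambda>i. if i \<in> K then u i + t else u i) = (w t)(k := u k)" for t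
    using k by (auto simp: w_def fun_eq_iff)
  define R where "R t z \<longleftrightarrow> \<bar>z - u k\<bar> \<le> \<bar>t\<bar> \<and>
    f ((w t)(k := u k + t)) - f ((w t)(k := u k)) = t * pderiv_at k f ((w t)(k := z))" for t z
  have "\<exists>z. R t z" for t
    unfolding R_def using C1_on_MVT[OF C1 w k(1)] .
  then obtain \<xi> where "\<And>t. R t (\<xi> t)" by metis
  then have \<xi>: "\<And>t. \<bar>\<xi> t - u k\<bar> \<le> \<bar>t\<bar>"
    "\<And>t. f ((w t)(k := u k + t)) - f ((w t)(k := u k)) = t * pderiv_at k f ((w t)(k := \<xi> t))"
    by (simp_all add: R_def)
  define g where "g t = f ((w t)(k := u k + t)) - f ((w t)(k := u k))" for t
  have "((\<lambda>t. pderiv_at k f ((w t)(k := \<xi> t))) \<longlongrightarrow> pderiv_at k f u) (at 0)"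
  proof (rule continuous_map_tendsto[where I = I and g = "pderiv_at k f" and y = u and x = "\<lambda>t. (w t)(k := \<xi> t)"])
    show "continuous_map (powertop_real I) euclideanreal (pderiv_at k f)"
      using C1 k by (simp add: C1_on_def)
    show "(w t)(k := \<xi> t) \<in> extensional I" for t using w k(1) by (rule extensional_upd)
    have "((\<lambda>t. \<xi> t - u k) \<longlongrightarrow> 0) (at 0)"
    proof (rule Lim_null_comparison)
      show "\<forall>\<^sub>F t in at 0. norm (\<xi> t - u k) \<le> \<bar>t\<bar>" using \<xi>(1) by simp
      show "((\<lambda>t::real. \<bar>t\<bar>) \<longlongrightarrow> 0) (at 0)" by (rule tendsto_rabs_zero) (rule tendsto_ident_at)
    qed
    then have \<xi>_lim: "(\<xi> \<longlongrightarrow> u k) (at 0)" by (simp add: LIM_zero_iff)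
    show "((\<lambda>t. ((w t)(k := \<xi> t)) i) \<longlongrightarrow> u i) (at 0)" for i
      using \<xi>_lim by (cases "i = k"; cases "i \<in> K") (auto simp: w_def intro!: tendsto_eq_intros)
  qed (rule u)
  then have "((\<lambda>t. (g (0 + t) - g 0) / t) \<longlongrightarrow> pderiv_at k f u) (at 0)"
  proof (rule Lim_transform_eventually)
    show "\<forall>\<^sub>F t in at 0. pderiv_at k f ((w t)(k := \<xi> t)) = (g (0 + t) - g 0) / t"
      unfolding eventually_at_filter by (rule always_eventually) (simp add: g_def \<xi>(2))
  qed
  then have "(g has_real_derivative pderiv_at k f u) (at 0)" by (simp add: DERIV_def)
  moreover have "((\<lambda>t. f ((w t)(k := u k))) has_real_derivative (\<Sum>k\<in>K. pderiv_at k f u)) (at 0)"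
    using insert.IH insert.prems unfolding w_eq by simp
  ultimately have "((\<lambda>t. g t + f ((w t)(k := u k))) has_real_derivative pderiv_at k f u + (\<Sum>k\<in>K. pderiv_at k f u)) (at 0)"
    by (rule DERIV_add)
  then show ?case using insert.hyps unfolding w_eq(1) by (simp add: g_def)
qed simp

text \<open>Raises the coordinates in \<open>J\<close> one at a time. It is applied to a first
  partial derivative of \<open>s\<close>, with \<open>J\<close> omitting the coordinate of that
  derivative, where (S3) gives the signs.\<close>

lemma C1_on_antimono:
  assumes C1: "C1_on I f" and J: "finite J" "J \<subseteq> I"
    and le: "\<And>k u. k \<in> J \<Longrightarrow> u \<in> extensional I \<Longrightarrow> pderiv_at k f u \<le> 0"
    and u: "u \<in> extensional I" "v \<in> extensional I" "\<And>i. i \<in> J \<Longrightarrow> u i \<le> v i" "\<And>i. i \<notin> J \<Longrightarrow> u i = v i"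
  shows "f v \<le> f u"
proof -
  have "f (\<lambda>i. if i \<in> K then v i else u i) \<le> f u" if "finite K" "K \<subseteq> J" for K
    using that
  proof (induction K)
    case (insert k K)
    define w where "w = (\<lambda>i. if i \<in> K then v i else u i)"
    have k: "k \<in> J" "k \<in> I" "k \<notin> K" using insert J by auto
    have w: "w \<in> extensional I" using u(1,2) by (auto simp: w_def extensional_def)
    have "f (w(k := v k)) \<le> f (w(k := u k))"
    proof (rule DERIV_nonpos_imp_nonincreasing[of "u k" "v k" "\<lambda>s. f (w(k := s))"])
      show "u k \<le> v k" using u k by simp
      show "\<exists>y. ((\<lambda>s. f (w(k := s))) has_real_derivative y) (at t) \<and> y \<le> 0" for t
        using C1_on_has_pderiv[OF C1 w k(2), of t] le[OF k(1) extensional_upd[OF w k(2)]] by blast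
    qed
    moreover have "w(k := u k) = w" using k by (auto simp: w_def)
    moreover have "(\<lambda>i. if i \<in> insert k K then v i else u i) = w(k := v k)"
      by (auto simp: w_def fun_eq_iff)
    moreover have "f w \<le> f u" unfolding w_def using insert by auto
    ultimately show ?case by simp
  qed simp
  from this[OF J(1) order_refl] have "f (\<lambda>i. if i \<in> J then v i else u i) \<le> f u" .
  also have "(\<lambda>i. if i \<in> J then v i else u i) = v" using u(4) by auto
  finally show ?thesis .
qed

lemma C1_on_strict_antimono:
  assumes C1: "C1_on I f" and J: "finite J" "J \<subseteq> I"
    and le: "\<And>k u. k \<in> J \<Longrightarrow> u \<in> extensional I \<Longrightarrow> pderiv_at k f u \<le> 0"
    and u: "u \<in> extensional I" "v \<in> extensional I" "\<And>i. i \<in> J \<Longrightarrow> u i \<le> v i" "\<And>i. i \<notin> J \<Longrightarrow> u i = v i"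
    and k: "k \<in> J" "u k < v k" "\<And>u. u \<in> extensional I \<Longrightarrow> pderiv_at k f u < 0"
  shows "f v < f u"
proof -
  have kI: "k \<in> I" using k J by auto
  have "f (u(k := v k)) < f (u(k := u k))"
  proof (rule DERIV_neg_imp_decreasing[of "u k" "v k" "\<lambda>s. f (u(k := s))"])
    show "\<exists>y. ((\<lambda>s. f (u(k := s))) has_real_derivative y) (at t) \<and> y < 0" for t
      using C1_on_has_pderiv[OF C1 u(1) kI, of t] k(3)[OF extensional_upd[OF u(1) kI]] by blast
  qed (rule k(2))
  moreover have "f v \<le> f (u(k := v k))"
    using C1 J le extensional_upd[OF u(1) kI] u(2) by (rule C1_on_antimono) (use u in auto)
  ultimately show ?thesis by simp
qed

context chain
begin

subsection \<open>The functional $J_1$ and the reduction to chains\<close>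

definition Jlim :: "(int \<Rightarrow> real) \<Rightarrow> ereal" where
  "Jlim x = Liminf (at_bot \<times>\<^sub>F at_top) (\<lambda>(p, q). ereal (\<Sum>j=p..q. H j x))"

text \<open>Partial sums of \<open>H\<close> are partial sums of \<open>G\<close> plus boundary
  terms. The former increase with the interval as \<open>G\<close> is nonnegative, the latter
  converge, so the liminf is the total energy plus a constant fixed by the two limits.\<close>

lemma Jlim_le_iff:
  assumes x: "x \<in> conn \<alpha> \<beta>"
  shows "Jlim x \<le> ereal (c + (\<phi> (\<lambda>_. \<beta>) - \<phi> (\<lambda>_. \<alpha>))) \<longleftrightarrow> energy_le x c"
proof -
  let ?F = "at_bot \<times>\<^sub>F at_top :: (int \<times> int) filter"
  have X: "x \<in> X" using x by (simp add: conn_def)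
  have ntriv: "?F \<noteq> bot" by (simp add: prod_filter_eq_bot)
  define B where "B = (\<lambda>(p, q). \<phi> (shift (q + 1) x) - \<phi> (shift p x))"
  define \<kappa> where "\<kappa> = \<phi> (\<lambda>_. \<beta>) - \<phi> (\<lambda>_. \<alpha>)"
  have "((\<lambda>i. \<phi> (shift i x)) \<longlongrightarrow> \<phi> (\<lambda>_. \<alpha>)) at_bot" "((\<lambda>i. \<phi> (shift i x)) \<longlongrightarrow> \<phi> (\<lambda>_. \<beta>)) at_top"
    using x by (auto simp: conn_def intro!: \<phi>_shift_tendsto)
  from filterlim_compose[OF this(1) filterlim_fst] filterlim_compose[OF filterlim_compose[OF this(2) ends_shift[of at_top 1]] filterlim_snd]
  have "((\<lambda>z. \<phi> (shift (snd z + 1) x) - \<phi> (shift (fst z) x)) \<longlongrightarrow> \<kappa>) ?F"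
    unfolding \<kappa>_def by (intro tendsto_diff) auto
  then have B: "(B \<longlongrightarrow> \<kappa>) ?F" by (simp add: B_def case_prod_unfold)
  \<comment> \<open>The sums of $J_1$ run over closed intervals, those of \<open>sum_G\<close> over
    half-open ones, hence the state at \<open>q + 1\<close>.\<close>
  have J_eq: "(\<Sum>j=p..q. H j x) = (\<Sum>j=p..q. G j x) + B (p, q)" if "p \<le> q" for p q
  proof -
    have "{p..q} = {p..<q+1}" by auto
    then show ?thesis using sum_G[of p "q + 1" x] that by (simp add: B_def)
  qed
  have ev: "\<forall>\<^sub>F z in ?F. A \<subseteq> {fst z..snd z} \<and> fst z \<le> snd z" if "finite A" for A :: "int set"
  proof -
    define M where "M = Max (insert 0 (abs ` A))"
    have M: "\<bar>i\<bar> \<le> M" if "i \<in> insert 0 A" for i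
      unfolding M_def using that \<open>finite A\<close> by (intro Max_ge) auto
    have "\<forall>\<^sub>F z in ?F. fst z \<le> - M" "\<forall>\<^sub>F z in ?F. M \<le> snd z"
      using eventually_compose_filterlim[OF eventually_le_at_bot[of "- M"] filterlim_fst]
        eventually_compose_filterlim[OF eventually_ge_at_top[of M] filterlim_snd] .
    then show ?thesis
    proof eventually_elim
      case (elim z)
      have *: "i \<in> {fst z..snd z}" if "i \<in> insert 0 A" for i using M[OF that] elim by auto
      from *[of 0] have "fst z \<le> snd z" by simp
      with * show ?case by auto
    qed
  qed
  show ?thesis
    unfolding \<kappa>_def[symmetric]
  proof
    assume en: "energy_le x c"
    have "\<forall>\<^sub>F z in ?F. (case z of (p, q) \<Rightarrow> ereal (\<Sum>j=p..q. H j x)) \<le> ereal (c + B z)"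
      using ev[OF finite.emptyI]
    proof eventually_elim
      case (elim z)
      then show ?case using J_eq[of "fst z" "snd z"] energy_leD[OF en, of "{fst z..snd z}"]
        by (simp add: case_prod_unfold)
    qed
    then have "Jlim x \<le> Liminf ?F (\<lambda>z. ereal (c + B z))"
      unfolding Jlim_def by (rule Liminf_mono)
    also have "\<dots> = ereal (c + \<kappa>)"
      using B by (intro lim_imp_Liminf ntriv tendsto_ereal tendsto_add tendsto_const)
    finally show "Jlim x \<le> ereal (c + \<kappa>)" .
  next
    assume J: "Jlim x \<le> ereal (c + \<kappa>)"
    show "energy_le x c"
      unfolding energy_le_def
    proof (intro allI impI)
      fix A :: "int set" assume A: "finite A"
      have "\<forall>\<^sub>F z in ?F. ereal (energy A x + B z) \<le> (case z of (p, q) \<Rightarrow> ereal (\<Sum>j=p..q. H j x))"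
        using ev[OF A]
      proof eventually_elim
        case (elim z)
        then have "energy A x \<le> energy {fst z..snd z} x" using X by (intro sum_G_mono) auto
        with elim J_eq[of "fst z" "snd z"] show ?case by (simp add: case_prod_unfold)
      qed
      then have "Liminf ?F (\<lambda>z. ereal (energy A x + B z)) \<le> Jlim x"
        unfolding Jlim_def by (rule Liminf_mono)
      moreover have "Liminf ?F (\<lambda>z. ereal (energy A x + B z)) = ereal (energy A x + \<kappa>)"
        using B by (intro lim_imp_Liminf ntriv tendsto_ereal tendsto_add tendsto_const)
      ultimately have "ereal (energy A x + \<kappa>) \<le> ereal (c + \<kappa>)" using J by (metis order_trans)
      then show "energy A x \<le> c" by simp
    qed
  qed
qed

lemma Jlim_minimal:
  assumes S: "S \<subseteq> conn \<alpha> \<beta>" and x: "x \<in> S" "energy_le x c" and min: "\<And>y c'. y \<in> S \<Longrightarrow> energy_le y c' \<Longrightarrow> c \<le> c'"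
  shows "Jlim x = (INF y\<in>S. Jlim y)"
proof (rule antisym)
  let ?\<kappa> = "\<phi> (\<lambda>_. \<beta>) - \<phi> (\<lambda>_. \<alpha>)"
  show "(INF y\<in>S. Jlim y) \<le> Jlim x" using x(1) by (rule INF_lower)
  show "Jlim x \<le> (INF y\<in>S. Jlim y)"
  proof (rule INF_greatest, rule ccontr)
    fix y assume y: "y \<in> S" "\<not> Jlim x \<le> Jlim y"
    have "Jlim x \<le> ereal (c + ?\<kappa>)" using x S Jlim_le_iff[of x \<alpha> \<beta> c] by auto
    with y(2) have "Jlim y < ereal (c + ?\<kappa>)" by (metis leI order_trans)
    \<comment> \<open>The energy criterion is stated for real levels, so a real number is put
      between the two extended reals.\<close>
    then obtain z where z: "Jlim y < ereal z" "ereal z < ereal (c + ?\<kappa>)" using ereal_dense2 by blast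
    have "Jlim y \<le> ereal ((z - ?\<kappa>) + ?\<kappa>)" using z(1) by (simp add: less_imp_le)
    then have "energy_le y (z - ?\<kappa>)" using y(1) S Jlim_le_iff[of y \<alpha> \<beta> "z - ?\<kappa>"] by blast
    with min[OF y(1)] z(2) show False by force
  qed
qed

text \<open>Identifies minimality of $J_1$ with minimality of the corrected energy. As the infimum
  \<open>e \<alpha> \<beta>\<close> may not be attained, the converse passes through all levels
  above it.\<close>

lemma conn_minimizer_iff:
  assumes \<alpha>\<beta>: "\<alpha> \<in> {a, b}" "\<beta> \<in> {a, b}" and x: "x \<in> conn \<alpha> \<beta>"
  shows "Jlim x = (INF y\<in>conn \<alpha> \<beta>. Jlim y) \<longleftrightarrow> energy_le x (e \<alpha> \<beta>)"
proof
  assume "energy_le x (e \<alpha> \<beta>)"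
  then show "Jlim x = (INF y\<in>conn \<alpha> \<beta>. Jlim y)"
    using x e_le by (intro Jlim_minimal[OF order_refl])
next
  let ?\<kappa> = "\<phi> (\<lambda>_. \<beta>) - \<phi> (\<lambda>_. \<alpha>)"
  assume J: "Jlim x = (INF y\<in>conn \<alpha> \<beta>. Jlim y)"
  have en: "energy_le x c" if c: "e \<alpha> \<beta> < c" for c
  proof -
    obtain y where y: "y \<in> conn \<alpha> \<beta>" "energy_le y c" using e_approx[OF \<alpha>\<beta> c] by blast
    have "Jlim x \<le> Jlim y" unfolding J using y(1) by (rule INF_lower)
    also have "Jlim y \<le> ereal (c + ?\<kappa>)" using Jlim_le_iff[OF y(1)] y(2) by blast
    finally show ?thesis using Jlim_le_iff[OF x] by blast
  qed
  show "energy_le x (e \<alpha> \<beta>)"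
    unfolding energy_le_def
  proof (intro allI impI)
    fix A :: "int set" assume A: "finite A"
    show "energy A x \<le> e \<alpha> \<beta>"
    proof (rule field_le_epsilon)
      fix \<eta> :: real assume "\<eta> > 0"
      then show "energy A x \<le> e \<alpha> \<beta> + \<eta>" using energy_leD[OF en A] by simp
    qed
  qed
qed

end

section \<open>Configurations that depend on one coordinate\<close>

definition lift :: "'n \<Rightarrow> (int \<Rightarrow> real) \<Rightarrow> 'n::finite config" where
  "lift d x = (\<lambda>j. x (j $ d))"

definition win :: "nat \<Rightarrow> 'n \<Rightarrow> (int \<Rightarrow> real) \<Rightarrow> 'n::finite config" where
  "win r d x = (\<lambda>k\<in>Bset r. x (k $ d))"

lemma win_ext: "win r d x \<in> extensional (Bset r)"
  by (simp add: win_def)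

lemma Bset_component: "k \<in> Bset r \<Longrightarrow> \<bar>k $ h\<bar> \<le> int r"
proof -
  have "\<bar>k $ h\<bar> \<le> (\<Sum>i\<in>UNIV. \<bar>k $ i\<bar>)" by (rule member_le_sum) auto
  then show "k \<in> Bset r \<Longrightarrow> \<bar>k $ h\<bar> \<le> int r" by (simp add: Bset_def l1norm_def)
qed

lemma Bset_component_image: "(\<lambda>k. k $ h) ` (Bset r :: (int ^ 'n::finite) set) \<subseteq> {- int r..int r}"
proof clarify
  fix k :: "int ^ 'n" assume "k \<in> Bset r"
  then show "k $ h \<in> {- int r..int r}" using Bset_component[of k r h] by auto
qed

lemma Bset_finite: "finite (Bset r :: (int ^ 'n::finite) set)"
proof -
  have "k $ h \<in> {- int r..int r}" if "k \<in> Bset r" for k :: "int ^ 'n" and h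
    using Bset_component[OF that, of h] by auto
  then have "vec_nth ` (Bset r :: (int ^ 'n) set) \<subseteq> (UNIV \<rightarrow>\<^sub>E {- int r..int r})"
    by auto
  then have "finite (vec_nth ` (Bset r :: (int ^ 'n) set))"
    by (rule finite_subset) (intro finite_PiE; simp)
  then show ?thesis by (rule finite_imageD) (auto simp: inj_on_def vec_nth_inject)
qed

lemma Bset_finite_Collect [simp]: "finite {k \<in> Bset r. P (k :: int ^ 'n::finite)}"
  by (rule finite_subset[OF _ Bset_finite]) auto

lemma l1norm_axis: "l1norm (axis h t) = \<bar>t\<bar>"
proof -
  have "l1norm (axis h t) = (\<Sum>i\<in>UNIV. if i = h then \<bar>t\<bar> else 0)"
    unfolding l1norm_def by (intro sum.cong) (auto simp: axis_def)
  then show ?thesis by simp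
qed

lemma l1norm_minus_commute: "l1norm (i - j) = l1norm (j - i)"
  by (simp add: l1norm_def abs_minus_commute)

lemma periodic1_axis:
  assumes "periodic1 h u"
  shows "u (i + axis h t) = u i"
proof (induction t rule: int_induct[of _ 0])
  case base
  have "axis h (0::int) = 0" by (simp add: vec_eq_iff axis_def)
  then show ?case by (simp only: add_0_right)
next
  case (step1 t)
  have "i + axis h (t + 1) = i + axis h t + axis h 1" by (simp add: vec_eq_iff axis_def)
  moreover have "u (i + axis h t + axis h 1) = u (i + axis h t)"
    using assms by (simp add: periodic1_def)
  ultimately show ?case using step1 by (simp only:)
next
  case (step2 t)
  have "i + axis h t = i + axis h (t - 1) + axis h 1" by (simp add: vec_eq_iff axis_def)
  moreover have "u (i + axis h (t - 1) + axis h 1) = u (i + axis h (t - 1))"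
    using assms by (simp add: periodic1_def)
  ultimately show ?case using step2 by (simp only:)
qed

lemma periodic_reduce:
  assumes "finite T" "\<And>h. h \<in> T \<Longrightarrow> periodic1 h u"
  shows "u j = u (\<chi> h. if h \<in> T then 0 else j $ h)"
  using assms
proof (induction T)
  case empty
  show ?case by (rule arg_cong[where f = u]) (simp add: vec_eq_iff)
next
  case (insert h T)
  have "(\<chi> i. if i \<in> T then 0 else j $ i) = (\<chi> i. if i \<in> insert h T then 0 else j $ i) + axis h (j $ h)"
    using insert.hyps by (auto simp: vec_eq_iff axis_def)
  with insert periodic1_axis[of h u] show ?case by simp
qed

lemma periodic_lift:
  assumes "\<And>h. h \<noteq> d \<Longrightarrow> periodic1 h u"
  shows "u = lift d (\<lambda>i. u (axis d i))"
proof
  fix j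
  have "u j = u (\<chi> h. if h \<in> - {d} then 0 else j $ h)"
    using assms by (intro periodic_reduce) auto
  also have "(\<chi> h. if h \<in> - {d} then 0 else j $ h) = axis d (j $ d)"
    by (auto simp: vec_eq_iff axis_def)
  finally show "u j = lift d (\<lambda>i. u (axis d i)) j" by (simp add: lift_def)
qed

lemma periodic_const:
  fixes u :: "'n::finite config"
  assumes "\<And>h. periodic1 h u"
  shows "u = (\<lambda>_. u 0)"
proof
  fix j
  have "u j = u (\<chi> h. if h \<in> UNIV then 0 else j $ h)"
    using assms by (intro periodic_reduce) auto
  also have "(\<chi> h. if h \<in> UNIV then 0 else j $ h) = (0 :: int ^ 'n)" by (simp add: vec_eq_iff)
  finally show "u j = u 0" .
qed

lemma lift_periodic: "h \<noteq> d \<Longrightarrow> periodic1 h (lift d x)"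
  by (simp add: periodic1_def lift_def axis_def)

lemma lift_axis [simp]: "lift d x (axis d i) = x i"
  by (simp add: lift_def axis_def)

lemma Sloc_lift: "Sloc r s j (lift d x) = s (win r d (shift (j $ d) x))"
  by (simp add: Sloc_def lift_def win_def)

section \<open>The lattice model as a chain\<close>

locale lattice_model =
  fixes r :: nat and s :: "'n::finite config \<Rightarrow> real" and d :: 'n and a b :: real
  assumes r: "r \<ge> 1" and C2: "C2_on (Bset r) s" and S2: "S2 r s" and S3: "S3 r s"
    and adj: "adjacent (M0 r s) (\<lambda>_. a) (\<lambda>_. b)"
begin

definition slab_energy :: "(int \<Rightarrow> real) \<Rightarrow> real" where
  "slab_energy x = s (win r d x) - c0 r s"

text \<open>Changing the chain at \<open>p\<close> moves all lattice sites of the layer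
  \<open>k $ d = p\<close> at once, so their partial derivatives add up.\<close>

definition slab_deriv :: "int \<Rightarrow> (int \<Rightarrow> real) \<Rightarrow> real" where
  "slab_deriv p x = (\<Sum>k | k \<in> Bset r \<and> k $ d = p. pderiv_at k s (win r d x))"

lemma C1: "C1_on (Bset r) s" and C1': "k \<in> Bset r \<Longrightarrow> C1_on (Bset r) (pderiv_at k s)"
  using C2 by (auto simp: C2_on_def)

lemma c0_eq: "c0 r s = Inf (range (\<lambda>c. s (win r d (\<lambda>_. c))))"
proof -
  have "{Sloc r s 0 u | u. \<forall>h. periodic1 h u} = range (\<lambda>c. s (win r d (\<lambda>_. c)))"
  proof (intro equalityI subsetI)
    fix z assume "z \<in> {Sloc r s 0 u | u. \<forall>h. periodic1 h u}"
    then obtain u where u: "z = Sloc r s 0 u" "\<forall>h. periodic1 h u" by auto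
    then have "u = lift d (\<lambda>_. u 0)" using periodic_const[of u] by (auto simp: lift_def)
    then have "z = s (win r d (\<lambda>_. u 0))" using u(1) Sloc_lift[of r s 0 d "\<lambda>_. u 0"] by simp
    then show "z \<in> range (\<lambda>c. s (win r d (\<lambda>_. c)))" by simp
  next
    fix z assume "z \<in> range (\<lambda>c. s (win r d (\<lambda>_. c)))"
    then obtain c where z: "z = s (win r d (\<lambda>_. c))" by auto
    have "Sloc r s 0 (\<lambda>_. c) = z" using Sloc_lift[of r s 0 d "\<lambda>_. c"] by (simp add: lift_def z)
    then show "z \<in> {Sloc r s 0 u | u. \<forall>h. periodic1 h u}" by (auto simp: periodic1_def)
  qed
  then show ?thesis by (simp add: c0_def)
qed

lemma slab_energy_const_nonneg: "0 \<le> slab_energy (\<lambda>_. c)"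
proof -
  have "bdd_below (range (\<lambda>c. s (win r d (\<lambda>_. c))))"
    using S2 win_ext unfolding S2_def by (elim conjE bdd_below_mono) blast
  then have "c0 r s \<le> s (win r d (\<lambda>_. c))" unfolding c0_eq by (intro cInf_lower) auto
  then show ?thesis by (simp add: slab_energy_def)
qed

lemma M0_iff: "(\<lambda>_. c) \<in> M0 r s \<longleftrightarrow> slab_energy (\<lambda>_. c) = 0"
  using Sloc_lift[of r s 0 d "\<lambda>_. c"] by (auto simp: M0_def periodic1_def lift_def slab_energy_def)

lemma ab: "a < b"
  using adj by (simp add: adjacent_def cless_def)

lemma slab_energy_zero_iff:
  assumes "a \<le> c" "c \<le> b"
  shows "slab_energy (\<lambda>_. c) = 0 \<longleftrightarrow> c = a \<or> c = b"
  using adj assms unfolding adjacent_def cless_def M0_iff[symmetric]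
  by (metis (mono_tags, lifting) order_le_less)

lemma slab_energy_deriv:
  assumes "\<bar>p\<bar> \<le> int r"
  shows "((\<lambda>t. slab_energy (x(p := t))) has_real_derivative slab_deriv p x) (at (x p))"
proof -
  let ?K = "{k \<in> Bset r. k $ d = p}" and ?u = "win r d x"
  have "((\<lambda>t. s (\<lambda>i. if i \<in> ?K then ?u i + t else ?u i)) has_real_derivative slab_deriv p x) (at 0)"
    unfolding slab_deriv_def by (intro C1_on_directional[OF C1 win_ext]) auto
  moreover have "(\<lambda>i. if i \<in> ?K then ?u i + t else ?u i) = win r d (x(p := x p + t))" for t
    by (auto simp: win_def fun_eq_iff)
  ultimately have "((\<lambda>t. s (win r d (x(p := x p + t)))) has_real_derivative slab_deriv p x) (at 0)" by simp
  then have "((\<lambda>t. s (win r d (x(p := t)))) has_real_derivative slab_deriv p x) (at (x p))"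
    using DERIV_shift[of "\<lambda>t. s (win r d (x(p := t)))" "slab_deriv p x" 0 "x p"] by (simp add: add.commute)
  then show ?thesis unfolding slab_energy_def by (auto intro!: derivative_eq_intros)
qed

lemma pderiv_antimono:
  assumes "k \<in> Bset r" "x \<le> y" "x (k $ d) = y (k $ d)"
  shows "pderiv_at k s (win r d y) \<le> pderiv_at k s (win r d x)"
proof (rule C1_on_antimono[OF C1'[OF assms(1)], of "{i \<in> Bset r. i \<noteq> k}"])
  show "pderiv_at i (pderiv_at k s) u \<le> 0" if "i \<in> {i \<in> Bset r. i \<noteq> k}" "u \<in> extensional (Bset r)" for i u
    using S3 that assms(1) by (auto simp: S3_def)
qed (use assms win_ext in \<open>auto simp: win_def le_fun_def\<close>)

lemma slab_energy_chain: "chain (int r) slab_energy slab_deriv a b"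
proof
  show "1 \<le> int r" using r by simp
  show "a < b" by (rule ab)
  show "slab_energy x = slab_energy y" if "\<And>i. \<bar>i\<bar> \<le> int r \<Longrightarrow> x i = y i" for x y
  proof -
    have "win r d x = win r d y" using that Bset_component by (auto simp: win_def fun_eq_iff)
    then show ?thesis by (simp add: slab_energy_def)
  qed
  show "(\<lambda>n. slab_energy (x n)) \<longlonglongrightarrow> slab_energy y" if "\<And>i. (\<lambda>n. x n i) \<longlonglongrightarrow> y i" for x y
    unfolding slab_energy_def
  proof (intro tendsto_intros continuous_map_tendsto[where I = "Bset r" and g = s and x = "\<lambda>n. win r d (x n)"])
    show "continuous_map (powertop_real (Bset r)) euclideanreal s"
      using C1 by (simp add: C1_on_def)
    show "(\<lambda>n. win r d (x n) i) \<longlonglongrightarrow> win r d y i" if "i \<in> Bset r" for i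
      using that \<open>\<And>i. (\<lambda>n. x n i) \<longlonglongrightarrow> y i\<close> by (simp add: win_def)
  qed (rule win_ext)+
  show "((\<lambda>t. slab_energy (x(p := t))) has_real_derivative slab_deriv p x) (at (x p))" if "\<bar>p\<bar> \<le> int r" for x p
    using that by (rule slab_energy_deriv)
  show "slab_deriv p y \<le> slab_deriv p x" if "x \<le> y" "x p = y p" for x y p
    unfolding slab_deriv_def using that by (intro sum_mono pderiv_antimono) auto
  show "slab_deriv p y < slab_deriv p x" if p: "\<bar>p\<bar> = 1" and xy: "x \<le> y" "x p = y p" "x 0 < y 0" for x y p
    unfolding slab_deriv_def
  proof (rule sum_strict_mono_ex1)
    show "finite {k \<in> Bset r. k $ d = p}" by simp
    show "\<forall>k\<in>{k \<in> Bset r. k $ d = p}. pderiv_at k s (win r d y) \<le> pderiv_at k s (win r d x)"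
      using xy by (auto intro!: pderiv_antimono)
    have l1: "l1norm (axis d p) = 1" using p by (simp add: l1norm_axis)
    have B: "axis d p \<in> Bset r" using l1 r by (simp add: Bset_def)
    have B0: "0 \<in> Bset r" by (simp add: Bset_def l1norm_def)
    have ne: "axis d p \<noteq> (0 :: int ^ 'n)" using p by (auto simp: vec_eq_iff axis_def)
    \<comment> \<open>In the layer \<open>p\<close>, the neighbour \<open>axis d p\<close> of the
      origin gives the strict decrease: its partial derivative strictly decreases in the value at
      the origin by (S3).\<close>
    have "pderiv_at (axis d p) s (win r d y) < pderiv_at (axis d p) s (win r d x)"
    proof (rule C1_on_strict_antimono[OF C1'[OF B], of "{i \<in> Bset r. i \<noteq> axis d p}" _ _ 0])
      show "pderiv_at i (pderiv_at (axis d p) s) u \<le> 0"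
        if "i \<in> {i \<in> Bset r. i \<noteq> axis d p}" "u \<in> extensional (Bset r)" for i u
        using S3 that B by (auto simp: S3_def)
      show "pderiv_at 0 (pderiv_at (axis d p) s) u < 0" if "u \<in> extensional (Bset r)" for u
        using S3 that l1 by (auto simp: S3_def)
    qed (use xy ne B B0 win_ext in \<open>auto simp: win_def le_fun_def axis_def\<close>)
    then show "\<exists>k\<in>{k \<in> Bset r. k $ d = p}. pderiv_at k s (win r d y) < pderiv_at k s (win r d x)"
      using B by (intro bexI[of _ "axis d p"]) (auto simp: axis_def)
  qed
  show "0 \<le> slab_energy (\<lambda>_. c)" for c by (rule slab_energy_const_nonneg)
  show "slab_energy (\<lambda>_. c) = 0 \<longleftrightarrow> c = a \<or> c = b" if "a \<le> c" "c \<le> b" for c using that by (rule slab_energy_zero_iff)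
  show "(\<Sum>p=- int r..int r. slab_deriv p (\<lambda>_. c)) = 0" if c: "c \<in> {a, b}" for c
  proof -
    \<comment> \<open>The values \<open>a\<close> and \<open>b\<close> minimize the energy among all
      constants, and the sum over all layers is the derivative along the constants.\<close>
    let ?u = "win r d (\<lambda>_. c)"
    have "(\<Sum>p=- int r..int r. slab_deriv p (\<lambda>_. c)) = (\<Sum>k\<in>Bset r. pderiv_at k s ?u)"
      unfolding slab_deriv_def by (rule sum.group[OF Bset_finite _ Bset_component_image]) simp
    moreover have "((\<lambda>t. s (\<lambda>i. if i \<in> Bset r then ?u i + t else ?u i)) has_real_derivative (\<Sum>k\<in>Bset r. pderiv_at k s ?u)) (at 0)"
      using Bset_finite by (intro C1_on_directional[OF C1 win_ext]) auto
    moreover have "(\<lambda>i. if i \<in> Bset r then ?u i + t else ?u i) = win r d (\<lambda>_. c + t)" for t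
      by (auto simp: win_def fun_eq_iff)
    moreover have "s (win r d (\<lambda>_. c + 0)) \<le> s (win r d (\<lambda>_. c + t))" for t
      using slab_energy_const_nonneg[of "c + t"] slab_energy_zero_iff[of c] c ab by (auto simp: slab_energy_def)
    ultimately show ?thesis
      using DERIV_local_min[of "\<lambda>t. s (win r d (\<lambda>_. c + t))" _ 0 1] by simp
  qed
qed

sublocale chain "int r" slab_energy slab_deriv a b
  by (rule slab_energy_chain)

lemma J1_lift: "J1 r s d (lift d x) = Jlim x"
proof -
  have "Sloc r s (axis d j) (lift d x) - c0 r s = H j x" for j
    unfolding Sloc_lift H_def slab_energy_def by (simp add: axis_def)
  then show ?thesis by (simp add: J1_def Jlim_def J1_sum_def)
qed

lemma Gamma1_eq: "Gamma1 d (\<lambda>_. a) (\<lambda>_. b) (\<lambda>_. \<alpha>) (\<lambda>_. \<beta>) = lift d ` conn \<alpha> \<beta>"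
proof (intro equalityI subsetI)
  fix u assume u: "u \<in> Gamma1 d (\<lambda>_. a) (\<lambda>_. b) (\<lambda>_. \<alpha>) (\<lambda>_. \<beta>)"
  define x where "x = (\<lambda>i. u (axis d i))"
  have "u = lift d x" unfolding x_def using u by (intro periodic_lift) (auto simp: Gamma1_def Gamma1_hat_def)
  moreover have "x \<in> band a b" using u by (auto simp: Gamma1_def Gamma1_hat_def x_def band_def le_fun_def)
  moreover have "(x \<longlongrightarrow> \<alpha>) at_bot" "(x \<longlongrightarrow> \<beta>) at_top"
    using u by (auto simp: Gamma1_def Tnorm_def x_def tendsto_rabs_zero_iff LIM_zero_iff)
  ultimately show "u \<in> lift d ` conn \<alpha> \<beta>" by (auto simp: conn_def)
next
  fix u assume "u \<in> lift d ` conn \<alpha> \<beta>"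
  then obtain x where x: "x \<in> conn \<alpha> \<beta>" "u = lift d x" by auto
  then show "u \<in> Gamma1 d (\<lambda>_. a) (\<lambda>_. b) (\<lambda>_. \<alpha>) (\<lambda>_. \<beta>)"
    using lift_periodic[of _ d x]
    by (auto simp: Gamma1_def Gamma1_hat_def Tnorm_def tendsto_rabs_zero_iff LIM_zero_iff conn_def band_def
        le_fun_def lift_def[of d x])
qed

lemma M1_iff:
  assumes "\<alpha> \<in> {a, b}" "\<beta> \<in> {a, b}" "x \<in> conn \<alpha> \<beta>"
  shows "lift d x \<in> M1 r s d (\<lambda>_. a) (\<lambda>_. b) (\<lambda>_. \<alpha>) (\<lambda>_. \<beta>) \<longleftrightarrow> energy_le x (e \<alpha> \<beta>)"
  using conn_minimizer_iff[OF assms] assms(3) by (simp add: M1_def c1_def Gamma1_eq J1_lift image_image)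

lemma rho_lift: "rho d (\<lambda>_. c) (tau1 d i (lift d x)) = \<bar>x i - c\<bar>" "rho d (\<lambda>_. c) (lift d x) = \<bar>x 0 - c\<bar>"
  by (simp_all add: rho_def Tnorm_def tau1_def lift_def axis_def)

text \<open>Substituting \<open>k = i - j\<close> and grouping by layers turns (EL) at
  \<open>i\<close> into the chain equation at \<open>i $ d\<close>, since the lifted chain looks the
  same from all sites of a layer.\<close>

lemma solution_lift:
  assumes "\<And>i. E i x = 0"
  shows "solution r s (lift d x)"
  unfolding solution_def
proof
  fix i :: "int ^ 'n"
  have pd: "pderiv_at i (Sloc r s j) (lift d x) = pderiv_at (i - j) s (win r d (shift (j $ d) x))"
    if "i - j \<in> Bset r" for j
  proof -
    have "(\<lambda>k\<in>Bset r. ((lift d x)(i := t)) (j + k)) = (win r d (shift (j $ d) x))(i - j := t)" for t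
      using that by (auto simp: fun_eq_iff win_def lift_def algebra_simps)
    moreover have "lift d x i = win r d (shift (j $ d) x) (i - j)"
      using that by (simp add: win_def lift_def)
    ultimately show ?thesis by (simp add: pderiv_at_def Sloc_def)
  qed
  have "(\<Sum>j | l1norm (j - i) \<le> int r. pderiv_at i (Sloc r s j) (lift d x))
      = (\<Sum>k\<in>Bset r. pderiv_at k s (win r d (shift (i $ d - k $ d) x)))"
  proof (rule sum.reindex_bij_witness[of _ "\<lambda>k. i - k" "\<lambda>j. i - j"])
    fix j assume "j \<in> {j. l1norm (j - i) \<le> int r}"
    then have j: "i - j \<in> Bset r" by (simp add: Bset_def l1norm_minus_commute)
    then show "i - j \<in> Bset r" .
    show "pderiv_at (i - j) s (win r d (shift (i $ d - (i - j) $ d) x)) = pderiv_at i (Sloc r s j) (lift d x)"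
      using pd[OF j] by simp
  next
    fix k :: "int ^ 'n" assume "k \<in> Bset r"
    then show "i - k \<in> {j. l1norm (j - i) \<le> int r}" by (simp add: Bset_def l1norm_def)
  qed simp_all
  also have "\<dots> = (\<Sum>p=- int r..int r. \<Sum>k | k \<in> Bset r \<and> k $ d = p. pderiv_at k s (win r d (shift (i $ d - k $ d) x)))"
    by (rule sum.group[OF Bset_finite _ Bset_component_image, symmetric]) simp
  also have "\<dots> = E (i $ d) x"
    unfolding E_def slab_deriv_def by (intro sum.cong) auto
  finally show "(\<Sum>j | l1norm (j - i) \<le> int r. pderiv_at i (Sloc r s j) (lift d x)) = 0"
    using assms by simp
qed

end

theorem theorem4p1:
  fixes s :: "'n::finite config \<Rightarrow> real"
    and r k :: nat
    and d :: 'n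
    and v0 w0 :: "'n config"
    and \<rho>1 \<rho>2 \<rho>3 \<rho>4 :: real
  assumes "CARD('n) \<ge> 2" and "r \<ge> 1"
    and "C2_on (Bset r) s" and "S1 r s" and "S2 r s" and "S3 r s"
    and "k \<ge> 2"
    and "adjacent (M0 r s) v0 w0"
    and "\<exists>v1 w1. adjacent (M1 r s d v0 w0 v0 w0) v1 w1"
    and "\<exists>v1 w1. adjacent (M1 r s d v0 w0 w0 v0) v1 w1"
    and "\<rho>1 \<in> {0<..<rho d v0 w0}" and "\<rho>1 \<notin> rho d v0 ` M1 r s d v0 w0 v0 w0"
    and "\<rho>2 \<in> {0<..<rho d v0 w0}" and "\<rho>2 \<notin> rho d w0 ` M1 r s d v0 w0 v0 w0"
    and "\<rho>3 \<in> {0<..<rho d v0 w0}" and "\<rho>3 \<notin> rho d w0 ` M1 r s d v0 w0 w0 v0"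
    and "\<rho>4 \<in> {0<..<rho d v0 w0}" and "\<rho>4 \<notin> rho d v0 ` M1 r s d v0 w0 w0 v0"
  shows "\<exists>l0::nat. \<forall>l\<ge>l0. \<exists>N::int. \<forall>m::nat \<Rightarrow> int.
    (\<forall>i. 1 \<le> i \<and> i < 4 * k \<longrightarrow> m i < m (i + 1)) \<and>
    (\<forall>j. 1 \<le> j \<and> j < 4 * k \<and> even j \<longrightarrow> m j + 2 * int l < m (j + 1)) \<longrightarrow>
    (\<exists>U\<in>Yset d v0 w0 \<rho>1 \<rho>2 \<rho>3 \<rho>4 k m l.
       J1 r s d U = b_inf r s d v0 w0 \<rho>1 \<rho>2 \<rho>3 \<rho>4 k m l \<and>
       ((\<forall>i\<in>{1..2 * k}. m (2 * i) - m (2 * i - 1) \<ge> N) \<longrightarrow> solution r s U))"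
proof -
  have M: "v0 \<in> M0 r s" "w0 \<in> M0 r s" using assms(8) by (auto simp: adjacent_def)
  define a b where "a = v0 0" and "b = w0 0"
  \<comment> \<open>Periodicity in all directions makes the members of \<open>M0 r s\<close>
    constant.\<close>
  have vw: "v0 = (\<lambda>_. a)" "w0 = (\<lambda>_. b)"
    unfolding a_def b_def using M by (auto simp: M0_def intro!: periodic_const)
  interpret lattice_model r s d a b
    using assms vw by unfold_locales auto
  have ex_min: "\<exists>x\<in>conn \<alpha> \<beta>. energy_le x (e \<alpha> \<beta>)"
    if gap: "\<exists>v1 w1. adjacent (M1 r s d v0 w0 (\<lambda>_. \<alpha>) (\<lambda>_. \<beta>)) v1 w1" and mem: "\<alpha> \<in> {a, b}" "\<beta> \<in> {a, b}" for \<alpha> \<beta>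
  proof -
    obtain v1 where v1: "v1 \<in> M1 r s d v0 w0 (\<lambda>_. \<alpha>) (\<lambda>_. \<beta>)" using gap by (auto simp: adjacent_def)
    then obtain x where "x \<in> conn \<alpha> \<beta>" "v1 = lift d x" by (auto simp: M1_def vw Gamma1_eq)
    with v1 M1_iff[OF mem] show ?thesis by (auto simp: vw)
  qed
  interpret chain_min "int r" slab_energy slab_deriv a b
    using ex_min[of a b] ex_min[of b a] assms(9,10) unfolding vw by unfold_locales simp_all
  have rho_ab: "rho d v0 w0 = b - a"
    using ab by (simp add: vw rho_def Tnorm_def)
  \<comment> \<open>A chain in the band lies above \<open>a\<close> and below \<open>b\<close>, so
    avoiding a distance from a ground state means avoiding a single value \<open>t\<close>.\<close>
  have avoid: "x 0 \<noteq> t"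
    if "x \<in> conn \<alpha> \<beta>" "energy_le x (e \<alpha> \<beta>)" "\<alpha> \<in> {a, b}" "\<beta> \<in> {a, b}"
      "\<theta> \<notin> rho d (\<lambda>_. c) ` M1 r s d v0 w0 (\<lambda>_. \<alpha>) (\<lambda>_. \<beta>)" "\<bar>t - c\<bar> = \<theta>" for x \<alpha> \<beta> \<theta> c t
  proof
    assume "x 0 = t"
    then have "rho d (\<lambda>_. c) (lift d x) = \<theta>" using that(6) by (simp add: rho_lift)
    moreover have "lift d x \<in> M1 r s d v0 w0 (\<lambda>_. \<alpha>) (\<lambda>_. \<beta>)"
      using M1_iff[OF that(3,4,1)] that(2) by (simp add: vw)
    ultimately show False using that(5) by blast
  qed
  let ?Q = "\<lambda>l N m. \<exists>U c. minimizer (windows \<rho>1 \<rho>2 \<rho>3 \<rho>4 k m l) U c \<and>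
      ((\<forall>i\<in>{1..2*k}. N \<le> m (2 * i) - m (2 * i - 1)) \<longrightarrow> (\<forall>i. E i U = 0))"
  have "\<exists>l0. \<forall>l\<ge>l0. \<exists>N. \<forall>m. admissible k m l \<longrightarrow> ?Q l N m"
  proof (rule multi_transition_minimizers)
    show "k \<ge> 1" using assms(7) by simp
    show "0 < \<rho>1" "\<rho>1 < b - a" "0 < \<rho>2" "\<rho>2 < b - a" "0 < \<rho>3" "\<rho>3 < b - a" "0 < \<rho>4" "\<rho>4 < b - a"
      using assms(11,13,15,17) by (auto simp: rho_ab)
    then show "x 0 \<noteq> a + \<rho>1" "x 0 \<noteq> b - \<rho>2" if "x \<in> conn a b" "energy_le x (e a b)" for x
      using avoid[OF that, of \<rho>1 a] avoid[OF that, of \<rho>2 b] assms(12,14) by (auto simp: vw)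
    show "x 0 \<noteq> b - \<rho>3" "x 0 \<noteq> a + \<rho>4" if "x \<in> conn b a" "energy_le x (e b a)" for x
      using avoid[OF that, of \<rho>3 b] avoid[OF that, of \<rho>4 a] assms(15-18) by (auto simp: vw)
  qed
  then obtain L where L: "\<And>l. l \<ge> L \<Longrightarrow> \<exists>N. \<forall>m. admissible k m l \<longrightarrow> ?Q l N m"
    by blast
  have Y_eq: "Yset d v0 w0 \<rho>1 \<rho>2 \<rho>3 \<rho>4 k m l = lift d ` Ycon (windows \<rho>1 \<rho>2 \<rho>3 \<rho>4 k m (int l))" for m l
  proof -
    have "lift d x \<in> Yset d v0 w0 \<rho>1 \<rho>2 \<rho>3 \<rho>4 k m l \<longleftrightarrow> x \<in> Ycon (windows \<rho>1 \<rho>2 \<rho>3 \<rho>4 k m (int l))"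
      if "x \<in> conn a a" for x
      using that unfolding Yset_def Ycon_def windows_def vw Gamma1_eq by (auto simp: rho_lift ball_Un)
    moreover have "Yset d v0 w0 \<rho>1 \<rho>2 \<rho>3 \<rho>4 k m l \<subseteq> lift d ` conn a a"
      by (auto simp: Yset_def vw Gamma1_eq)
    moreover have "Ycon (windows \<rho>1 \<rho>2 \<rho>3 \<rho>4 k m (int l)) \<subseteq> conn a a" by (auto simp: Ycon_def)
    ultimately show ?thesis by blast
  qed
  show ?thesis (is "\<exists>l0. \<forall>l\<ge>l0. \<exists>N. \<forall>m. ?A l m \<longrightarrow> ?B l N m")
  proof (intro exI[of _ "nat L"] allI impI)
    fix l :: nat assume "nat L \<le> l"
    then have "int l \<ge> L" by simp
    then obtain N where N: "\<And>m. admissible k m (int l) \<Longrightarrow> ?Q (int l) N m"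
      using L by blast
    show "\<exists>N. \<forall>m. ?A l m \<longrightarrow> ?B l N m"
    proof (intro exI[of _ N] allI impI)
      fix m :: "nat \<Rightarrow> int"
      assume "?A l m"
      then have "admissible k m (int l)" by (simp add: admissible_def)
      then obtain U c where U: "minimizer (windows \<rho>1 \<rho>2 \<rho>3 \<rho>4 k m (int l)) U c"
        "(\<forall>i\<in>{1..2*k}. N \<le> m (2 * i) - m (2 * i - 1)) \<longrightarrow> (\<forall>i. E i U = 0)"
        using N by blast
      show "?B l N m"
      proof (intro bexI[of _ "lift d U"] conjI impI)
        show "lift d U \<in> Yset d v0 w0 \<rho>1 \<rho>2 \<rho>3 \<rho>4 k m l"
          using U(1) by (simp add: Y_eq minimizer_def)
        have "Jlim U = (INF y\<in>Ycon (windows \<rho>1 \<rho>2 \<rho>3 \<rho>4 k m (int l)). Jlim y)"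
          using U(1) by (intro Jlim_minimal[of _ a a]) (auto simp: minimizer_def Ycon_def)
        then show "J1 r s d (lift d U) = b_inf r s d v0 w0 \<rho>1 \<rho>2 \<rho>3 \<rho>4 k m l"
          by (simp add: J1_lift b_inf_def Y_eq image_image)
        show "solution r s (lift d U)" if "\<forall>i\<in>{1..2 * k}. m (2 * i) - m (2 * i - 1) \<ge> N"
          using U(2) that solution_lift by blast
      qed
    qed
  qed
qed

end
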